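(* Fix $p\in(0,1/2]$ and $\varepsilon>0$ with $(1+\varepsilon)p<1$. For integers $n,d\ge2$ let $G$ be the Gaussian random geometric graph on $n$ vertices with edge probability $p$ in dimension $d$, and let $|E(G)|$ be its number of edges. Then there exist constants $c,C>0$ (depending on $p$ and $\varepsilon$ but not on $n,d$) such that for all $n,d\ge 2$, $$\exp\left(-c\min(n^2,n\sqrt d)\right)\le\mathbb P\left(|E(G)|\ge(1+\varepsilon)\binom n2p\right)\le\exp\left(-C\min(n^2,n\sqrt d)\right).$$
   Context: Gaussian random geometric graph: let $\tilde X_1,\dots,\tilde X_n$ be i.i.d. $\mathcal N(0,I_d)$ vectors in $\mathbb R^d$ and let $\tilde t_p=\tilde t_{p,d}$ be such that $\mathbb P(\langle \tilde X_1,\tilde X_2\rangle\ge \tilde t_p)=p$. The graph has vertex set $\{1,\dots,n\}$, with an (undirected) edge between $i\ne j$ iff $\langle \tilde X_i,\tilde X_j\rangle\ge \tilde t_p$. *)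

theory Defs
  imports "HOL-Probability.Probability"
begin

text \<open>
  Vectors in \<open>\<real>\<^sup>d\<close> are functions \<open>nat \<Rightarrow> real\<close> on the index set \<open>{..<d}\<close>, because \<open>d\<close> (and the number
  of vectors \<open>n\<close>) is quantified inside statements.
\<close>

definition dot :: "nat \<Rightarrow> (nat \<Rightarrow> real) \<Rightarrow> (nat \<Rightarrow> real) \<Rightarrow> real" where
  "dot d x y = (\<Sum>k<d. x k * y k)"

text \<open>\<open>N(0, I\<^sub>d)\<close> is the law of \<open>d\<close> independent standard normal coordinates.\<close>

definition std_gaussian :: "nat \<Rightarrow> (nat \<Rightarrow> real) measure" where
  "std_gaussian d = Pi\<^sub>M {..<d} (\<lambda>_. std_normal_distribution)"

definition gaussian_sample :: "nat \<Rightarrow> nat \<Rightarrow> (nat \<Rightarrow> nat \<Rightarrow> real) measure" where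
  "gaussian_sample n d = Pi\<^sub>M {1..n} (\<lambda>_. std_gaussian d)"

definition is_threshold :: "real \<Rightarrow> nat \<Rightarrow> real \<Rightarrow> bool" where
  "is_threshold p d t \<longleftrightarrow>
     measure (std_gaussian d \<Otimes>\<^sub>M std_gaussian d)
       {(x, y) \<in> space (std_gaussian d \<Otimes>\<^sub>M std_gaussian d). dot d x y \<ge> t} = p"

text \<open>
  The edge set of the random geometric graph with vertices \<open>1, \<dots>, n\<close>, as a function of the
  realisation \<open>X\<close> of the \<open>n\<close> vectors; an undirected edge is a two-element set of vertices.
\<close>

definition rgg_edges :: "nat \<Rightarrow> nat \<Rightarrow> real \<Rightarrow> (nat \<Rightarrow> nat \<Rightarrow> real) \<Rightarrow> nat set set" where
  "rgg_edges n d t X =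
     {{i, j} | i j. i \<in> {1..n} \<and> j \<in> {1..n} \<and> i \<noteq> j \<and> dot d (X i) (X j) \<ge> t}"

lemma prob_space_std_normal: "prob_space std_normal_distribution"
  by (rule prob_space_normal_density) simp

lemma prob_space_std_gaussian: "prob_space (std_gaussian d)"
  unfolding std_gaussian_def by (intro prob_space_PiM prob_space_std_normal)

lemma prob_space_gaussian_sample: "prob_space (gaussian_sample n d)"
  unfolding gaussian_sample_def by (intro prob_space_PiM prob_space_std_gaussian)

lemma measurable_coordinate:
  assumes "k < d"
  shows "(\<lambda>x. x k) \<in> borel_measurable (std_gaussian d)"
proof -
  have "(\<lambda>x. x k) \<in> measurable (std_gaussian d) std_normal_distribution"
    unfolding std_gaussian_def using assms by (intro measurable_component_singleton) auto
  then show ?thesis by (simp cong: measurable_cong_sets)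
qed

lemma measurable_dot [measurable]:
  assumes "f \<in> measurable M (std_gaussian d)" "g \<in> measurable M (std_gaussian d)"
  shows "(\<lambda>w. dot d (f w) (g w)) \<in> borel_measurable M"
  unfolding dot_def
  by (intro borel_measurable_sum borel_measurable_times
        measurable_compose[OF assms(1) measurable_coordinate]
        measurable_compose[OF assms(2) measurable_coordinate]) auto

lemma dot_commute: "dot d x y = dot d y x"
  by (simp add: dot_def mult.commute)

lemma card_rgg_edges:
  "real (card (rgg_edges n d t X)) =
     (\<Sum>i\<in>{1..n}. \<Sum>j\<in>{i<..n}. of_bool (dot d (X i) (X j) \<ge> t))"
proof -
  let ?S = "SIGMA i:{1..n}. {i<..n}"
  let ?T = "{(i, j) \<in> ?S. dot d (X i) (X j) \<ge> t}"
  have fin: "finite ?S" by auto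
  have "rgg_edges n d t X = (\<lambda>(i, j). {i, j}) ` ?T"
  proof (intro equalityI subsetI)
    fix e assume "e \<in> rgg_edges n d t X"
    then obtain i j where e: "e = {i, j}" "i \<in> {1..n}" "j \<in> {1..n}" "i \<noteq> j" "dot d (X i) (X j) \<ge> t"
      unfolding rgg_edges_def by blast
    show "e \<in> (\<lambda>(i, j). {i, j}) ` ?T"
    proof (cases "i < j")
      case True
      then show ?thesis using e by (intro image_eqI[of _ _ "(i, j)"]) auto
    next
      case False
      moreover have "dot d (X j) (X i) \<ge> t" using e(5) by (subst dot_commute)
      ultimately show ?thesis using e by (intro image_eqI[of _ _ "(j, i)"]) auto
    qed
  next
    fix e assume "e \<in> (\<lambda>(i, j). {i, j}) ` ?T"
    then obtain i j where "e = {i, j}" "i \<in> {1..n}" "i < j" "j \<le> n" "dot d (X i) (X j) \<ge> t"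
      by auto
    then show "e \<in> rgg_edges n d t X"
      unfolding rgg_edges_def by (intro CollectI exI[of _ i] exI[of _ j]) simp
  qed
  moreover have "inj_on (\<lambda>(i, j). {i, j}) ?T"
    by (auto simp: inj_on_def doubleton_eq_iff)
  ultimately have "real (card (rgg_edges n d t X)) = real (card ?T)"
    by (simp add: card_image)
  also have "\<dots> = (\<Sum>(i, j)\<in>?S. of_bool (dot d (X i) (X j) \<ge> t))"
  proof -
    have "(\<Sum>w\<in>?S. of_bool (dot d (X (fst w)) (X (snd w)) \<ge> t)) = real (card (?S \<inter> {w. dot d (X (fst w)) (X (snd w)) \<ge> t}))"
      using sum_of_bool_eq[OF fin] by simp
    moreover have "?S \<inter> {w. dot d (X (fst w)) (X (snd w)) \<ge> t} = ?T" by auto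
    ultimately show ?thesis by (simp only: case_prod_unfold)
  qed
  also have "\<dots> = (\<Sum>i\<in>{1..n}. \<Sum>j\<in>{i<..n}. of_bool (dot d (X i) (X j) \<ge> t))"
    by (subst sum.Sigma) auto
  finally show ?thesis .
qed

lemma measurable_card_rgg_edges:
  "(\<lambda>X. real (card (rgg_edges n d t X))) \<in> borel_measurable (gaussian_sample n d)"
proof -
  have X: "(\<lambda>X. X i) \<in> measurable (gaussian_sample n d) (std_gaussian d)" if "i \<in> {1..n}" for i
    unfolding gaussian_sample_def using that by (rule measurable_component_singleton)
  have "(\<lambda>X. of_bool (dot d (X i) (X j) \<ge> t) :: real) \<in> borel_measurable (gaussian_sample n d)"
    if "i \<in> {1..n}" "j \<in> {i<..n}" for i j
  proof -
    have [measurable]: "(\<lambda>X. dot d (X i) (X j)) \<in> borel_measurable (gaussian_sample n d)"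
      using that by (intro measurable_dot X) auto
    show ?thesis unfolding of_bool_def by measurable
  qed
  then show ?thesis
    unfolding card_rgg_edges by (intro borel_measurable_sum)
qed

lemma null_dot_level:
  assumes "k < d" "x k \<noteq> 0"
  shows "emeasure (std_gaussian d) {y \<in> space (std_gaussian d). dot d x y = t} = 0"
proof -
  interpret P: product_sigma_finite "\<lambda>_::nat. std_normal_distribution"
    by (intro product_sigma_finite.intro prob_space_imp_sigma_finite prob_space_std_normal)
  let ?I = "{..<d} - {k}"
  have I: "{..<d} = insert k ?I" using assms by auto
  define A where "A = {y \<in> space (std_gaussian d). dot d x y = t}"
  define xr where "xr = restrict x {..<d}"
  have xr: "dot d x = dot d xr" unfolding dot_def xr_def by (intro ext sum.cong) auto
  have "xr \<in> space (std_gaussian d)"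
    unfolding xr_def std_gaussian_def by (auto simp: space_PiM)
  then have A [measurable]: "A \<in> sets (std_gaussian d)"
    unfolding A_def xr by measurable
  have "emeasure (std_gaussian d) A = (\<integral>\<^sup>+ y. indicator A y \<partial>Pi\<^sub>M (insert k ?I) (\<lambda>_. std_normal_distribution))"
    using A I by (simp add: std_gaussian_def)
  also have "\<dots> = (\<integral>\<^sup>+ y. (\<integral>\<^sup>+ z. indicator A (y(k := z)) \<partial>std_normal_distribution)
                     \<partial>Pi\<^sub>M ?I (\<lambda>_. std_normal_distribution))"
    using A I by (intro P.product_nn_integral_insert) (auto simp: std_gaussian_def)
  also have "\<dots> = (\<integral>\<^sup>+ y. 0 \<partial>Pi\<^sub>M ?I (\<lambda>_. std_normal_distribution))"
  proof (intro nn_integral_cong)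
    fix y
    let ?s = "\<Sum>i\<in>?I. x i * y i"
    have d: "dot d x (y(k := z)) = x k * z + ?s" for z
      unfolding dot_def by (subst I, subst sum.insert) (auto intro!: sum.cong)
    have "(\<integral>\<^sup>+ z. indicator A (y(k := z)) \<partial>std_normal_distribution)
           \<le> (\<integral>\<^sup>+ z. indicator {(t - ?s) / x k} z \<partial>std_normal_distribution)"
      using assms(2) by (intro nn_integral_mono)
        (auto simp: indicator_def A_def d field_simps)
    also have "\<dots> = 0"
      by (auto simp: emeasure_density nn_integral_0_iff_AE intro!: AE_I[of _ _ "{(t - ?s) / x k}"])
    finally show "(\<integral>\<^sup>+ z. indicator A (y(k := z)) \<partial>std_normal_distribution) = 0" by simp
  qed
  finally show ?thesis by (simp add: A_def)
qed

lemma threshold_exists: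
  assumes "d \<ge> 1" "0 < p" "p < 1"
  shows "\<exists>t. is_threshold p d t"
proof -
  interpret N: prob_space "std_gaussian d" by (rule prob_space_std_gaussian)
  interpret NN: pair_prob_space "std_gaussian d" "std_gaussian d" ..
  let ?P = "std_gaussian d \<Otimes>\<^sub>M std_gaussian d"
  define f where "f = (\<lambda>(x, y). dot d x y)"
  have f [measurable]: "f \<in> borel_measurable ?P"
    unfolding f_def split_beta by measurable
  define D where "D = distr ?P borel f"
  interpret D: real_distribution D
    unfolding D_def by (intro real_distribution.intro NN.P.prob_space_distr
          real_distribution_axioms.intro) auto
  have null: "emeasure ?P {w \<in> space ?P. f w = t} = 0" for t
  proof -
    have "emeasure (std_gaussian d) {x \<in> space (std_gaussian d). dot d (\<lambda>i. if i = 0 then 1 else 0) x = 0} = 0"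
      using assms(1) by (intro null_dot_level[of 0]) auto
    moreover have "dot d (\<lambda>i. if i = 0 then 1 else 0) x = x 0" for x
      unfolding dot_def using assms(1) by (subst sum.remove[of _ 0]) auto
    ultimately have "emeasure (std_gaussian d) {x \<in> space (std_gaussian d). x 0 = 0} = 0" by simp
    moreover have "{x \<in> space (std_gaussian d). x 0 = 0} \<in> sets (std_gaussian d)"
    proof -
      have [measurable]: "(\<lambda>x. x 0) \<in> borel_measurable (std_gaussian d)"
        using assms(1) by (intro measurable_coordinate) auto
      show ?thesis by measurable
    qed
    ultimately have ae: "AE x in std_gaussian d. x 0 \<noteq> 0"
      by (intro AE_I[of _ _ "{x \<in> space (std_gaussian d). x 0 = 0}"]) auto
    have "emeasure ?P {w \<in> space ?P. f w = t}
        = (\<integral>\<^sup>+ x. emeasure (std_gaussian d) (Pair x -` {w \<in> space ?P. f w = t}) \<partial>std_gaussian d)"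
      by (intro N.emeasure_pair_measure_alt) measurable
    also have "\<dots> = (\<integral>\<^sup>+ x. 0 \<partial>std_gaussian d)"
    proof (intro nn_integral_cong_AE, use ae in eventually_elim)
      fix x :: "nat \<Rightarrow> real" assume x: "x 0 \<noteq> 0"
      have "emeasure (std_gaussian d) (Pair x -` {w \<in> space ?P. f w = t})
         \<le> emeasure (std_gaussian d) {y \<in> space (std_gaussian d). dot d x y = t}"
      proof (cases "x \<in> space (std_gaussian d)")
        case True
        then have "Pair x -` {w \<in> space ?P. f w = t} = {y \<in> space (std_gaussian d). dot d x y = t}"
          by (auto simp: space_pair_measure f_def)
        then show ?thesis by (simp only: order_refl)
      next
        case False
        then have "Pair x -` {w \<in> space ?P. f w = t} = {}"
          by (auto simp: space_pair_measure)
        then show ?thesis by (simp only: emeasure_empty zero_le)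
      qed
      also have "\<dots> = 0" using x assms(1) by (intro null_dot_level[of 0]) auto
      finally show "emeasure (std_gaussian d) (Pair x -` {w \<in> space ?P. f w = t}) = 0" by simp
    qed
    finally show ?thesis by simp
  qed
  have cont: "isCont (cdf D) x" for x
  proof -
    have "f -` {x} \<inter> space ?P = {w \<in> space ?P. f w = x}" by auto
    then show ?thesis
      unfolding D.isCont_cdf by (simp add: D_def measure_def emeasure_distr null)
  qed
  have "eventually (\<lambda>x. cdf D x < 1 - p) at_bot"
    using D.cdf_lim_at_bot assms by (intro order_tendstoD) auto
  then obtain a where a: "cdf D a < 1 - p" by (metis eventually_at_bot_linorder order_refl)
  have "eventually (\<lambda>x. cdf D x > 1 - p) at_top"
    using D.cdf_lim_at_top_prob assms by (intro order_tendstoD) auto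
  then obtain b where b: "cdf D b > 1 - p" by (metis eventually_at_top_linorder order_refl)
  have "a \<le> b" using a b D.cdf_nondecreasing[of b a] by linarith
  then obtain t where t: "cdf D t = 1 - p"
    using IVT[of "cdf D" a "1 - p" b] a b cont by auto
  have "measure D {..<t} = measure D {..t} - measure D {t}"
    by (subst D.finite_measure_Diff[symmetric]) (auto intro!: arg_cong[where f = "measure D"])
  also have "measure D {t} = 0" using cont D.isCont_cdf by simp
  finally have "measure D {..<t} = 1 - p" using t by (simp add: cdf_def)
  moreover have "measure D {t..} = 1 - measure D {..<t}"
    using D.prob_compl[of "{..<t}"] by (simp add: D.space_eq_univ Compl_eq_Diff_UNIV[symmetric] D_def)
  ultimately have "measure D {t..} = p" by simp
  moreover have "measure D {t..} = measure ?P (f -` {t..} \<inter> space ?P)"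
    unfolding D_def by (simp add: measure_distr)
  moreover have "f -` {t..} \<inter> space ?P = {(x, y) \<in> space ?P. dot d x y \<ge> t}"
    by (auto simp: f_def)
  ultimately show ?thesis by (auto simp: is_threshold_def)
qed

end

theory Submission
  imports Defs
begin

text \<open>
  Upper bound. In \<open>\<real>\<^sup>n\<^sup>d\<close> the Gaussian measure satisfies \<open>\<gamma>(A) \<gamma>(B) \<le> exp (- r\<^sup>2 / 4)\<close> when \<open>A\<close> and \<open>B\<close> are at
  distance \<open>r\<close>. Let \<open>A\<close> be the event of too many edges, and let \<open>B\<close> be the event that few pairs have inner product
  at least \<open>t - \<delta> \<surd>d\<close> and that the Gram matrix is within \<open>K n \<surd>d\<close> of \<open>d I\<close> in Frobenius norm; second moments and
  anticoncentration of the inner product bound the probability of \<open>B\<close> from below. For \<open>X\<close> in \<open>A\<close> and \<open>Y\<close> in \<open>B\<close> the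
  Gram matrices are at distance of order \<open>n \<surd>d\<close>. Since the operator norm of the Gram matrix of \<open>Y\<close> is at most
  \<open>d + K n \<surd>d\<close>, this forces \<open>\<parallel>X - Y\<parallel>\<^sup>2\<close> to be of order \<open>min (n\<^sup>2, n \<surd>d)\<close>.

  Lower bound. A volume preserving change of variables turns a typical sample into one with many edges, and the loss of
  Gaussian density is the cost. If \<open>n\<close> is at most of order \<open>\<surd>d\<close>, add to each \<open>X i\<close> the sum of the preceding vectors,
  scaled by a constant over \<open>\<surd>d\<close>; otherwise add to every vector a fixed vector of squared length of order \<open>\<surd>d\<close>.
\<close>

text \<open>The edge count is discontinuous in the sample and the Gram matrix is quadratic in it, so
  concentration of Lipschitz functions does not apply directly. The lowered threshold in B repairs
  the first point: a pair counted for X at \<open>t\<close> but not for Y at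
  \<open>t - \<delta> * sqrt d\<close> contributes at least \<delta>^2 d to the squared Frobenius
  distance. As concentration is applied to two sets, only Y needs a controlled Gram matrix. Then |X
  - Y|^2 is at least of order n^2 d / (d + n sqrt d), which is the minimum in the theorem. The
  probability of B is only bounded below by a constant; this loss is absorbed when the minimum is
  large, and Markov's inequality serves when it is bounded. The two-set inequality comes from a
  midpoint inequality on the line that tensorizes. In the lower bound the changes of variables are
  triangular with ones on the diagonal, so no determinant occurs. They can produce any proportion of
  edges below 1, which is where (1 + \<epsilon>) p < 1 enters.\<close>

subsection \<open>One-dimensional Prekopa--Leindler inequality\<close>

text \<open>Sup A may fail to lie in A, so A is exhausted by half-lines ending at an increasing
  sequence, each term of which is exceeded by a point of A; at most the null point Sup A is lost.
  The midpoint argument can then cut at points of A without passing to compact sets.\<close>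

lemma emeasure_le_of_truncations:
  fixes A :: "real set"
  assumes A [measurable]: "A \<in> sets borel" and ne: "A \<noteq> {}"
    and le: "\<And>a. a \<in> A \<Longrightarrow> emeasure lborel (A \<inter> {..<a}) \<le> c"
  shows "emeasure lborel A \<le> c"
proof -
  have lim: "emeasure lborel (A \<inter> (\<Union>n. {..<s n})) \<le> c"
    if s: "incseq s" "\<And>n. \<exists>a\<in>A. s n < a" for s :: "nat \<Rightarrow> real"
  proof -
    have "emeasure lborel (A \<inter> {..<s n}) \<le> c" for n
    proof -
      obtain a where a: "a \<in> A" "s n < a" using s by blast
      have "emeasure lborel (A \<inter> {..<s n}) \<le> emeasure lborel (A \<inter> {..<a})"
        using a by (intro emeasure_mono) auto
      with le[OF a(1)] show ?thesis by order
    qed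
    moreover have "(SUP n. emeasure lborel (A \<inter> {..<s n})) = emeasure lborel (\<Union>n. A \<inter> {..<s n})"
      using s(1) by (intro SUP_emeasure_incseq) (auto simp: incseq_def intro: order_less_le_trans)
    ultimately show ?thesis by (metis Int_UN_distrib SUP_least)
  qed
  show ?thesis
  proof (cases "bdd_above A")
    case True
    define s where "s n = Sup A - inverse (real (Suc n))" for n
    have "incseq s" unfolding s_def
      by (intro monoI diff_left_mono le_imp_inverse_le) auto
    moreover have "\<exists>a\<in>A. s n < a" for n
      using less_cSup_iff[OF ne True, of "s n"] by (auto simp: s_def)
    ultimately have "emeasure lborel (A \<inter> (\<Union>n. {..<s n})) \<le> c" by (rule lim)
    moreover have "AE x in lborel. x \<in> A \<longrightarrow> x \<in> A \<inter> (\<Union>n. {..<s n})"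
    proof (rule AE_I[of _ _ "{Sup A}"])
      show "{x \<in> space lborel. \<not> (x \<in> A \<longrightarrow> x \<in> A \<inter> (\<Union>n. {..<s n}))} \<subseteq> {Sup A}"
      proof (rule ccontr)
        assume "\<not> ?thesis"
        then obtain x where x: "x \<in> A" "\<And>n. s n \<le> x" "x \<noteq> Sup A" by (force simp: not_less)
        then have "x < Sup A" using cSup_upper[OF x(1) True] by simp
        then obtain n where "inverse (real (Suc n)) < Sup A - x"
          using reals_Archimedean[of "Sup A - x"] by auto
        with x(2)[of n] show False by (simp add: s_def)
      qed
    qed auto
    then have "emeasure lborel A \<le> emeasure lborel (A \<inter> (\<Union>n. {..<s n}))"
      by (intro emeasure_mono_AE) auto
    ultimately show ?thesis by order
  next
    case False
    have "(\<Union>n. {..<real n}) = UNIV" using reals_Archimedean2 by auto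
    moreover have "\<exists>a\<in>A. real n < a" for n using False by (force simp: bdd_above_def not_le)
    moreover have "incseq real" by (auto simp: incseq_def)
    ultimately show ?thesis using lim[of real] by simp
  qed
qed

lemma emeasure_le_of_truncations':
  fixes A :: "real set"
  assumes A [measurable]: "A \<in> sets borel" and ne: "A \<noteq> {}"
    and le: "\<And>a. a \<in> A \<Longrightarrow> emeasure lborel (A \<inter> {a<..}) \<le> c"
  shows "emeasure lborel A \<le> c"
proof -
  have refl: "emeasure lborel (uminus -` S) = emeasure lborel S" if [measurable]: "S \<in> sets borel" for S :: "real set"
  proof -
    have "emeasure (distr lborel borel uminus) S = emeasure lborel (uminus -` S)"
      by (subst emeasure_distr) auto
    then show ?thesis by (simp add: lborel_distr_uminus)
  qed
  have sets: "uminus -` S \<in> sets borel" if "S \<in> sets borel" for S :: "real set"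
    using measurable_sets[of uminus "borel :: real measure" borel S] that by simp
  have "emeasure lborel (uminus -` A) \<le> c"
  proof (rule emeasure_le_of_truncations)
    show "uminus -` A \<noteq> {}" using ne by (metis ex_in_conv vimage_eq verit_minus_simplify(4))
    fix a assume "a \<in> uminus -` A"
    then have "emeasure lborel (A \<inter> {-a<..}) \<le> c" by (intro le) auto
    moreover have "uminus -` A \<inter> {..<a} = uminus -` (A \<inter> {-a<..})" by auto
    ultimately show "emeasure lborel (uminus -` A \<inter> {..<a}) \<le> c" using refl[of "A \<inter> {-a<..}"] by simp
  qed (simp add: sets)
  then show ?thesis by (simp add: refl)
qed

text \<open>Brunn-Minkowski on the line. For a in A and b in B, the midpoints of b with the part of
  A below a, and those of a with the part of B above b, lie on different sides of (a + b) / 2. They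
  are disjoint subsets of C with half the measure of these parts. A measurable C containing the
  midpoints replaces the sumset, whose measurability is not clear.\<close>

lemma emeasure_midpoint_sumset:
  fixes A B C :: "real set"
  assumes [measurable]: "A \<in> sets borel" "B \<in> sets borel" "C \<in> sets borel"
    and ne: "A \<noteq> {}" "B \<noteq> {}"
    and mid: "\<And>x y. x \<in> A \<Longrightarrow> y \<in> B \<Longrightarrow> (x + y) / 2 \<in> C"
  shows "emeasure lborel A + emeasure lborel B \<le> 2 * emeasure lborel C"
proof (cases "emeasure lborel C = \<infinity>")
  case True
  then show ?thesis by (simp add: ennreal_mult_top)
next
  case fin: False
  have half: "emeasure lborel S = 2 * emeasure lborel ((\<lambda>z. 2 * z - b) -` S)"
    if [measurable]: "S \<in> sets borel" for S :: "real set" and b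
  proof -
    have "emeasure lborel S = emeasure (density (distr lborel borel (\<lambda>z. - b + 2 * z)) (\<lambda>_. ennreal \<bar>2\<bar>)) S"
      by (subst (1) lborel_real_affine[of 2 "-b"]) auto
    also have "\<dots> = 2 * emeasure lborel ((\<lambda>z. - b + 2 * z) -` S)"
      by (simp add: emeasure_density_const emeasure_distr)
    finally show ?thesis by (simp add: algebra_simps)
  qed
  have trunc: "emeasure lborel (A \<inter> {..<a}) + emeasure lborel (B \<inter> {b<..}) \<le> 2 * emeasure lborel C"
    if ab: "a \<in> A" "b \<in> B" for a b
  proof -
    let ?A = "(\<lambda>z. 2 * z - b) -` (A \<inter> {..<a})" and ?B = "(\<lambda>z. 2 * z - a) -` (B \<inter> {b<..})"
    have s: "?A \<in> sets borel" "?B \<in> sets borel"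
      using measurable_sets[of "\<lambda>z::real. 2 * z - b" borel borel "A \<inter> {..<a}"]
        measurable_sets[of "\<lambda>z::real. 2 * z - a" borel borel "B \<inter> {b<..}"] by auto
    have "?A \<subseteq> C" using mid[OF _ ab(2)] by force
    moreover have "?B \<subseteq> C" using mid[OF ab(1)] by force
    moreover have "?A \<inter> ?B = {}" by auto
    ultimately have "emeasure lborel ?A + emeasure lborel ?B \<le> emeasure lborel C"
      using s by (subst plus_emeasure) (auto intro!: emeasure_mono)
    then have "2 * (emeasure lborel ?A + emeasure lborel ?B) \<le> 2 * emeasure lborel C"
      by (intro mult_left_mono) auto
    then show ?thesis
      by (simp add: half[of "A \<inter> {..<a}" b] half[of "B \<inter> {b<..}" a] distrib_left)
  qed
  have fin2: "2 * emeasure lborel C \<noteq> \<infinity>" using fin by (simp add: ennreal_mult_eq_top_iff)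
  \<comment> \<open>The cuts are removed one after the other, because the bound has to stay fixed
    while a cut moves. Moving the other summand across in \<open>ennreal\<close> requires it to be
    finite.\<close>
  have *: "emeasure lborel A + emeasure lborel (B \<inter> {b<..}) \<le> 2 * emeasure lborel C" if "b \<in> B" for b
  proof -
    obtain a where "a \<in> A" using ne by auto
    have fB: "emeasure lborel (B \<inter> {b<..}) \<noteq> \<infinity>"
      using trunc[OF \<open>a \<in> A\<close> that] fin2 by (metis add.commute ennreal_add_eq_top infinity_ennreal_def top.extremum_uniqueI)
    have "emeasure lborel A \<le> 2 * emeasure lborel C - emeasure lborel (B \<inter> {b<..})"
    proof (rule emeasure_le_of_truncations)
      fix a assume "a \<in> A"
      from trunc[OF this that] show "emeasure lborel (A \<inter> {..<a}) \<le> 2 * emeasure lborel C - emeasure lborel (B \<inter> {b<..})"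
        by (subst ennreal_le_minus_iff) simp
    qed (use ne in auto)
    then have "emeasure lborel A + emeasure lborel (B \<inter> {b<..}) \<le> 2 * emeasure lborel C - emeasure lborel (B \<inter> {b<..}) + emeasure lborel (B \<inter> {b<..})"
      by (rule add_right_mono)
    also have "\<dots> = 2 * emeasure lborel C"
      using trunc[OF \<open>a \<in> A\<close> that] by (intro diff_add_cancel_ennreal) (rule order_trans[OF add_increasing[OF zero_le order_refl]])
    finally show ?thesis .
  qed
  obtain b where "b \<in> B" using ne by auto
  have fA: "emeasure lborel A \<noteq> \<infinity>"
    using *[OF \<open>b \<in> B\<close>] fin2 by (metis ennreal_add_eq_top infinity_ennreal_def top.extremum_uniqueI)
  have AC: "emeasure lborel A \<le> 2 * emeasure lborel C"
    using *[OF \<open>b \<in> B\<close>] by (rule order_trans[OF add_increasing2[OF zero_le order_refl]])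
  have "emeasure lborel B \<le> 2 * emeasure lborel C - emeasure lborel A"
  proof (rule emeasure_le_of_truncations')
    fix b assume "b \<in> B"
    then show "emeasure lborel (B \<inter> {b<..}) \<le> 2 * emeasure lborel C - emeasure lborel A"
      using *[of b] by (subst ennreal_le_minus_iff) (simp add: add.commute)
  qed (use ne in auto)
  then have "emeasure lborel A + emeasure lborel B \<le> emeasure lborel A + (2 * emeasure lborel C - emeasure lborel A)"
    by (rule add_left_mono)
  also have "\<dots> = 2 * emeasure lborel C" using AC by (simp add: add.commute diff_add_cancel_ennreal)
  finally show ?thesis .
qed

lemma nn_integral_layer_cake:
  fixes f :: "real \<Rightarrow> real"
  assumes [measurable]: "f \<in> borel_measurable borel" and pos: "\<And>x. 0 \<le> f x"
  shows "(\<integral>\<^sup>+x. f x \<partial>lborel) = (\<integral>\<^sup>+l. indicator {0<..} l * emeasure lborel {x. l < f x} \<partial>lborel)"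
proof -
  have "(\<integral>\<^sup>+x. f x \<partial>lborel) = (\<integral>\<^sup>+x. (\<integral>\<^sup>+l. indicator {0<..} l * indicator {z. z < f x} l \<partial>lborel) \<partial>lborel)"
  proof (intro nn_integral_cong)
    fix x
    have "(\<integral>\<^sup>+l. indicator {0<..} l * indicator {z. z < f x} l \<partial>lborel) = (\<integral>\<^sup>+l. indicator {0<..<f x} l \<partial>lborel)"
      by (intro nn_integral_cong) (auto simp: indicator_def)
    then show "ennreal (f x) = (\<integral>\<^sup>+l. indicator {0<..} l * indicator {z. z < f x} l \<partial>lborel)"
      using pos[of x] by simp
  qed
  also have "\<dots> = (\<integral>\<^sup>+l. (\<integral>\<^sup>+x. indicator {0<..} l * indicator {z. z < f x} l \<partial>lborel) \<partial>lborel)"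
  proof (rule lborel_pair.Fubini'[symmetric])
    have [measurable]: "Measurable.pred (borel \<Otimes>\<^sub>M borel) (\<lambda>z. snd z < f (fst z))" by measurable
    have "(\<lambda>z. indicator {0<..} (snd z) * indicator {z. snd z < f (fst z)} z :: ennreal) \<in> borel_measurable (borel \<Otimes>\<^sub>M borel)"
      by measurable
    then show "(\<lambda>(x, l). indicator {0<..} l * indicator {z. z < f x} l :: ennreal) \<in> borel_measurable (lborel \<Otimes>\<^sub>M lborel)"
      by (simp add: case_prod_unfold indicator_def cong: measurable_cong_sets)
  qed
  also have "\<dots> = (\<integral>\<^sup>+l. indicator {0<..} l * emeasure lborel {x. l < f x} \<partial>lborel)"
  proof (intro nn_integral_cong)
    fix l
    have "(\<integral>\<^sup>+x. indicator {0<..} l * indicator {z. z < f x} l \<partial>lborel) = (\<integral>\<^sup>+x. indicator {0<..} l * indicator {x. l < f x} x \<partial>lborel)"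
      by (intro nn_integral_cong) (auto simp: indicator_def)
    also have "\<dots> = indicator {0<..} l * emeasure lborel {x. l < f x}"
      by (subst nn_integral_cmult) auto
    finally show "(\<integral>\<^sup>+x. indicator {0<..} l * indicator {z. z < f x} l \<partial>lborel) = indicator {0<..} l * emeasure lborel {x. l < f x}" .
  qed
  finally show ?thesis .
qed

text \<open>With both suprema equal to 1, the level sets of f and g are nonempty below level 1 and
  empty from there on, so the sumset inequality holds at every level and the layer cake formula
  integrates it. Nonemptiness matters: the sumset inequality fails if just one of the sets is
  empty.\<close>

lemma prekopa_leindler_normalized:
  fixes f g h :: "real \<Rightarrow> real"
  assumes [measurable]: "f \<in> borel_measurable borel" "g \<in> borel_measurable borel" "h \<in> borel_measurable borel"
    and f: "\<And>x. 0 \<le> f x" "\<And>x. f x \<le> 1" "\<And>l. l < 1 \<Longrightarrow> \<exists>x. l < f x"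
    and g: "\<And>x. 0 \<le> g x" "\<And>x. g x \<le> 1" "\<And>l. l < 1 \<Longrightarrow> \<exists>x. l < g x"
    and h: "\<And>x. 0 \<le> h x" "\<And>x y. f x * g y \<le> (h ((x + y) / 2))\<^sup>2"
  shows "(\<integral>\<^sup>+x. f x \<partial>lborel) + (\<integral>\<^sup>+x. g x \<partial>lborel) \<le> 2 * (\<integral>\<^sup>+x. h x \<partial>lborel)"
proof -
  have meas [measurable]: "(\<lambda>l. emeasure lborel {x. l < k x}) \<in> borel_measurable borel"
    if [measurable]: "k \<in> borel_measurable borel" for k :: "real \<Rightarrow> real"
  proof -
    have "Measurable.pred (borel \<Otimes>\<^sub>M lborel) (\<lambda>z. fst z < k (snd z))" by measurable
    then have "{z. fst z < k (snd z)} \<in> sets (borel \<Otimes>\<^sub>M lborel)"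
      by (simp add: pred_def space_pair_measure)
    from lborel.measurable_emeasure_Pair[OF this] show ?thesis by (simp add: vimage_def)
  qed
  have le: "indicator {0<..} l * emeasure lborel {x. l < f x} + indicator {0<..} l * emeasure lborel {x. l < g x}
     \<le> 2 * (indicator {0<..} l * emeasure lborel {x. l < h x})" for l :: real
  proof -
    consider "l \<le> 0" | "l \<ge> 1" | "0 < l" "l < 1" by linarith
    then show ?thesis
    proof cases
      case 1 then show ?thesis by simp
    next
      case 2
      then have "{x. l < f x} = {}" "{x. l < g x} = {}"
        using f(2) g(2) by (auto simp: not_less intro: order_trans)
      then show ?thesis by simp
    next
      case 3
      have "emeasure lborel {x. l < f x} + emeasure lborel {x. l < g x} \<le> 2 * emeasure lborel {x. l < h x}"
      proof (rule emeasure_midpoint_sumset)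
        show "{x. l < f x} \<noteq> {}" "{x. l < g x} \<noteq> {}" using f(3) g(3) 3 by auto
        fix x y assume "x \<in> {x. l < f x}" "y \<in> {x. l < g x}"
        then have "l * l < f x * g y" using 3 by (intro mult_strict_mono') auto
        also have "\<dots> \<le> (h ((x + y) / 2))\<^sup>2" by (rule h)
        finally have "l\<^sup>2 < (h ((x + y) / 2))\<^sup>2" by (simp add: power2_eq_square)
        then show "(x + y) / 2 \<in> {x. l < h x}" using h(1) by (auto dest: power2_less_imp_less)
      qed measurable
      then show ?thesis using 3 by simp
    qed
  qed
  show ?thesis
    unfolding nn_integral_layer_cake[OF assms(1) f(1)] nn_integral_layer_cake[OF assms(2) g(1)]
      nn_integral_layer_cake[OF assms(3) h(1)]
    by (subst nn_integral_add[symmetric], measurable, subst nn_integral_cmult[symmetric], measurable)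
      (intro nn_integral_mono le)
qed

subsection \<open>Gaussian concentration\<close>

text \<open>
  Maurey's property \<open>(\<tau>)\<close>, stated for pairs \<open>u\<close>, \<open>v\<close> instead of a function and its
  infimum convolution, so that no measurability question arises for the latter.
\<close>

definition property_tau :: "'a measure \<Rightarrow> ('a \<Rightarrow> 'a \<Rightarrow> real) \<Rightarrow> bool" where
  "property_tau M c \<longleftrightarrow>
     (\<forall>u\<in>borel_measurable M. \<forall>v\<in>borel_measurable M.
        (\<forall>x\<in>space M. \<forall>y\<in>space M. u x * v y \<le> ennreal (exp (c x y))) \<longrightarrow>
        (\<integral>\<^sup>+x. u x \<partial>M) * (\<integral>\<^sup>+x. v x \<partial>M) \<le> 1)"

lemma std_normal_density_le_1: "std_normal_density x \<le> 1"
proof -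
  have "1 / sqrt (2 * pi) \<le> 1" using pi_gt3 by (simp add: divide_le_eq)
  then have "std_normal_density x \<le> 1 * 1" unfolding std_normal_density_def by (intro mult_mono) auto
  then show ?thesis by simp
qed

text \<open>The cost (x - y)^2 / 4 is exactly what turns the product of the Gaussian densities at x
  and y into the squared density at the midpoint. So u and v times the density satisfy the
  hypothesis of the midpoint inequality, with the density itself as h.\<close>

lemma property_tau_std_normal: "property_tau std_normal_distribution (\<lambda>x y. (x - y)\<^sup>2 / 4)"
  unfolding property_tau_def
proof (intro ballI impI)
  fix u v :: "real \<Rightarrow> ennreal"
  assume "u \<in> borel_measurable std_normal_distribution" "v \<in> borel_measurable std_normal_distribution"
  then have [measurable]: "u \<in> borel_measurable borel" "v \<in> borel_measurable borel"
    by (simp_all cong: measurable_cong_sets)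
  assume uv: "\<forall>x\<in>space std_normal_distribution. \<forall>y\<in>space std_normal_distribution.
    u x * v y \<le> ennreal (exp ((x - y)\<^sup>2 / 4))"
  let ?\<phi> = std_normal_density
  define a b where "a x = ennreal (?\<phi> x) * u x" and "b x = ennreal (?\<phi> x) * v x" for x
  have [measurable]: "a \<in> borel_measurable borel" "b \<in> borel_measurable borel"
    unfolding a_def b_def by measurable
  have int: "(\<integral>\<^sup>+x. u x \<partial>std_normal_distribution) = (\<integral>\<^sup>+x. a x \<partial>lborel)"
    "(\<integral>\<^sup>+x. v x \<partial>std_normal_distribution) = (\<integral>\<^sup>+x. b x \<partial>lborel)"
    by (simp_all add: nn_integral_density a_def b_def)
  have ab: "a x * b y \<le> ennreal ((?\<phi> ((x + y) / 2))\<^sup>2)" for x y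
  proof -
    have "a x * b y = ennreal (?\<phi> x * ?\<phi> y) * (u x * v y)"
      unfolding a_def b_def by (simp add: ennreal_mult mult_ac)
    also have "\<dots> \<le> ennreal (?\<phi> x * ?\<phi> y) * ennreal (exp ((x - y)\<^sup>2 / 4))"
      using uv by (intro mult_left_mono) auto
    also have "\<dots> = ennreal (?\<phi> x * ?\<phi> y * exp ((x - y)\<^sup>2 / 4))"
      by (subst ennreal_mult) auto
    also have "?\<phi> x * ?\<phi> y * exp ((x - y)\<^sup>2 / 4) = (?\<phi> ((x + y) / 2))\<^sup>2"
    proof -
      have "exp (- (x\<^sup>2 / 2)) * exp (- (y\<^sup>2 / 2)) * exp ((x - y)\<^sup>2 / 4) = exp (- (((x + y) / 2)\<^sup>2 / 2)) * exp (- (((x + y) / 2)\<^sup>2 / 2))"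
        unfolding exp_add[symmetric] by (rule arg_cong[where f = exp]) (simp add: power2_eq_square field_simps)
      then show ?thesis
        by (simp add: std_normal_density_def power2_eq_square field_simps)
    qed
    finally show ?thesis .
  qed
  have \<phi>1: "(?\<phi> x)\<^sup>2 \<le> 1" for x
    using std_normal_density_le_1[of x] by (simp add: power_le_one)
  have ab1: "a x * b y \<le> 1" for x y
    using ab[of x y] \<phi>1[of "(x + y) / 2"] by (meson ennreal_le_1 order_trans)
  show "(\<integral>\<^sup>+x. u x \<partial>std_normal_distribution) * (\<integral>\<^sup>+x. v x \<partial>std_normal_distribution) \<le> 1"
  proof (cases "(\<integral>\<^sup>+x. a x \<partial>lborel) = 0 \<or> (\<integral>\<^sup>+x. b x \<partial>lborel) = 0")
    case True
    then show ?thesis by (auto simp: int)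
  next
    case False
    have "\<exists>x0. a x0 \<noteq> 0" "\<exists>y0. b y0 \<noteq> 0"
      using False nn_integral_cong[of lborel a "\<lambda>_. 0"] nn_integral_cong[of lborel b "\<lambda>_. 0"] by auto
    then obtain x0 y0 where x0: "a x0 \<noteq> 0" and y0: "b y0 \<noteq> 0" by blast
    \<comment> \<open>Since a and b have products at most 1, comparing the supremum of each with a
      nonzero value of the other shows that both suprema are finite.\<close>
    have top: "s = 0 \<or> s < top" if "s * r \<le> 1" "r \<noteq> 0" for s r :: ennreal
      using that by (cases s; cases r) (auto simp: ennreal_mult_top ennreal_top_mult top_unique)
    define A B where "A = (SUP x. a x)" and "B = (SUP x. b x)"
    have A0: "A \<noteq> 0" unfolding A_def using x0 by (metis SUP_upper UNIV_I le_zero_eq)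
    have B0: "B \<noteq> 0" unfolding B_def using y0 by (metis SUP_upper UNIV_I le_zero_eq)
    have "(SUP x. a x * b y0) \<le> 1" "(SUP x. b x * a x0) \<le> 1"
      using ab1 by (auto intro!: SUP_least simp: mult.commute)
    then have "A * b y0 \<le> 1" "B * a x0 \<le> 1"
      by (simp_all add: A_def B_def SUP_mult_right_ennreal)
    then have "A < top" using top y0 A0 by blast
    then obtain \<alpha> where \<alpha>: "A = ennreal \<alpha>" "\<alpha> > 0"
      using A0 by (cases A) (auto simp: less_le)
    have "B < top" using top \<open>B * a x0 \<le> 1\<close> x0 B0 by blast
    then obtain \<beta> where \<beta>: "B = ennreal \<beta>" "\<beta> > 0"
      using B0 by (cases B) (auto simp: less_le)
    \<comment> \<open>Dividing by the suprema normalizes f and g; dividing h by their geometric mean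
      preserves f g \<le> h^2.\<close>
    define f g h where "f x = enn2real (a x) / \<alpha>" and "g x = enn2real (b x) / \<beta>"
      and "h x = ?\<phi> x / sqrt (\<alpha> * \<beta>)" for x
    have aA: "a x \<le> ennreal \<alpha>" and bB: "b x \<le> ennreal \<beta>" for x
      unfolding \<alpha>(1)[symmetric] \<beta>(1)[symmetric] A_def B_def by (auto intro: SUP_upper)
    have af: "a x = ennreal \<alpha> * ennreal (f x)" and bg: "b x = ennreal \<beta> * ennreal (g x)" for x
      using aA[of x] bB[of x] \<alpha>(2) \<beta>(2)
      by (auto simp: f_def g_def ennreal_mult[symmetric] ennreal_enn2real_if top_unique)
    have [measurable]: "f \<in> borel_measurable borel" "g \<in> borel_measurable borel" "h \<in> borel_measurable borel"
      unfolding f_def g_def h_def by measurable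
    have "(\<integral>\<^sup>+x. f x \<partial>lborel) + (\<integral>\<^sup>+x. g x \<partial>lborel) \<le> 2 * (\<integral>\<^sup>+x. h x \<partial>lborel)"
    proof (rule prekopa_leindler_normalized)
      fix x y l :: real
      show "0 \<le> f x" "0 \<le> g x" "0 \<le> h x" using \<alpha> \<beta> by (auto simp: f_def g_def h_def)
      show "f x \<le> 1" "g x \<le> 1"
        using aA[of x] bB[of x] \<alpha>(2) \<beta>(2) enn2real_mono[of "a x" "ennreal \<alpha>"] enn2real_mono[of "b x" "ennreal \<beta>"]
        by (auto simp: f_def g_def)
      show "f x * g y \<le> (h ((x + y) / 2))\<^sup>2"
      proof -
        have "enn2real (a x) * enn2real (b y) \<le> (?\<phi> ((x + y) / 2))\<^sup>2"
          using enn2real_mono[OF ab[of x y]] by (simp add: enn2real_mult)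
        then show ?thesis using \<alpha>(2) \<beta>(2)
          by (simp add: f_def g_def h_def power_divide divide_right_mono)
      qed
      assume l: "l < 1"
      have "\<exists>x. max l 0 * \<alpha> < enn2real (a x)"
      proof -
        have "max l 0 * \<alpha> < \<alpha>" using l \<alpha>(2) by (auto simp: max_def)
        then have "ennreal (max l 0 * \<alpha>) < A" using \<alpha> by (simp add: ennreal_lessI)
        then obtain x where "ennreal (max l 0 * \<alpha>) < a x" unfolding A_def less_SUP_iff by auto
        then show ?thesis using aA[of x] \<alpha>(2)
          by (intro exI[of _ x]) (cases "a x", auto simp: ennreal_less_iff top_unique)
      qed
      then obtain x where "max l 0 * \<alpha> < enn2real (a x)" ..
      moreover have "l * \<alpha> \<le> max l 0 * \<alpha>" using \<alpha>(2) by (intro mult_right_mono) auto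
      ultimately have "l < f x" unfolding f_def pos_less_divide_eq[OF \<alpha>(2)] by (rule le_less_trans[rotated])
      then show "\<exists>x. l < f x" ..
      have "\<exists>x. max l 0 * \<beta> < enn2real (b x)"
      proof -
        have "max l 0 * \<beta> < \<beta>" using l \<beta>(2) by (auto simp: max_def)
        then have "ennreal (max l 0 * \<beta>) < B" using \<beta> by (simp add: ennreal_lessI)
        then obtain x where "ennreal (max l 0 * \<beta>) < b x" unfolding B_def less_SUP_iff by auto
        then show ?thesis using bB[of x] \<beta>(2)
          by (intro exI[of _ x]) (cases "b x", auto simp: ennreal_less_iff top_unique)
      qed
      then obtain x where "max l 0 * \<beta> < enn2real (b x)" ..
      moreover have "l * \<beta> \<le> max l 0 * \<beta>" using \<beta>(2) by (intro mult_right_mono) auto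
      ultimately have "l < g x" unfolding g_def pos_less_divide_eq[OF \<beta>(2)] by (rule le_less_trans[rotated])
      then show "\<exists>x. l < g x" ..
    qed measurable
    also have "(\<integral>\<^sup>+x. h x \<partial>lborel) = ennreal (1 / sqrt (\<alpha> * \<beta>))"
    proof -
      have "(\<integral>\<^sup>+x. h x \<partial>lborel) = (\<integral>\<^sup>+x. ennreal (?\<phi> x) * ennreal (1 / sqrt (\<alpha> * \<beta>)) \<partial>lborel)"
        unfolding h_def using \<alpha> \<beta> by (intro nn_integral_cong) (simp add: ennreal_mult[symmetric])
      also have "\<dots> = (\<integral>\<^sup>+x. ennreal (?\<phi> x) \<partial>lborel) * ennreal (1 / sqrt (\<alpha> * \<beta>))"
        by (rule nn_integral_multc) auto
      also have "(\<integral>\<^sup>+x. ennreal (?\<phi> x) \<partial>lborel) = 1"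
        using prob_space.emeasure_space_1[OF prob_space_std_normal] by (simp add: emeasure_density)
      finally show ?thesis by simp
    qed
    finally have st: "(\<integral>\<^sup>+x. f x \<partial>lborel) + (\<integral>\<^sup>+x. g x \<partial>lborel) \<le> ennreal (2 / sqrt (\<alpha> * \<beta>))"
      using \<alpha> \<beta> by (simp add: ennreal_mult[symmetric] flip: ennreal_numeral)
    then obtain s t where s: "(\<integral>\<^sup>+x. f x \<partial>lborel) = ennreal s" "s \<ge> 0" and t: "(\<integral>\<^sup>+x. g x \<partial>lborel) = ennreal t" "t \<ge> 0"
      by (cases "\<integral>\<^sup>+x. f x \<partial>lborel"; cases "\<integral>\<^sup>+x. g x \<partial>lborel") (auto simp: top_unique)
    have "s + t \<le> 2 / sqrt (\<alpha> * \<beta>)"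
      using st s t \<alpha> \<beta> by (simp flip: ennreal_plus)
    then have "(s + t)\<^sup>2 \<le> (2 / sqrt (\<alpha> * \<beta>))\<^sup>2" using s t by (intro power_mono) auto
    also have "\<dots> = 4 / (\<alpha> * \<beta>)" using \<alpha> \<beta> by (simp add: power_divide)
    \<comment> \<open>The inequality of arithmetic and geometric means converts the additive bound
      into one for the product, in which the normalizing factors cancel.\<close>
    finally have "4 * (s * t) \<le> 4 / (\<alpha> * \<beta>)"
      using sum_squares_bound[of s t] by (simp add: power2_eq_square algebra_simps)
    then have *: "\<alpha> * s * (\<beta> * t) \<le> 1" using \<alpha> \<beta> by (simp add: field_simps)
    have "(\<integral>\<^sup>+x. a x \<partial>lborel) * (\<integral>\<^sup>+x. b x \<partial>lborel) = (ennreal \<alpha> * ennreal s) * (ennreal \<beta> * ennreal t)"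
      unfolding af bg s(1)[symmetric] t(1)[symmetric] by (subst (1 2) nn_integral_cmult) auto
    also have "\<dots> = ennreal (\<alpha> * s * (\<beta> * t))"
      using \<alpha> \<beta> s t by (simp add: ennreal_mult)
    also have "\<dots> \<le> 1" using * by simp
    finally show ?thesis by (simp add: int)
  qed
qed

text \<open>Integrating out one coordinate of \<open>u\<close> and of \<open>v\<close> gives two
  functions that satisfy the hypothesis for the remaining coordinates. This is the one-coordinate
  property applied while the others are held fixed.\<close>

lemma property_tau_PiM:
  assumes fin: "finite I" and M: "prob_space M" and tau: "property_tau M c"
  shows "property_tau (Pi\<^sub>M I (\<lambda>_. M)) (\<lambda>x y. \<Sum>i\<in>I. c (x i) (y i))"
  using fin
proof (induction I rule: finite_induct)
  case empty
  interpret P: product_sigma_finite "\<lambda>_::'a. M"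
    by (intro product_sigma_finite.intro prob_space_imp_sigma_finite M)
  show ?case by (simp add: property_tau_def PiM_empty nn_integral_count_space_finite)
next
  case (insert i I)
  interpret P: product_sigma_finite "\<lambda>_::'a. M"
    by (intro product_sigma_finite.intro prob_space_imp_sigma_finite M)
  interpret M: prob_space M by (rule M)
  let ?Q = "Pi\<^sub>M I (\<lambda>_. M)"
  show ?case unfolding property_tau_def
  proof (intro ballI impI)
    fix u v :: "('a \<Rightarrow> 'b) \<Rightarrow> ennreal"
    assume u [measurable]: "u \<in> borel_measurable (Pi\<^sub>M (insert i I) (\<lambda>_. M))"
      and v [measurable]: "v \<in> borel_measurable (Pi\<^sub>M (insert i I) (\<lambda>_. M))"
      and uv: "\<forall>x\<in>space (Pi\<^sub>M (insert i I) (\<lambda>_. M)). \<forall>y\<in>space (Pi\<^sub>M (insert i I) (\<lambda>_. M)).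
        u x * v y \<le> ennreal (exp (\<Sum>i\<in>insert i I. c (x i) (y i)))"
    have meas: "(\<lambda>x. \<integral>\<^sup>+z. w (x(i := z)) \<partial>M) \<in> borel_measurable ?Q"
      "x \<in> space ?Q \<Longrightarrow> (\<lambda>z. w (x(i := z))) \<in> borel_measurable M"
      if [measurable]: "w \<in> borel_measurable (Pi\<^sub>M (insert i I) (\<lambda>_. M))" for w :: "('a \<Rightarrow> 'b) \<Rightarrow> ennreal" and x
    proof -
      have "(\<lambda>(x, z). w (x(i := z))) \<in> borel_measurable (?Q \<Otimes>\<^sub>M M)"
        using measurable_compose[OF measurable_add_dim that] by (simp add: case_prod_unfold)
      then show "(\<lambda>x. \<integral>\<^sup>+z. w (x(i := z)) \<partial>M) \<in> borel_measurable ?Q"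
        by (rule sigma_finite_measure.borel_measurable_nn_integral[OF prob_space_imp_sigma_finite[OF M]])
      show "(\<lambda>z. w (x(i := z))) \<in> borel_measurable M" if "x \<in> space ?Q"
        using that by (intro measurable_compose[OF measurable_component_update \<open>w \<in> _\<close>] insert)
    qed
    have "(\<integral>\<^sup>+z. u (x(i := z)) \<partial>M) * (\<integral>\<^sup>+z. v (y(i := z)) \<partial>M) \<le> ennreal (exp (\<Sum>i\<in>I. c (x i) (y i)))"
      if x: "x \<in> space ?Q" and y: "y \<in> space ?Q" for x y
    proof -
      let ?s = "\<Sum>i\<in>I. c (x i) (y i)"
      have [measurable]: "(\<lambda>z. u (x(i := z))) \<in> borel_measurable M" "(\<lambda>z. v (y(i := z))) \<in> borel_measurable M"
        using meas x y u v by auto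
      \<comment> \<open>The cost \<open>?s\<close> of the other coordinates is a constant here; the
        factor \<open>exp (- ?s)\<close> moves it into \<open>u\<close>, so that only the cost of
        coordinate \<open>i\<close> is left.\<close>
      have "(\<integral>\<^sup>+z. u (x(i := z)) * ennreal (exp (- ?s)) \<partial>M) * (\<integral>\<^sup>+z. v (y(i := z)) \<partial>M) \<le> 1"
      proof (rule tau[unfolded property_tau_def, rule_format])
        fix z w assume zw: "z \<in> space M" "w \<in> space M"
        have "x(i := z) \<in> space (Pi\<^sub>M (insert i I) (\<lambda>_. M))" "y(i := w) \<in> space (Pi\<^sub>M (insert i I) (\<lambda>_. M))"
          using x y zw by (auto simp: space_PiM PiE_def extensional_def)
        with uv have "u (x(i := z)) * v (y(i := w)) \<le> ennreal (exp (\<Sum>j\<in>insert i I. c ((x(i := z)) j) ((y(i := w)) j)))"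
          by blast
        also have "(\<Sum>j\<in>insert i I. c ((x(i := z)) j) ((y(i := w)) j)) = c z w + ?s"
        proof -
          have "(\<Sum>j\<in>I. c ((x(i := z)) j) ((y(i := w)) j)) = ?s"
            using insert.hyps by (intro sum.cong) auto
          then show ?thesis using insert.hyps by simp
        qed
        finally have "u (x(i := z)) * v (y(i := w)) * ennreal (exp (- ?s)) \<le> ennreal (exp (c z w + ?s)) * ennreal (exp (- ?s))"
          by (rule mult_right_mono) simp
        also have "\<dots> = ennreal (exp (c z w))"
          by (simp add: ennreal_mult[symmetric] exp_add[symmetric])
        finally show "u (x(i := z)) * ennreal (exp (- ?s)) * v (y(i := w)) \<le> ennreal (exp (c z w))"
          by (simp add: mult_ac)
      qed measurable
      then have "(\<integral>\<^sup>+z. u (x(i := z)) \<partial>M) * (\<integral>\<^sup>+z. v (y(i := z)) \<partial>M) * ennreal (exp (- ?s)) \<le> 1"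
        by (subst (asm) nn_integral_multc) (auto simp: mult_ac)
      then have "(\<integral>\<^sup>+z. u (x(i := z)) \<partial>M) * (\<integral>\<^sup>+z. v (y(i := z)) \<partial>M) * ennreal (exp (- ?s)) * ennreal (exp ?s) \<le> 1 * ennreal (exp ?s)"
        by (rule mult_right_mono) simp
      then show ?thesis by (simp add: mult.assoc ennreal_mult[symmetric] exp_add[symmetric])
    qed
    then have "(\<integral>\<^sup>+x. (\<integral>\<^sup>+z. u (x(i := z)) \<partial>M) \<partial>?Q) * (\<integral>\<^sup>+x. (\<integral>\<^sup>+z. v (x(i := z)) \<partial>M) \<partial>?Q) \<le> 1"
      by (intro insert.IH[unfolded property_tau_def, rule_format] meas(1) u v)
    then show "(\<integral>\<^sup>+x. u x \<partial>Pi\<^sub>M (insert i I) (\<lambda>_. M)) * (\<integral>\<^sup>+x. v x \<partial>Pi\<^sub>M (insert i I) (\<lambda>_. M)) \<le> 1"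
      unfolding P.product_nn_integral_insert[OF insert.hyps u] P.product_nn_integral_insert[OF insert.hyps v] .
  qed
qed

lemma property_tau_gaussian_sample:
  "property_tau (gaussian_sample n d) (\<lambda>X Y. \<Sum>i\<in>{1..n}. \<Sum>k<d. (X i k - Y i k)\<^sup>2 / 4)"
proof -
  have "property_tau (std_gaussian d) (\<lambda>x y. \<Sum>k<d. (x k - y k)\<^sup>2 / 4)"
    unfolding std_gaussian_def by (intro property_tau_PiM prob_space_std_normal property_tau_std_normal) simp
  then show ?thesis
    unfolding gaussian_sample_def by (intro property_tau_PiM prob_space_std_gaussian) simp_all
qed

text \<open>Take \<open>u\<close> to be exp r times the indicator of A and \<open>v\<close> the
  indicator of B: the product is exp r on A \<times> B and 0 elsewhere.\<close>

lemma measure_mult_le_exp_dist: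
  assumes "property_tau M c" and "prob_space M" and A: "A \<in> sets M" and B: "B \<in> sets M"
    and r: "\<And>x y. x \<in> A \<Longrightarrow> y \<in> B \<Longrightarrow> r \<le> c x y" and c: "\<And>x y. 0 \<le> c x y"
  shows "measure M A * measure M B \<le> exp (- r)"
proof -
  interpret prob_space M by fact
  have "(\<integral>\<^sup>+x. indicator A x * ennreal (exp r) \<partial>M) * (\<integral>\<^sup>+x. indicator B x \<partial>M) \<le> 1"
  proof (rule assms(1)[unfolded property_tau_def, rule_format])
    fix x y
    show "indicator A x * ennreal (exp r) * indicator B y \<le> ennreal (exp (c x y))"
      using r[of x y] by (auto simp: indicator_def intro: ennreal_leI)
  qed (use A B in measurable)
  then have "emeasure M A * ennreal (exp r) * emeasure M B \<le> 1"
    using A B by (subst (asm) nn_integral_multc) auto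
  then have "measure M A * exp r * measure M B \<le> 1"
    by (simp add: emeasure_eq_measure ennreal_mult[symmetric])
  then show ?thesis by (simp add: exp_minus field_simps)
qed

subsection \<open>Second moments\<close>

lemma measure_ge_le_nn_integral:
  assumes "prob_space M" and [measurable]: "u \<in> borel_measurable M"
    and u: "(\<integral>\<^sup>+x. ennreal (u x) \<partial>M) \<le> ennreal b" and b: "0 \<le> b" and a: "0 < a"
  shows "measure M {x \<in> space M. a \<le> u x} \<le> b / a"
proof -
  interpret prob_space M by fact
  have "emeasure M {x \<in> space M. a \<le> u x} \<le> emeasure M {x \<in> space M. 1 \<le> ennreal (1 / a) * ennreal (u x)}"
    using a by (intro emeasure_mono) (auto simp: ennreal_mult[symmetric] ennreal_mult'[symmetric] field_simps)
  also have "\<dots> \<le> ennreal (1 / a) * (\<integral>\<^sup>+x. ennreal (u x) * indicator (space M) x \<partial>M)"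
    by (intro nn_integral_Markov_inequality) auto
  also have "(\<integral>\<^sup>+x. ennreal (u x) * indicator (space M) x \<partial>M) = (\<integral>\<^sup>+x. ennreal (u x) \<partial>M)"
    by (intro nn_integral_cong) auto
  also have "ennreal (1 / a) * \<dots> \<le> ennreal (1 / a) * ennreal b"
    using u by (intro mult_left_mono) auto
  also have "\<dots> = ennreal (b / a)" using a b by (simp add: ennreal_mult[symmetric])
  finally show ?thesis using a b by (simp add: emeasure_eq_measure)
qed

text \<open>The assumption for all constants \<open>a\<close> says that \<open>f i\<close> has mean
  zero and variance \<open>s i\<close>, in a form that needs only nonnegative integrals and no
  integrability. Integrating a new coordinate, with the other terms collected in \<open>a\<close>,
  adds its variance.\<close>

lemma nn_integral_PiM_sum_square:
  fixes f :: "'i \<Rightarrow> 'a \<Rightarrow> real"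
  assumes fin: "finite I" and M: "prob_space M"
    and f [measurable]: "\<And>i. f i \<in> borel_measurable M"
    and s: "\<And>i. 0 \<le> s i" "\<And>i a. i \<in> I \<Longrightarrow> (\<integral>\<^sup>+z. ennreal ((a + f i z)\<^sup>2) \<partial>M) = ennreal (a\<^sup>2 + s i)"
  shows "(\<integral>\<^sup>+x. ennreal ((c + (\<Sum>i\<in>I. f i (x i)))\<^sup>2) \<partial>Pi\<^sub>M I (\<lambda>_. M)) = ennreal (c\<^sup>2 + (\<Sum>i\<in>I. s i))"
  using fin s(2)
proof (induction I rule: finite_induct)
  case empty
  then show ?case by (simp add: PiM_empty nn_integral_count_space_finite)
next
  case (insert i I)
  interpret P: product_sigma_finite "\<lambda>_::'i. M"
    by (intro product_sigma_finite.intro prob_space_imp_sigma_finite M)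
  interpret prob_space "Pi\<^sub>M I (\<lambda>_. M)" by (intro prob_space_PiM M)
  have [measurable]: "(\<lambda>x. f j (x j)) \<in> borel_measurable (Pi\<^sub>M J (\<lambda>_. M))" if "j \<in> J" for j J
    by (rule measurable_compose[OF measurable_component_singleton[OF that] f])
  have [measurable]: "(\<lambda>x. \<Sum>j\<in>J. f j (x j)) \<in> borel_measurable (Pi\<^sub>M K (\<lambda>_. M))" if "J \<subseteq> K" for J K
    using that by (intro borel_measurable_sum) auto
  have "(\<integral>\<^sup>+x. ennreal ((c + (\<Sum>j\<in>insert i I. f j (x j)))\<^sup>2) \<partial>Pi\<^sub>M (insert i I) (\<lambda>_. M))
      = (\<integral>\<^sup>+x. (\<integral>\<^sup>+z. ennreal ((c + (\<Sum>j\<in>insert i I. f j ((x(i := z)) j)))\<^sup>2) \<partial>M) \<partial>Pi\<^sub>M I (\<lambda>_. M))"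
    using insert.hyps by (intro P.product_nn_integral_insert) auto
  also have "\<dots> = (\<integral>\<^sup>+x. (\<integral>\<^sup>+z. ennreal ((c + (\<Sum>j\<in>I. f j (x j)) + f i z)\<^sup>2) \<partial>M) \<partial>Pi\<^sub>M I (\<lambda>_. M))"
  proof (intro nn_integral_cong)
    fix x z
    have "(\<Sum>j\<in>I. f j ((x(i := z)) j)) = (\<Sum>j\<in>I. f j (x j))"
      using insert.hyps by (intro sum.cong) auto
    then show "ennreal ((c + (\<Sum>j\<in>insert i I. f j ((x(i := z)) j)))\<^sup>2) = ennreal ((c + (\<Sum>j\<in>I. f j (x j)) + f i z)\<^sup>2)"
      using insert.hyps by (simp add: ac_simps)
  qed
  also have "\<dots> = (\<integral>\<^sup>+x. ennreal ((c + (\<Sum>j\<in>I. f j (x j)))\<^sup>2) + ennreal (s i) \<partial>Pi\<^sub>M I (\<lambda>_. M))"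
    using insert.prems s(1) by (intro nn_integral_cong) simp
  also have "\<dots> = (\<integral>\<^sup>+x. ennreal ((c + (\<Sum>j\<in>I. f j (x j)))\<^sup>2) \<partial>Pi\<^sub>M I (\<lambda>_. M)) + ennreal (s i)"
    by (subst nn_integral_add) (auto simp: emeasure_space_1)
  also have "\<dots> = ennreal (c\<^sup>2 + (\<Sum>j\<in>I. s j)) + ennreal (s i)"
    using insert.IH insert.prems by simp
  also have "\<dots> = ennreal (c\<^sup>2 + (\<Sum>j\<in>insert i I. s j))"
    using insert.hyps s(1) by (subst ennreal_plus[symmetric]) (auto intro!: sum_nonneg add_nonneg_nonneg simp: ac_simps)
  finally show ?case .
qed

lemma nn_integral_std_normal:
  assumes g: "has_bochner_integral lborel (\<lambda>z. std_normal_density z * g z) m" "\<And>z. 0 \<le> g z"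
    and [measurable]: "g \<in> borel_measurable borel"
  shows "(\<integral>\<^sup>+z. ennreal (g z) \<partial>std_normal_distribution) = ennreal m"
proof -
  have "(\<integral>\<^sup>+z. ennreal (g z) \<partial>std_normal_distribution) = (\<integral>\<^sup>+z. ennreal (std_normal_density z * g z) \<partial>lborel)"
    using g(2) by (simp add: nn_integral_density ennreal_mult)
  also have "\<dots> = ennreal m"
    using g by (subst nn_integral_eq_integral) (auto simp: has_bochner_integral_iff)
  finally show ?thesis .
qed

lemma nn_integral_std_normal_affine_square:
  "(\<integral>\<^sup>+z. ennreal ((a + x * z)\<^sup>2) \<partial>std_normal_distribution) = ennreal (a\<^sup>2 + x\<^sup>2)"
proof (rule nn_integral_std_normal)
  have "has_bochner_integral lborel (\<lambda>z. a\<^sup>2 * (std_normal_density z * z ^ (2 * 0)) +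
      (2 * a * x * (std_normal_density z * z ^ (2 * 0 + 1)) + x\<^sup>2 * (std_normal_density z * z ^ (2 * 1))))
      (a\<^sup>2 * (fact (2 * 0) / (2 ^ 0 * fact 0)) + (2 * a * x * 0 + x\<^sup>2 * (fact (2 * 1) / (2 ^ 1 * fact 1))))"
    by (intro has_bochner_integral_add has_bochner_integral_mult_right std_normal_moment_even std_normal_moment_odd)
  then show "has_bochner_integral lborel (\<lambda>z. std_normal_density z * (a + x * z)\<^sup>2) (a\<^sup>2 + x\<^sup>2)"
    by (simp add: power2_eq_square algebra_simps)
qed auto

lemma nn_integral_std_normal_centered_square:
  "(\<integral>\<^sup>+z. ennreal ((a + (z\<^sup>2 - 1))\<^sup>2) \<partial>std_normal_distribution) = ennreal (a\<^sup>2 + 2)"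
proof (rule nn_integral_std_normal)
  have "has_bochner_integral lborel (\<lambda>z. (a - 1)\<^sup>2 * (std_normal_density z * z ^ (2 * 0)) +
      (2 * (a - 1) * (std_normal_density z * z ^ (2 * 1)) + 1 * (std_normal_density z * z ^ (2 * 2))))
      ((a - 1)\<^sup>2 * (fact (2 * 0) / (2 ^ 0 * fact 0)) + (2 * (a - 1) * (fact (2 * 1) / (2 ^ 1 * fact 1)) + 1 * (fact (2 * 2) / (2 ^ 2 * fact 2))))"
    by (intro has_bochner_integral_add has_bochner_integral_mult_right std_normal_moment_even)
  moreover have "(a - 1)\<^sup>2 * (fact (2 * 0) / (2 ^ 0 * fact 0)) + (2 * (a - 1) * (fact (2 * 1) / (2 ^ 1 * fact 1)) + 1 * (fact (2 * 2) / (2 ^ 2 * fact 2))) = a\<^sup>2 + 2"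
    by (simp add: power2_eq_square algebra_simps fact_numeral)
  moreover have "(\<lambda>z. (a - 1)\<^sup>2 * (std_normal_density z * z ^ (2 * 0)) +
      (2 * (a - 1) * (std_normal_density z * z ^ (2 * 1)) + 1 * (std_normal_density z * z ^ (2 * 2)))) = (\<lambda>z. std_normal_density z * (a + (z\<^sup>2 - 1))\<^sup>2)"
    by (intro ext) (simp add: power2_eq_square power4_eq_xxxx algebra_simps)
  ultimately show "has_bochner_integral lborel (\<lambda>z. std_normal_density z * (a + (z\<^sup>2 - 1))\<^sup>2) (a\<^sup>2 + 2)"
    by (simp only:)
qed auto

lemma nn_integral_dot_square:
  "(\<integral>\<^sup>+y. ennreal ((dot d x y)\<^sup>2) \<partial>std_gaussian d) = ennreal (\<Sum>k<d. (x k)\<^sup>2)"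
  using nn_integral_PiM_sum_square[of "{..<d}" std_normal_distribution "\<lambda>k z. x k * z" "\<lambda>k. (x k)\<^sup>2" 0]
  by (simp add: std_gaussian_def dot_def prob_space_std_normal nn_integral_std_normal_affine_square)

lemma nn_integral_coordinate_square:
  assumes "k < d"
  shows "(\<integral>\<^sup>+x. ennreal ((x k)\<^sup>2) \<partial>std_gaussian d) = 1"
proof -
  have "dot d (\<lambda>j. if j = k then 1 else 0) x = x k" for x
    using assms unfolding dot_def by (subst sum.remove[of _ k]) auto
  moreover have "(\<Sum>j<d. (if j = k then 1 else 0 :: real)\<^sup>2) = 1"
    using assms by (subst sum.remove[of _ k]) auto
  ultimately show ?thesis using nn_integral_dot_square[of d "\<lambda>j. if j = k then 1 else 0"] by simp
qed

lemma nn_integral_norm_square: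
  "(\<integral>\<^sup>+x. ennreal (\<Sum>k<d. (x k)\<^sup>2) \<partial>std_gaussian d) = ennreal (real d)"
proof -
  have [measurable]: "(\<lambda>x. x k) \<in> borel_measurable (std_gaussian d)" if "k < d" for k
    using that by (rule measurable_coordinate)
  have "(\<integral>\<^sup>+x. ennreal (\<Sum>k<d. (x k)\<^sup>2) \<partial>std_gaussian d) = (\<integral>\<^sup>+x. (\<Sum>k<d. ennreal ((x k)\<^sup>2)) \<partial>std_gaussian d)"
    by (intro nn_integral_cong) (simp add: sum_ennreal)
  also have "\<dots> = (\<Sum>k<d. (\<integral>\<^sup>+x. ennreal ((x k)\<^sup>2) \<partial>std_gaussian d))"
    by (intro nn_integral_sum) auto
  finally show ?thesis by (simp add: nn_integral_coordinate_square ennreal_of_nat_eq_real_of_nat)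
qed

lemma nn_integral_norm_square_deviation:
  "(\<integral>\<^sup>+x. ennreal ((dot d x x - real d)\<^sup>2) \<partial>std_gaussian d) = ennreal (2 * real d)"
proof -
  have "dot d x x - real d = (\<Sum>k<d. (x k)\<^sup>2 - 1)" for x
    by (simp add: dot_def sum_subtractf power2_eq_square)
  then show ?thesis
    using nn_integral_PiM_sum_square[of "{..<d}" std_normal_distribution "\<lambda>k z. z\<^sup>2 - 1" "\<lambda>k. 2" 0]
    by (simp add: std_gaussian_def prob_space_std_normal nn_integral_std_normal_centered_square mult.commute)
qed

lemma nn_integral_dot_square_pair:
  "(\<integral>\<^sup>+x. \<integral>\<^sup>+y. ennreal ((dot d x y)\<^sup>2) \<partial>std_gaussian d \<partial>std_gaussian d) = ennreal (real d)"
  by (simp add: nn_integral_dot_square nn_integral_norm_square)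

lemma nn_integral_PiM_component:
  assumes M: "prob_space M" and i: "i \<in> I" and [measurable]: "f \<in> borel_measurable M"
  shows "(\<integral>\<^sup>+x. f (x i) \<partial>Pi\<^sub>M I (\<lambda>_. M)) = (\<integral>\<^sup>+z. f z \<partial>M)"
proof -
  have "(\<integral>\<^sup>+z. f z \<partial>M) = (\<integral>\<^sup>+z. f z \<partial>distr (Pi\<^sub>M I (\<lambda>_. M)) M (\<lambda>x. x i))"
    using i by (subst distr_PiM_component) (auto intro: M)
  also have "\<dots> = (\<integral>\<^sup>+x. f (x i) \<partial>Pi\<^sub>M I (\<lambda>_. M))"
    using i by (intro nn_integral_distr) auto
  finally show ?thesis ..
qed

text \<open>The remaining rows integrate to one. This connects the sample with the threshold, which
  is defined through an independent pair.\<close>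

lemma nn_integral_gaussian_sample_pair:
  assumes ij: "i \<in> {1..n}" "j \<in> {1..n}" "i \<noteq> j"
    and f [measurable]: "case_prod f \<in> borel_measurable (std_gaussian d \<Otimes>\<^sub>M std_gaussian d)"
  shows "(\<integral>\<^sup>+X. f (X i) (X j) \<partial>gaussian_sample n d) = (\<integral>\<^sup>+w. case_prod f w \<partial>(std_gaussian d \<Otimes>\<^sub>M std_gaussian d))"
proof -
  interpret P: product_sigma_finite "\<lambda>_::nat. std_gaussian d"
    by (intro product_sigma_finite.intro prob_space_imp_sigma_finite prob_space_std_gaussian)
  interpret N: prob_space "std_gaussian d" by (rule prob_space_std_gaussian)
  interpret NN: pair_prob_space "std_gaussian d" "std_gaussian d" ..
  have J: "{1..n} = insert i ({1..n} - {i})" using ij by auto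
  have meas: "(\<lambda>X. f (X i) (X j)) \<in> borel_measurable (Pi\<^sub>M {1..n} (\<lambda>_. std_gaussian d))"
    using measurable_compose[OF measurable_Pair[OF measurable_component_singleton[OF ij(1)] measurable_component_singleton[OF ij(2)]] f]
    by simp
  have "(\<integral>\<^sup>+X. f (X i) (X j) \<partial>gaussian_sample n d) =
      (\<integral>\<^sup>+X. (\<integral>\<^sup>+z. f z (X j) \<partial>std_gaussian d) \<partial>Pi\<^sub>M ({1..n} - {i}) (\<lambda>_. std_gaussian d))"
    unfolding gaussian_sample_def
    apply (subst J, subst P.product_nn_integral_insert)
    using ij meas by (auto simp flip: J)
  also have "\<dots> = (\<integral>\<^sup>+y. (\<integral>\<^sup>+z. f z y \<partial>std_gaussian d) \<partial>std_gaussian d)"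
    using ij by (intro nn_integral_PiM_component[where f = "\<lambda>y. \<integral>\<^sup>+z. f z y \<partial>std_gaussian d"] prob_space_std_gaussian) auto
  also have "\<dots> = (\<integral>\<^sup>+w. case_prod f w \<partial>(std_gaussian d \<Otimes>\<^sub>M std_gaussian d))"
    using NN.nn_integral_snd[OF f] by simp
  finally show ?thesis .
qed

text \<open>
  The deviation of the Gram matrix of the sample from its mean \<open>d I\<close>, and its squared Frobenius norm.
\<close>

definition gram_dev :: "nat \<Rightarrow> (nat \<Rightarrow> nat \<Rightarrow> real) \<Rightarrow> nat \<Rightarrow> nat \<Rightarrow> real" where
  "gram_dev d X i j = dot d (X i) (X j) - (if i = j then real d else 0)"

definition gram_dev_sq :: "nat \<Rightarrow> nat \<Rightarrow> (nat \<Rightarrow> nat \<Rightarrow> real) \<Rightarrow> real" where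
  "gram_dev_sq n d X = (\<Sum>i\<in>{1..n}. \<Sum>j\<in>{1..n}. (gram_dev d X i j)\<^sup>2)"

lemma measurable_gaussian_sample_component [measurable]:
  "i \<in> {1..n} \<Longrightarrow> (\<lambda>X. X i) \<in> measurable (gaussian_sample n d) (std_gaussian d)"
  unfolding gaussian_sample_def by (rule measurable_component_singleton)

lemma measurable_gram_dev_sq [measurable]:
  "gram_dev_sq n d \<in> borel_measurable (gaussian_sample n d)"
  unfolding gram_dev_sq_def gram_dev_def by measurable

text \<open>Diagonal entries have second moment 2d and off-diagonal entries d; the larger value is
  used for all n^2 of them.\<close>

lemma nn_integral_gram_dev_sq:
  "(\<integral>\<^sup>+X. ennreal (gram_dev_sq n d X) \<partial>gaussian_sample n d) \<le> ennreal (2 * (real n)\<^sup>2 * real d)"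
proof -
  interpret N: prob_space "std_gaussian d" by (rule prob_space_std_gaussian)
  interpret NN: pair_prob_space "std_gaussian d" "std_gaussian d" ..
  have one: "(\<integral>\<^sup>+X. ennreal ((gram_dev d X i j)\<^sup>2) \<partial>gaussian_sample n d) \<le> ennreal (2 * real d)"
    if ij: "i \<in> {1..n}" "j \<in> {1..n}" for i j
  proof (cases "i = j")
    case True
    then show ?thesis
      unfolding gram_dev_def gaussian_sample_def using ij
        nn_integral_PiM_component[OF prob_space_std_gaussian, of i "{1..n}" "\<lambda>x. ennreal ((dot d x x - real d)\<^sup>2)" d]
      by (simp add: nn_integral_norm_square_deviation)
  next
    case False
    have "(\<integral>\<^sup>+X. ennreal ((dot d (X i) (X j))\<^sup>2) \<partial>gaussian_sample n d) = (\<integral>\<^sup>+w. (\<lambda>(x, y). ennreal ((dot d x y)\<^sup>2)) w \<partial>(std_gaussian d \<Otimes>\<^sub>M std_gaussian d))"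
      using ij False by (intro nn_integral_gaussian_sample_pair[where f = "\<lambda>x y. ennreal ((dot d x y)\<^sup>2)"]) (auto simp: case_prod_unfold)
    also have "\<dots> = (\<integral>\<^sup>+x. \<integral>\<^sup>+y. ennreal ((dot d x y)\<^sup>2) \<partial>std_gaussian d \<partial>std_gaussian d)"
      by (subst N.nn_integral_fst[symmetric]) (auto simp: case_prod_unfold)
    also have "\<dots> = ennreal (real d)" by (rule nn_integral_dot_square_pair)
    also have "\<dots> \<le> ennreal (2 * real d)" by (intro ennreal_leI) simp
    finally show ?thesis using False by (simp add: gram_dev_def)
  qed
  have [measurable]: "(\<lambda>X. gram_dev d X i j) \<in> borel_measurable (gaussian_sample n d)"
    if "i \<in> {1..n}" "j \<in> {1..n}" for i j
    using that unfolding gram_dev_def by measurable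
  have "(\<integral>\<^sup>+X. ennreal (gram_dev_sq n d X) \<partial>gaussian_sample n d)
      = (\<integral>\<^sup>+X. (\<Sum>i\<in>{1..n}. \<Sum>j\<in>{1..n}. ennreal ((gram_dev d X i j)\<^sup>2)) \<partial>gaussian_sample n d)"
    unfolding gram_dev_sq_def by (intro nn_integral_cong) (simp add: sum_ennreal sum_nonneg)
  also have "\<dots> = (\<Sum>i\<in>{1..n}. \<Sum>j\<in>{1..n}. (\<integral>\<^sup>+X. ennreal ((gram_dev d X i j)\<^sup>2) \<partial>gaussian_sample n d))"
    by (subst nn_integral_sum, measurable, intro sum.cong refl nn_integral_sum) measurable
  also have "\<dots> \<le> (\<Sum>i\<in>{1..n}. \<Sum>j\<in>{1..n}. ennreal (2 * real d))"
    by (intro sum_mono one)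
  also have "\<dots> = ennreal (2 * (real n)\<^sup>2 * real d)"
    by (simp add: sum_ennreal power2_eq_square mult_ac ennreal_of_nat_eq_real_of_nat ennreal_mult[symmetric])
  finally show ?thesis .
qed

text \<open>Chebyshev's inequality, as the inner product has second moment d. It shows that the
  lower bound has to raise inner products only by order sqrt d.\<close>

lemma threshold_le:
  assumes "is_threshold p d t" "0 < p"
  shows "t \<le> sqrt (real d / p)"
proof (cases "t \<le> 0")
  case True
  then show ?thesis using assms by (simp add: order_trans)
next
  case False
  interpret N: prob_space "std_gaussian d" by (rule prob_space_std_gaussian)
  interpret NN: pair_prob_space "std_gaussian d" "std_gaussian d" ..
  let ?P = "std_gaussian d \<Otimes>\<^sub>M std_gaussian d"
  have "p = measure ?P {w \<in> space ?P. t \<le> dot d (fst w) (snd w)}"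
    using assms(1) by (simp add: is_threshold_def case_prod_unfold)
  also have "\<dots> \<le> measure ?P {w \<in> space ?P. t\<^sup>2 \<le> (dot d (fst w) (snd w))\<^sup>2}"
    using False by (intro NN.P.finite_measure_mono) (auto intro!: power_mono)
  also have "\<dots> \<le> real d / t\<^sup>2"
  proof (rule measure_ge_le_nn_integral)
    show "(\<integral>\<^sup>+w. ennreal ((dot d (fst w) (snd w))\<^sup>2) \<partial>?P) \<le> ennreal (real d)"
      by (subst N.nn_integral_fst[symmetric]) (auto simp: nn_integral_dot_square_pair)
  qed (use False NN.P.prob_space_axioms in auto)
  finally have "t\<^sup>2 \<le> real d / p"
    using assms(2) False by (simp add: field_simps)
  then show ?thesis by (rule real_le_rsqrt)
qed

subsection \<open>Anticoncentration of the inner product\<close>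

lemma indep_vars_std_gaussian:
  assumes "0 < d"
  shows "prob_space.indep_vars (std_gaussian d) (\<lambda>_. std_normal_distribution) (\<lambda>k y. y k) {..<d}"
proof -
  interpret prob_space "std_gaussian d" by (rule prob_space_std_gaussian)
  have "distr (std_gaussian d) (std_gaussian d) (\<lambda>x. \<lambda>i\<in>{..<d}. x i) = distr (std_gaussian d) (std_gaussian d) (\<lambda>x. x)"
    by (intro distr_cong refl) (auto simp: std_gaussian_def space_PiM PiE_restrict)
  also have "\<dots> = std_gaussian d" by (rule distr_id2) simp
  also have "\<dots> = Pi\<^sub>M {..<d} (\<lambda>i. distr (std_gaussian d) std_normal_distribution (\<lambda>x. x i))"
    unfolding std_gaussian_def
    by (intro PiM_cong refl distr_PiM_component[symmetric] prob_space_std_normal)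
  finally show ?thesis
    using assms unfolding std_gaussian_def[symmetric]
    by (subst indep_vars_iff_distr_eq_PiM')
      (auto simp: std_gaussian_def[symmetric] intro: measurable_coordinate)
qed

lemma distributed_dot:
  assumes x: "0 < (\<Sum>k<d. (x k)\<^sup>2)"
  shows "distributed (std_gaussian d) lborel (dot d x) (normal_density 0 (sqrt (\<Sum>k<d. (x k)\<^sup>2)))"
proof -
  interpret prob_space "std_gaussian d" by (rule prob_space_std_gaussian)
  \<comment> \<open>Coordinates where \<open>x\<close> vanishes would give degenerate summands,
    which the rule for sums of independent normals excludes.\<close>
  let ?I = "{k\<in>{..<d}. x k \<noteq> 0}"
  have d: "0 < d" using x by (cases d) auto
  have "?I \<noteq> {}"
  proof
    assume "?I = {}"
    then have "(\<Sum>k<d. (x k)\<^sup>2) = 0" by (intro sum.neutral) auto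
    with x show False by simp
  qed
  have comp: "distributed (std_gaussian d) lborel (\<lambda>y. y k) std_normal_density" if "k < d" for k
  proof -
    have "distr (std_gaussian d) lborel (\<lambda>y. y k) = distr (std_gaussian d) std_normal_distribution (\<lambda>y. y k)"
      by (intro distr_cong) auto
    also have "\<dots> = std_normal_distribution"
      unfolding std_gaussian_def using that by (intro distr_PiM_component prob_space_std_normal) auto
    finally show ?thesis
      using measurable_coordinate[OF that] unfolding distributed_def by auto
  qed
  have "distributed (std_gaussian d) lborel (\<lambda>y. \<Sum>k\<in>?I. x k * y k)
     (normal_density (\<Sum>k\<in>?I. 0) (sqrt (\<Sum>k\<in>?I. \<bar>x k\<bar>\<^sup>2)))"
  proof (rule sum_indep_normal)
    show "indep_vars (\<lambda>i. borel) (\<lambda>k y. x k * y k) ?I"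
      using indep_vars_compose2[OF indep_vars_subset[OF indep_vars_std_gaussian[OF d], of ?I], of "\<lambda>k z. x k * z" "\<lambda>_. borel"]
      by auto
    show "distributed (std_gaussian d) lborel (\<lambda>y. x k * y k) (normal_density 0 \<bar>x k\<bar>)" if "k \<in> ?I" for k
      using normal_density_affine[OF comp[of k], of "x k" 0] that by simp
  qed (use \<open>?I \<noteq> {}\<close> in auto)
  moreover have "(\<lambda>y. \<Sum>k\<in>?I. x k * y k) = dot d x"
    unfolding dot_def by (intro ext sum.mono_neutral_left) auto
  moreover have "(\<Sum>k\<in>?I. \<bar>x k\<bar>\<^sup>2) = (\<Sum>k<d. (x k)\<^sup>2)"
    by (simp, intro sum.mono_neutral_left) auto
  ultimately show ?thesis by simp
qed

text \<open>For fixed \<open>x\<close> the inner product is normal with standard deviation |x|, and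
  its density is at most 1 / |x|, wherever the interval lies.\<close>

lemma measure_dot_interval_le:
  assumes x: "0 < (\<Sum>k<d. (x k)\<^sup>2)" and s: "0 \<le> s"
  shows "emeasure (std_gaussian d) {y \<in> space (std_gaussian d). a \<le> dot d x y \<and> dot d x y < a + s}
     \<le> ennreal (s / sqrt (\<Sum>k<d. (x k)\<^sup>2))"
proof -
  let ?\<sigma> = "sqrt (\<Sum>k<d. (x k)\<^sup>2)"
  have \<sigma>: "?\<sigma> > 0" using x by simp
  have "emeasure (std_gaussian d) {y \<in> space (std_gaussian d). a \<le> dot d x y \<and> dot d x y < a + s}
    = emeasure (std_gaussian d) (dot d x -` {a..<a + s} \<inter> space (std_gaussian d))"
    by (rule arg_cong[where f = "emeasure _"]) auto
  also have "\<dots> = (\<integral>\<^sup>+z. ennreal (normal_density 0 ?\<sigma> z) * indicator {a..<a + s} z \<partial>lborel)"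
    by (rule distributed_emeasure[OF distributed_dot[OF x]]) simp
  also have "\<dots> \<le> (\<integral>\<^sup>+z. ennreal (1 / ?\<sigma>) * indicator {a..<a + s} z \<partial>lborel)"
  proof (intro nn_integral_mono mult_right_mono ennreal_leI)
    fix z :: real
    have "?\<sigma> \<le> sqrt (2 * pi * ?\<sigma>\<^sup>2)" using \<sigma> pi_gt3
      by (intro real_le_rsqrt) (simp add: mult_ge1_I)
    then have "normal_density 0 ?\<sigma> z \<le> 1 / ?\<sigma> * 1"
      unfolding normal_density_def using \<sigma> by (intro mult_mono divide_left_mono) auto
    then show "normal_density 0 ?\<sigma> z \<le> 1 / ?\<sigma>" by simp
  qed simp
  also have "\<dots> = ennreal (s / ?\<sigma>)"
    using s \<sigma> by (simp add: nn_integral_cmult_indicator ennreal_mult[symmetric])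
  finally show ?thesis .
qed

text \<open>If the average of the squared coordinates is below \<kappa>, at least half of them are
  below 2 \<kappa>. Each is so with probability at most 2 sqrt (2 \<kappa>), because the density is
  at most 1, and Markov's inequality for their number gives a bound that is uniform in
  \<open>d\<close>, small dimensions included.\<close>

lemma measure_small_norm_le:
  assumes d: "0 < d" and \<kappa>: "0 \<le> \<kappa>"
  shows "measure (std_gaussian d) {x \<in> space (std_gaussian d). (\<Sum>k<d. (x k)\<^sup>2) < \<kappa> * real d} \<le> 4 * sqrt (2 * \<kappa>)"
proof -
  interpret prob_space "std_gaussian d" by (rule prob_space_std_gaussian)
  have [measurable]: "(\<lambda>x. x k) \<in> borel_measurable (std_gaussian d)" if "k < d" for k
    using that by (rule measurable_coordinate)
  have one: "(\<integral>\<^sup>+x. ennreal (of_bool ((x k)\<^sup>2 < 2 * \<kappa>)) \<partial>std_gaussian d) \<le> ennreal (2 * sqrt (2 * \<kappa>))"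
    if k: "k < d" for k
  proof -
    have "(\<integral>\<^sup>+x. ennreal (of_bool ((x k)\<^sup>2 < 2 * \<kappa>)) \<partial>std_gaussian d) = (\<integral>\<^sup>+z. ennreal (of_bool (z\<^sup>2 < 2 * \<kappa>)) \<partial>std_normal_distribution)"
      unfolding std_gaussian_def using k
      by (intro nn_integral_PiM_component[where f = "\<lambda>z. ennreal (of_bool (z\<^sup>2 < 2 * \<kappa>))"] prob_space_std_normal) (auto simp: of_bool_def)
    also have "\<dots> = (\<integral>\<^sup>+z. ennreal (std_normal_density z) * ennreal (of_bool (z\<^sup>2 < 2 * \<kappa>)) \<partial>lborel)"
      by (subst nn_integral_density) (auto simp: of_bool_def)
    also have "\<dots> \<le> (\<integral>\<^sup>+z. indicator {- sqrt (2 * \<kappa>)..sqrt (2 * \<kappa>)} z \<partial>lborel)"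
    proof (intro nn_integral_mono)
      fix z :: real
      have "std_normal_density z \<le> 1" by (rule std_normal_density_le_1)
      moreover have "\<bar>z\<bar> \<le> sqrt (2 * \<kappa>)" if "z\<^sup>2 < 2 * \<kappa>"
        using that by (metis less_imp_le real_le_rsqrt power2_abs)
      ultimately show "ennreal (std_normal_density z) * ennreal (of_bool (z\<^sup>2 < 2 * \<kappa>)) \<le> indicator {- sqrt (2 * \<kappa>)..sqrt (2 * \<kappa>)} z"
        by (auto simp: indicator_def abs_le_iff)
    qed
    also have "\<dots> = ennreal (2 * sqrt (2 * \<kappa>))" using \<kappa> by simp
    finally show ?thesis .
  qed
  have "{x \<in> space (std_gaussian d). (\<Sum>k<d. (x k)\<^sup>2) < \<kappa> * real d}
      \<subseteq> {x \<in> space (std_gaussian d). real d / 2 \<le> (\<Sum>k<d. of_bool ((x k)\<^sup>2 < 2 * \<kappa>))}"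
  proof safe
    fix x assume x: "(\<Sum>k<d. (x k)\<^sup>2) < \<kappa> * real d"
    have "(\<Sum>k<d. 2 * \<kappa> * (1 - of_bool ((x k)\<^sup>2 < 2 * \<kappa>))) \<le> (\<Sum>k<d. (x k)\<^sup>2)"
      by (intro sum_mono) auto
    then have "2 * \<kappa> * (real d - (\<Sum>k<d. of_bool ((x k)\<^sup>2 < 2 * \<kappa>))) < \<kappa> * real d"
      using x by (simp add: sum_distrib_left[symmetric] sum_subtractf)
    then have "\<kappa> * (real d / 2 - (\<Sum>k<d. of_bool ((x k)\<^sup>2 < 2 * \<kappa>))) < 0"
      by (simp add: algebra_simps)
    then show "real d / 2 \<le> (\<Sum>k<d. of_bool ((x k)\<^sup>2 < 2 * \<kappa>))"
      using \<kappa> by (simp add: mult_less_0_iff)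
  qed
  then have "prob {x \<in> space (std_gaussian d). (\<Sum>k<d. (x k)\<^sup>2) < \<kappa> * real d}
      \<le> prob {x \<in> space (std_gaussian d). real d / 2 \<le> (\<Sum>k<d. of_bool ((x k)\<^sup>2 < 2 * \<kappa>))}"
    by (intro finite_measure_mono) (auto simp: of_bool_def)
  also have "\<dots> \<le> real d * (2 * sqrt (2 * \<kappa>)) / (real d / 2)"
  proof (rule measure_ge_le_nn_integral)
    have "(\<integral>\<^sup>+x. ennreal (\<Sum>k<d. of_bool ((x k)\<^sup>2 < 2 * \<kappa>)) \<partial>std_gaussian d)
        = (\<integral>\<^sup>+x. (\<Sum>k<d. ennreal (of_bool ((x k)\<^sup>2 < 2 * \<kappa>))) \<partial>std_gaussian d)"
      by (intro nn_integral_cong) (simp add: sum_ennreal)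
    also have "\<dots> = (\<Sum>k<d. (\<integral>\<^sup>+x. ennreal (of_bool ((x k)\<^sup>2 < 2 * \<kappa>)) \<partial>std_gaussian d))"
      by (intro nn_integral_sum) (auto simp: of_bool_def)
    also have "\<dots> \<le> (\<Sum>k<d. ennreal (2 * sqrt (2 * \<kappa>)))" using one by (intro sum_mono) auto
    also have "\<dots> = ennreal (real d * (2 * sqrt (2 * \<kappa>)))"
      using \<kappa> by (subst sum_ennreal) auto
    finally show "(\<integral>\<^sup>+x. ennreal (\<Sum>k<d. of_bool ((x k)\<^sup>2 < 2 * \<kappa>)) \<partial>std_gaussian d) \<le> ennreal (real d * (2 * sqrt (2 * \<kappa>)))" .
  qed (use d \<kappa> prob_space_axioms in \<open>auto simp: of_bool_def\<close>)
  finally show ?thesis using d by simp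
qed

text \<open>Given a first vector of length of order sqrt d or more, the inner product is normal with
  spread of at least that order, so a window that is a small multiple of sqrt d is unlikely. That
  \<delta> depends on neither \<open>d\<close> nor \<open>t\<close> makes the constants of the upper
  bound uniform.\<close>

lemma dot_anticoncentration:
  assumes \<eta>: "0 < \<eta>"
  shows "\<exists>\<delta>>0. \<forall>d t. 0 < d \<longrightarrow>
    measure (std_gaussian d \<Otimes>\<^sub>M std_gaussian d)
      {w \<in> space (std_gaussian d \<Otimes>\<^sub>M std_gaussian d).
         t - \<delta> * sqrt (real d) \<le> dot d (fst w) (snd w) \<and> dot d (fst w) (snd w) < t} \<le> \<eta>"
proof -
  define \<kappa> where "\<kappa> = \<eta>\<^sup>2 / 128"
  have \<kappa>: "\<kappa> > 0" using \<eta> by (simp add: \<kappa>_def)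
  have \<kappa>\<eta>: "4 * sqrt (2 * \<kappa>) = \<eta> / 2"
  proof -
    have "2 * \<kappa> = (\<eta> / 8)\<^sup>2" by (simp add: \<kappa>_def power2_eq_square)
    then show ?thesis using \<eta> by (simp only: real_sqrt_abs)
  qed
  \<comment> \<open>With |x|^2 \<ge> \<kappa> d, a window of length \<delta> sqrt d has conditional
    probability at most \<delta> / sqrt \<kappa> = \<eta> / 2. Short first vectors use the other
    half of \<eta>.\<close>
  define \<delta> where "\<delta> = \<eta> / 2 * sqrt \<kappa>"
  have \<delta>: "\<delta> > 0" using \<eta> \<kappa> by (simp add: \<delta>_def)
  show ?thesis
  proof (intro exI[of _ \<delta>] conjI allI impI \<delta>)
    fix d :: nat and t :: real assume d: "0 < d"
    interpret N: prob_space "std_gaussian d" by (rule prob_space_std_gaussian)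
    interpret NN: pair_prob_space "std_gaussian d" "std_gaussian d" ..
    let ?P = "std_gaussian d \<Otimes>\<^sub>M std_gaussian d"
    let ?s = "\<delta> * sqrt (real d)"
    let ?A = "{w \<in> space ?P. t - ?s \<le> dot d (fst w) (snd w) \<and> dot d (fst w) (snd w) < t}"
    let ?S = "{x \<in> space (std_gaussian d). (\<Sum>k<d. (x k)\<^sup>2) < \<kappa> * real d}"
    have [measurable]: "(\<lambda>x. x k) \<in> borel_measurable (std_gaussian d)" if "k < d" for k
      using that by (rule measurable_coordinate)
    have [measurable]: "?S \<in> sets (std_gaussian d)"
      by measurable
    have "emeasure ?P ?A = (\<integral>\<^sup>+x. emeasure (std_gaussian d) (Pair x -` ?A) \<partial>std_gaussian d)"
      by (intro N.emeasure_pair_measure_alt) measurable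
    also have "\<dots> \<le> (\<integral>\<^sup>+x. indicator ?S x + ennreal (\<eta> / 2) \<partial>std_gaussian d)"
    proof (intro nn_integral_mono)
      fix x assume x: "x \<in> space (std_gaussian d)"
      show "emeasure (std_gaussian d) (Pair x -` ?A) \<le> indicator ?S x + ennreal (\<eta> / 2)"
      proof (cases "x \<in> ?S")
        case True
        have "emeasure (std_gaussian d) (Pair x -` ?A) \<le> 1" by (rule N.emeasure_le_1)
        then show ?thesis using True by (simp add: add_increasing2)
      next
        case False
        then have le: "\<kappa> * real d \<le> (\<Sum>k<d. (x k)\<^sup>2)" using x by auto
        moreover have "0 < \<kappa> * real d" using \<kappa> d by simp
        ultimately have pos: "0 < (\<Sum>k<d. (x k)\<^sup>2)" by linarith
        have "Pair x -` ?A = {y \<in> space (std_gaussian d). t - ?s \<le> dot d x y \<and> dot d x y < (t - ?s) + ?s}"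
          using x by (auto simp: space_pair_measure)
        then have "emeasure (std_gaussian d) (Pair x -` ?A) \<le> ennreal (?s / sqrt (\<Sum>k<d. (x k)\<^sup>2))"
          using measure_dot_interval_le[OF pos, of ?s "t - ?s"] \<delta> by (simp only:) auto
        also have "\<dots> \<le> ennreal (?s / sqrt (\<kappa> * real d))"
          using le \<delta> \<kappa> d pos by (intro ennreal_leI divide_left_mono) auto
        also have "?s / sqrt (\<kappa> * real d) = \<eta> / 2"
          using d \<kappa> by (simp add: \<delta>_def real_sqrt_mult)
        finally show ?thesis using False by simp
      qed
    qed
    also have "\<dots> = emeasure (std_gaussian d) ?S + ennreal (\<eta> / 2)"
      by (subst nn_integral_add) (auto simp: N.emeasure_space_1)
    also have "\<dots> \<le> ennreal (\<eta> / 2) + ennreal (\<eta> / 2)"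
      using measure_small_norm_le[OF d, of \<kappa>] \<kappa> \<kappa>\<eta>
      by (intro add_mono) (auto simp: N.emeasure_eq_measure intro!: ennreal_leI)
    also have "\<dots> = ennreal \<eta>" using \<eta> by (simp flip: ennreal_plus)
    finally show "measure ?P ?A \<le> \<eta>" using \<eta> by (simp add: NN.P.emeasure_eq_measure)
  qed
qed

subsection \<open>Upper bound\<close>

lemma Cauchy_Schwarz_ineq_sum_sum:
  fixes a b :: "'i \<Rightarrow> 'j \<Rightarrow> real"
  shows "(\<Sum>i\<in>I. \<Sum>j\<in>J. a i j * b i j)\<^sup>2 \<le> (\<Sum>i\<in>I. \<Sum>j\<in>J. (a i j)\<^sup>2) * (\<Sum>i\<in>I. \<Sum>j\<in>J. (b i j)\<^sup>2)"
  using Cauchy_Schwarz_ineq_sum[of "case_prod a" "case_prod b" "I \<times> J"]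
  by (simp add: sum.cartesian_product case_prod_unfold)

lemma dot_self_nonneg: "0 \<le> dot d x x"
  by (simp add: dot_def sum_nonneg)

lemma dot_sq_le: "(dot d x y)\<^sup>2 \<le> dot d x x * dot d y y"
  using Cauchy_Schwarz_ineq_sum[of x y "{..<d}"] by (simp add: dot_def power2_eq_square)

lemma dot_sum_right: "dot d w (\<lambda>k. \<Sum>j\<in>J. a j * X j k) = (\<Sum>j\<in>J. a j * dot d w (X j))"
  unfolding dot_def sum_distrib_left by (subst sum.swap) (simp add: mult_ac)

lemma gram_dev_sq_nonneg: "0 \<le> gram_dev_sq n d X"
  by (simp add: gram_dev_sq_def sum_nonneg)

text \<open>
  The operator norm of \<open>X\<^sup>T X\<close> equals that of the Gram matrix, which is \<open>d I\<close> plus the deviation.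
\<close>

lemma sum_dot_sq_le:
  "(\<Sum>j\<in>{1..n}. (dot d w (X j))\<^sup>2) \<le> (real d + sqrt (gram_dev_sq n d X)) * dot d w w"
proof -
  define a where "a j = dot d w (X j)" for j
  define s where "s = (\<Sum>j\<in>{1..n}. (a j)\<^sup>2)"
  \<comment> \<open>The inner product of \<open>w\<close> with this vector is \<open>s\<close>, and
    its squared length is at most the operator norm bound times \<open>s\<close>. Cauchy-Schwarz for
    the two vectors then leaves one factor \<open>s\<close> to cancel.\<close>
  let ?v = "\<lambda>k. \<Sum>j\<in>{1..n}. a j * X j k"
  let ?F = "gram_dev_sq n d X"
  have s0: "0 \<le> s" by (simp add: s_def sum_nonneg)
  have "dot d ?v ?v = (\<Sum>i\<in>{1..n}. \<Sum>j\<in>{1..n}. a i * a j * dot d (X i) (X j))"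
  proof -
    have "dot d ?v ?v = (\<Sum>j\<in>{1..n}. a j * dot d (X j) ?v)"
      by (subst dot_sum_right) (simp only: dot_commute)
    also have "\<dots> = (\<Sum>i\<in>{1..n}. \<Sum>j\<in>{1..n}. a i * a j * dot d (X i) (X j))"
      by (simp add: dot_sum_right sum_distrib_left mult_ac)
    finally show ?thesis .
  qed
  also have "\<dots> = (\<Sum>i\<in>{1..n}. \<Sum>j\<in>{1..n}. a i * a j * gram_dev d X i j) + real d * s"
  proof -
    have "(\<Sum>j\<in>{1..n}. a i * a j * dot d (X i) (X j)) = (\<Sum>j\<in>{1..n}. a i * a j * gram_dev d X i j) + real d * (a i)\<^sup>2"
      if "i \<in> {1..n}" for i
    proof -
      have "(\<Sum>j\<in>{1..n}. a i * a j * dot d (X i) (X j)) =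
          (\<Sum>j\<in>{1..n}. a i * a j * gram_dev d X i j + (if i = j then real d * (a i)\<^sup>2 else 0))"
        by (intro sum.cong) (auto simp: gram_dev_def algebra_simps power2_eq_square)
      then show ?thesis using that by (simp add: sum.distrib)
    qed
    then show ?thesis by (simp add: sum.distrib s_def sum_distrib_left)
  qed
  also have "(\<Sum>i\<in>{1..n}. \<Sum>j\<in>{1..n}. a i * a j * gram_dev d X i j) \<le> s * sqrt ?F"
  proof -
    have "(\<Sum>i\<in>{1..n}. \<Sum>j\<in>{1..n}. a i * a j * gram_dev d X i j)\<^sup>2
      \<le> (\<Sum>i\<in>{1..n}. \<Sum>j\<in>{1..n}. (a i * a j)\<^sup>2) * ?F"
      unfolding gram_dev_sq_def by (rule Cauchy_Schwarz_ineq_sum_sum)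
    also have "(\<Sum>i\<in>{1..n}. \<Sum>j\<in>{1..n}. (a i * a j)\<^sup>2) = s * s"
      by (simp add: s_def sum_product power_mult_distrib)
    also have "s * s * ?F = (s * sqrt ?F)\<^sup>2"
      using gram_dev_sq_nonneg by (simp add: power_mult_distrib power2_eq_square)
    finally show ?thesis by (rule power2_le_imp_le) (simp add: s0 gram_dev_sq_nonneg)
  qed
  finally have v: "dot d ?v ?v \<le> (real d + sqrt ?F) * s" by (simp add: algebra_simps)
  have "dot d w ?v = s" unfolding dot_sum_right s_def by (simp add: a_def power2_eq_square)
  then have "s\<^sup>2 \<le> dot d w w * dot d ?v ?v" using dot_sq_le[of d w ?v] by simp
  also have "\<dots> \<le> dot d w w * ((real d + sqrt ?F) * s)"
    by (intro mult_left_mono v dot_self_nonneg)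
  finally have "s * s \<le> ((real d + sqrt ?F) * dot d w w) * s" by (simp add: power2_eq_square mult_ac)
  then have "s \<le> (real d + sqrt ?F) * dot d w w"
    using s0 gram_dev_sq_nonneg[of n d X] dot_self_nonneg[of d w]
    by (cases "s = 0") (auto simp: mult_le_cancel_right)
  then show ?thesis by (simp add: s_def a_def)
qed

lemma square_sum3_le: "(x + y + z)\<^sup>2 \<le> 3 * (x\<^sup>2 + y\<^sup>2 + z\<^sup>2)" for x y z :: real
  using sum_squares_bound[of x y] sum_squares_bound[of y z] sum_squares_bound[of x z]
  by (simp add: power2_eq_square algebra_simps)

text \<open>With D = X - Y each Gram difference splits into two mixed terms, linear in D and
  controlled by the operator norm of Y, and a term quadratic in D. Expanding around Y keeps the size
  of X out of the bound.\<close>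

lemma gram_difference_le:
  fixes X Y :: "nat \<Rightarrow> nat \<Rightarrow> real" and n d :: nat
  defines "Q \<equiv> \<Sum>i\<in>{1..n}. \<Sum>k<d. (X i k - Y i k)\<^sup>2"
  shows "(\<Sum>i\<in>{1..n}. \<Sum>j\<in>{1..n}. (dot d (X i) (X j) - dot d (Y i) (Y j))\<^sup>2)
    \<le> 6 * Q * (real d + sqrt (gram_dev_sq n d Y)) + 3 * Q\<^sup>2"
proof -
  define D where "D i k = X i k - Y i k" for i k
  let ?l = "real d + sqrt (gram_dev_sq n d Y)"
  have Q: "Q = (\<Sum>i\<in>{1..n}. dot d (D i) (D i))"
    by (simp add: Q_def D_def dot_def power2_eq_square)
  have "(dot d (X i) (X j) - dot d (Y i) (Y j))\<^sup>2
      \<le> 3 * ((dot d (D i) (Y j))\<^sup>2 + (dot d (D j) (Y i))\<^sup>2 + dot d (D i) (D i) * dot d (D j) (D j))" for i j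
  proof -
    have "dot d (X i) (X j) - dot d (Y i) (Y j) = dot d (D i) (Y j) + dot d (D j) (Y i) + dot d (D i) (D j)"
      unfolding dot_def D_def by (simp add: sum.distrib[symmetric] sum_subtractf[symmetric] algebra_simps)
    then show ?thesis
      using square_sum3_le[of "dot d (D i) (Y j)" "dot d (D j) (Y i)" "dot d (D i) (D j)"] dot_sq_le[of d "D i" "D j"]
      by (smt (verit, best))
  qed
  then have "(\<Sum>i\<in>{1..n}. \<Sum>j\<in>{1..n}. (dot d (X i) (X j) - dot d (Y i) (Y j))\<^sup>2)
    \<le> (\<Sum>i\<in>{1..n}. \<Sum>j\<in>{1..n}. 3 * ((dot d (D i) (Y j))\<^sup>2 + (dot d (D j) (Y i))\<^sup>2 + dot d (D i) (D i) * dot d (D j) (D j)))"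
    by (intro sum_mono)
  also have "\<dots> = 3 * ((\<Sum>i\<in>{1..n}. \<Sum>j\<in>{1..n}. (dot d (D i) (Y j))\<^sup>2)
      + (\<Sum>i\<in>{1..n}. \<Sum>j\<in>{1..n}. (dot d (D j) (Y i))\<^sup>2) + Q\<^sup>2)"
    by (simp add: Q sum.distrib sum_distrib_left[symmetric] power2_eq_square sum_product)
  also have "(\<Sum>i\<in>{1..n}. \<Sum>j\<in>{1..n}. (dot d (D j) (Y i))\<^sup>2) = (\<Sum>i\<in>{1..n}. \<Sum>j\<in>{1..n}. (dot d (D i) (Y j))\<^sup>2)"
    by (rule sum.swap)
  also have "(\<Sum>i\<in>{1..n}. \<Sum>j\<in>{1..n}. (dot d (D i) (Y j))\<^sup>2) \<le> (\<Sum>i\<in>{1..n}. ?l * dot d (D i) (D i))"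
    by (intro sum_mono sum_dot_sq_le)
  also have "\<dots> = ?l * Q" by (simp add: Q sum_distrib_left)
  finally show ?thesis by (simp add: algebra_simps)
qed

text \<open>Suppose Q < c m with m the minimum. Its two members match the two terms of the operator
  norm: m \<le> n^2 gives m d \<le> n^2 d, and m \<le> n sqrt d gives m n sqrt d \<le> n^2 d, hence
  also m^2 \<le> n^2 d. So the Gram matrices would differ by less than b n^2 d in squared Frobenius
  norm.\<close>

lemma frobenius_distance_ge:
  fixes X Y :: "nat \<Rightarrow> nat \<Rightarrow> real"
  assumes nd: "0 < n" "0 < d" and K: "0 \<le> K" and F: "gram_dev_sq n d Y \<le> K\<^sup>2 * (real n)\<^sup>2 * real d"
    and R: "b * (real n)\<^sup>2 * real d \<le> (\<Sum>i\<in>{1..n}. \<Sum>j\<in>{1..n}. (dot d (X i) (X j) - dot d (Y i) (Y j))\<^sup>2)"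
    and c: "0 < c" "c \<le> 1" "c * (6 * (1 + K) + 3) \<le> b"
  shows "c * min ((real n)\<^sup>2) (real n * sqrt (real d)) \<le> (\<Sum>i\<in>{1..n}. \<Sum>k<d. (X i k - Y i k)\<^sup>2)"
proof (rule ccontr)
  define Q where "Q = (\<Sum>i\<in>{1..n}. \<Sum>k<d. (X i k - Y i k)\<^sup>2)"
  define m where "m = min ((real n)\<^sup>2) (real n * sqrt (real d))"
  define l where "l = real d + K * real n * sqrt (real d)"
  have Q0: "0 \<le> Q" by (simp add: Q_def sum_nonneg)
  have m0: "0 < m" using nd by (simp add: m_def)
  have l0: "0 < l" using nd K by (auto simp: l_def intro: add_pos_nonneg)
  assume "\<not> ?thesis"
  then have Qm: "Q < c * m" by (simp add: Q_def m_def)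
  have "sqrt (gram_dev_sq n d Y) \<le> sqrt (K\<^sup>2 * (real n)\<^sup>2 * real d)" using F by simp
  also have "\<dots> = K * real n * sqrt (real d)" using K by (simp add: real_sqrt_mult)
  finally have "real d + sqrt (gram_dev_sq n d Y) \<le> l" by (simp add: l_def)
  then have "6 * Q * (real d + sqrt (gram_dev_sq n d Y)) + 3 * Q\<^sup>2 \<le> 6 * Q * l + 3 * Q\<^sup>2"
    using Q0 by (intro add_mono mult_left_mono) auto
  with gram_difference_le[where d = d and n = n and X = X and Y = Y] R
  have "b * (real n)\<^sup>2 * real d \<le> 6 * Q * l + 3 * Q\<^sup>2" unfolding Q_def by linarith
  also have "6 * Q * l < 6 * (c * m) * l" using Qm l0 by simp
  also have "3 * Q\<^sup>2 \<le> 3 * (c * m)\<^sup>2" using Qm Q0 by (intro mult_left_mono power_mono) auto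
  also have "6 * (c * m) * l + 3 * (c * m)\<^sup>2 \<le> c * (6 * (1 + K) + 3) * ((real n)\<^sup>2 * real d)"
  proof -
    have "m * real d \<le> (real n)\<^sup>2 * real d" by (intro mult_right_mono) (auto simp: m_def)
    moreover have msq: "m * (real n * sqrt (real d)) \<le> (real n)\<^sup>2 * real d"
    proof -
      have "m * (real n * sqrt (real d)) \<le> (real n * sqrt (real d)) * (real n * sqrt (real d))"
        by (intro mult_right_mono) (auto simp: m_def)
      then show ?thesis by (simp add: power2_eq_square mult_ac)
    qed
    then have "K * (m * (real n * sqrt (real d))) \<le> K * ((real n)\<^sup>2 * real d)"
      using K by (intro mult_left_mono) auto
    ultimately have ml: "m * l \<le> (1 + K) * ((real n)\<^sup>2 * real d)"
      by (simp add: l_def algebra_simps)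
    have "m * m \<le> m * (real n * sqrt (real d))" using m0 by (intro mult_left_mono) (auto simp: m_def)
    with msq have mm: "m * m \<le> (real n)\<^sup>2 * real d" by linarith
    have "6 * (c * m) * l = 6 * c * (m * l)" by simp
    also have "\<dots> \<le> 6 * c * ((1 + K) * ((real n)\<^sup>2 * real d))" using ml c by (intro mult_left_mono) auto
    finally have 1: "6 * (c * m) * l \<le> 6 * c * ((1 + K) * ((real n)\<^sup>2 * real d))" .
    have "3 * (c * m)\<^sup>2 = 3 * (c * c) * (m * m)" by (simp add: power2_eq_square)
    also have "\<dots> \<le> 3 * (c * 1) * ((real n)\<^sup>2 * real d)"
      using c m0 by (intro mult_mono[OF _ mm]) auto
    finally have 2: "3 * (c * m)\<^sup>2 \<le> 3 * c * ((real n)\<^sup>2 * real d)" by simp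
    from add_mono[OF 1 2] show ?thesis by (simp add: algebra_simps)
  qed
  also have "\<dots> \<le> b * ((real n)\<^sup>2 * real d)" using c by (intro mult_right_mono) auto
  finally show False by (simp add: mult_ac)
qed

section \<open>Expected edge counts and the upper tail estimate\<close>

lemma sum_pairs_eq_choose: "(\<Sum>i\<in>{1..n}. \<Sum>j\<in>{i<..n}. 1 :: real) = real (n choose 2)"
proof -
  have "(\<Sum>i\<in>{1..n}. n - i) = n choose 2"
  proof (induction n)
    case (Suc n)
    have "(\<Sum>i\<in>{1..Suc n}. Suc n - i) = (\<Sum>i\<in>{1..n}. Suc n - i)" by simp
    also have "\<dots> = (\<Sum>i\<in>{1..n}. (n - i) + 1)" by (intro sum.cong) auto
    also have "\<dots> = (n choose 2) + n" using Suc.IH by (subst sum.distrib) simp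
    finally show ?case by (simp add: numeral_2_eq_2)
  qed simp
  moreover have "(\<Sum>i\<in>{1..n}. \<Sum>j\<in>{i<..n}. 1 :: real) = real (\<Sum>i\<in>{1..n}. n - i)"
    unfolding of_nat_sum by (intro sum.cong) simp_all
  ultimately show ?thesis by simp
qed

lemma choose_two_ge:
  assumes "2 \<le> n"
  shows "(real n)\<^sup>2 / 4 \<le> real (n choose 2)"
proof -
  have "real (n choose 2) = real n * (real n - 1) / 2"
    using assms by (simp add: choose_two real_of_nat_div of_nat_diff)
  moreover have "real n * (real n / 2) \<le> real n * (real n - 1)"
    using assms by (intro mult_left_mono) auto
  ultimately show ?thesis by (simp add: power2_eq_square)
qed

text \<open>Linearity over pairs. The level \<open>t\<close> is arbitrary since the formula is
  needed both at the threshold and at the lowered level.\<close>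

lemma nn_integral_card_rgg_edges:
  "(\<integral>\<^sup>+X. ennreal (real (card (rgg_edges n d t X))) \<partial>gaussian_sample n d)
   = ennreal (real (n choose 2) * measure (std_gaussian d \<Otimes>\<^sub>M std_gaussian d)
       {w \<in> space (std_gaussian d \<Otimes>\<^sub>M std_gaussian d). t \<le> dot d (fst w) (snd w)})"
proof -
  interpret N: prob_space "std_gaussian d" by (rule prob_space_std_gaussian)
  interpret NN: pair_prob_space "std_gaussian d" "std_gaussian d" ..
  let ?P = "std_gaussian d \<Otimes>\<^sub>M std_gaussian d"
  let ?q = "measure ?P {w \<in> space ?P. t \<le> dot d (fst w) (snd w)}"
  have [measurable]: "(\<lambda>X. of_bool (t \<le> dot d (X i) (X j)) :: real) \<in> borel_measurable (gaussian_sample n d)"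
    if "i \<in> {1..n}" "j \<in> {1..n}" for i j
    using that unfolding of_bool_def by measurable
  have one: "(\<integral>\<^sup>+X. ennreal (of_bool (t \<le> dot d (X i) (X j))) \<partial>gaussian_sample n d) = ennreal ?q"
    if "i \<in> {1..n}" "j \<in> {i<..n}" for i j
  proof -
    have "(\<integral>\<^sup>+X. ennreal (of_bool (t \<le> dot d (X i) (X j))) \<partial>gaussian_sample n d)
       = (\<integral>\<^sup>+w. (\<lambda>(x, y). ennreal (of_bool (t \<le> dot d x y))) w \<partial>?P)"
      using that by (intro nn_integral_gaussian_sample_pair[where f = "\<lambda>x y. ennreal (of_bool (t \<le> dot d x y))"])
        (auto simp: case_prod_unfold of_bool_def)
    also have "\<dots> = (\<integral>\<^sup>+w. indicator {w \<in> space ?P. t \<le> dot d (fst w) (snd w)} w \<partial>?P)"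
      by (intro nn_integral_cong) (auto simp: indicator_def)
    also have "\<dots> = emeasure ?P {w \<in> space ?P. t \<le> dot d (fst w) (snd w)}"
      by (rule nn_integral_indicator) measurable
    finally show ?thesis by (simp add: NN.P.emeasure_eq_measure)
  qed
  have "(\<integral>\<^sup>+X. ennreal (real (card (rgg_edges n d t X))) \<partial>gaussian_sample n d)
    = (\<integral>\<^sup>+X. (\<Sum>i\<in>{1..n}. \<Sum>j\<in>{i<..n}. ennreal (of_bool (t \<le> dot d (X i) (X j)))) \<partial>gaussian_sample n d)"
    unfolding card_rgg_edges by (intro nn_integral_cong) (simp add: sum_ennreal sum_nonneg)
  also have "\<dots> = (\<Sum>i\<in>{1..n}. \<Sum>j\<in>{i<..n}. (\<integral>\<^sup>+X. ennreal (of_bool (t \<le> dot d (X i) (X j))) \<partial>gaussian_sample n d))"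
    by (subst nn_integral_sum, measurable, intro sum.cong refl nn_integral_sum) measurable
  also have "\<dots> = (\<Sum>i\<in>{1..n}. \<Sum>j\<in>{i<..n}. ennreal ?q)"
    by (intro sum.cong refl one)
  also have "\<dots> = ennreal (\<Sum>i\<in>{1..n}. \<Sum>j\<in>{i<..n}. 1 * ?q)"
    by (simp only: mult_1_left sum_ennreal sum_nonneg measure_nonneg)
  also have "(\<Sum>i\<in>{1..n}. \<Sum>j\<in>{i<..n}. 1 * ?q) = real (n choose 2) * ?q"
    unfolding sum_pairs_eq_choose[symmetric] sum_distrib_right ..
  finally show ?thesis .
qed

text \<open>The excess \<epsilon> is divided: lowering the threshold raises the edge probability to
  at most (1 + \<epsilon>/4) p, fewer than (1 + \<epsilon>/2) p of the pairs are then edges with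
  probability bounded away from zero, and the remaining \<epsilon>/2 is the surplus of A over
  B.\<close>

lemma upper_tail_le:
  fixes p \<epsilon> :: real
  assumes p: "0 < p" and \<epsilon>: "0 < \<epsilon>"
  shows "\<exists>C>0. \<forall>n d t. 2 \<le> n \<longrightarrow> 0 < d \<longrightarrow> is_threshold p d t \<longrightarrow>
    measure (gaussian_sample n d) {X \<in> space (gaussian_sample n d).
        (1 + \<epsilon>) * real (n choose 2) * p \<le> real (card (rgg_edges n d t X))}
      \<le> exp (- C * min ((real n)\<^sup>2) (real n * sqrt (real d)))"
proof -
  obtain \<delta> where \<delta>: "\<delta> > 0" "\<And>d t. 0 < d \<Longrightarrow>
    measure (std_gaussian d \<Otimes>\<^sub>M std_gaussian d)
      {w \<in> space (std_gaussian d \<Otimes>\<^sub>M std_gaussian d).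
         t - \<delta> * sqrt (real d) \<le> dot d (fst w) (snd w) \<and> dot d (fst w) (snd w) < t} \<le> \<epsilon> * p / 4"
    using dot_anticoncentration[of "\<epsilon> * p / 4"] p \<epsilon> by auto
  \<comment> \<open>The margin 1 - (1 + \<epsilon>/4) / (1 + \<epsilon>/2) in Markov's inequality
    for \<open>B1\<close> is 2 \<eta>. One \<eta> is spent on \<open>B2\<close>, the other bounds
    the probability of the good set from below.\<close>
  define \<eta> where "\<eta> = \<epsilon> / (8 * (1 + \<epsilon> / 2))"
  have \<eta>: "0 < \<eta>" "\<eta> < 1" using \<epsilon> by (auto simp: \<eta>_def divide_less_eq)
  \<comment> \<open>Makes Markov's bound for \<open>B2\<close>, which is 2 / K^2, equal to
    \<eta>.\<close>
  define K where "K = sqrt (2 / \<eta>)"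
  have K: "0 < K" "K\<^sup>2 = 2 / \<eta>" using \<eta> by (auto simp: K_def)
  \<comment> \<open>A squared gap \<delta>^2 d for at least \<epsilon> p / 2 times n^2 / 4
    pairs.\<close>
  define c1 where "c1 = \<delta>\<^sup>2 * \<epsilon> * p / 8"
  have c1: "0 < c1" using \<delta> \<epsilon> p by (simp add: c1_def)
  define c where "c = min 1 (c1 / (6 * (1 + K) + 3))"
  have "c \<le> c1 / (6 * (1 + K) + 3)" by (simp add: c_def)
  then have "c * (6 * (1 + K) + 3) \<le> c1"
    using K by (subst (asm) pos_le_divide_eq) auto
  moreover have "0 < c" "c \<le> 1"
    using c1 K by (auto simp: c_def)
  ultimately have c: "0 < c" "c \<le> 1" "c * (6 * (1 + K) + 3) \<le> c1" by auto
  \<comment> \<open>From m \<ge> M on, 1 / \<eta> is at most exp (c m / 8), half of the exponent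
    gained. Below M the Markov bound 1 / (1 + \<epsilon>) is enough, which is the second entry in
    the minimum defining \<open>C\<close>.\<close>
  define M where "M = 8 / c * ln (1 / \<eta>)"
  have M: "0 < M" using c \<eta> by (simp add: M_def)
  define C where "C = min (c / 8) (ln (1 + \<epsilon>) / M)"
  have C: "0 < C" using c M \<epsilon> by (simp add: C_def)
  show ?thesis
  proof (intro exI[of _ C] conjI allI impI C)
    fix n d :: nat and t :: real
    assume n: "2 \<le> n" and d: "0 < d" and t: "is_threshold p d t"
    interpret N: prob_space "std_gaussian d" by (rule prob_space_std_gaussian)
    interpret NN: pair_prob_space "std_gaussian d" "std_gaussian d" ..
    interpret G: prob_space "gaussian_sample n d" by (rule prob_space_gaussian_sample)
    let ?G = "gaussian_sample n d" and ?P = "std_gaussian d \<Otimes>\<^sub>M std_gaussian d"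
    let ?N = "real (n choose 2)"
    define m where "m = min ((real n)\<^sup>2) (real n * sqrt (real d))"
    define t' where "t' = t - \<delta> * sqrt (real d)"
    define A where "A = {X \<in> space ?G. (1 + \<epsilon>) * ?N * p \<le> real (card (rgg_edges n d t X))}"
    define B1 where "B1 = {X \<in> space ?G. (1 + \<epsilon> / 2) * ?N * p \<le> real (card (rgg_edges n d t' X))}"
    define B2 where "B2 = {X \<in> space ?G. K\<^sup>2 * (real n)\<^sup>2 * real d \<le> gram_dev_sq n d X}"
    have [measurable]: "(\<lambda>X. real (card (rgg_edges n d t X))) \<in> borel_measurable ?G" for t
      by (rule measurable_card_rgg_edges)
    have meas [measurable]: "A \<in> sets ?G" "B1 \<in> sets ?G" "B2 \<in> sets ?G"
      unfolding A_def B1_def B2_def by measurable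
    have N4: "(real n)\<^sup>2 / 4 \<le> ?N" by (rule choose_two_ge[OF n])
    moreover have "0 < (real n)\<^sup>2 / 4" using n by simp
    ultimately have N0: "0 < ?N" by linarith
    have pt: "measure ?P {w \<in> space ?P. t \<le> dot d (fst w) (snd w)} = p"
      using t by (simp add: is_threshold_def case_prod_unfold)
    have pt': "measure ?P {w \<in> space ?P. t' \<le> dot d (fst w) (snd w)} \<le> p + \<epsilon> * p / 4"
    proof -
      have "{w \<in> space ?P. t' \<le> dot d (fst w) (snd w)} \<subseteq>
        {w \<in> space ?P. t \<le> dot d (fst w) (snd w)} \<union>
        {w \<in> space ?P. t' \<le> dot d (fst w) (snd w) \<and> dot d (fst w) (snd w) < t}" by auto
      then have "measure ?P {w \<in> space ?P. t' \<le> dot d (fst w) (snd w)} \<le>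
        measure ?P ({w \<in> space ?P. t \<le> dot d (fst w) (snd w)} \<union>
        {w \<in> space ?P. t' \<le> dot d (fst w) (snd w) \<and> dot d (fst w) (snd w) < t})"
        by (intro NN.P.finite_measure_mono) auto
      also have "\<dots> \<le> measure ?P {w \<in> space ?P. t \<le> dot d (fst w) (snd w)} +
        measure ?P {w \<in> space ?P. t' \<le> dot d (fst w) (snd w) \<and> dot d (fst w) (snd w) < t}"
        by (intro measure_Un_le) auto
      also have "\<dots> \<le> p + \<epsilon> * p / 4" using pt \<delta>(2)[OF d, of t] by (simp add: t'_def)
      finally show ?thesis .
    qed
    have "measure ?G A \<le> ?N * p / ((1 + \<epsilon>) * ?N * p)"
      unfolding A_def using p \<epsilon> N0
      by (intro measure_ge_le_nn_integral G.prob_space_axioms) (auto simp: nn_integral_card_rgg_edges pt)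
    also have "\<dots> = 1 / (1 + \<epsilon>)"
      using nonzero_divide_mult_cancel_right[of "?N * p" "1 + \<epsilon>"] p N0 by (simp add: mult.assoc)
    finally have A1: "measure ?G A \<le> exp (- ln (1 + \<epsilon>))"
      using \<epsilon> by (simp add: exp_minus inverse_eq_divide)
    have "measure ?G B1 \<le> ?N * (p + \<epsilon> * p / 4) / ((1 + \<epsilon> / 2) * ?N * p)"
      unfolding B1_def using p \<epsilon> N0 pt'
      by (intro measure_ge_le_nn_integral G.prob_space_axioms)
        (auto simp: nn_integral_card_rgg_edges intro!: ennreal_leI mult_left_mono)
    also have "\<dots> = ((1 + \<epsilon> / 4) * (?N * p)) / ((1 + \<epsilon> / 2) * (?N * p))"
      by (rule arg_cong2[where f = "(/)"]) (simp_all add: algebra_simps)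
    also have "\<dots> = (1 + \<epsilon> / 4) / (1 + \<epsilon> / 2)"
      using p N0 by (intro mult_divide_mult_cancel_right) simp
    also have "\<dots> = 1 - 2 * \<eta>" using \<epsilon> by (simp add: \<eta>_def field_simps)
    finally have B1: "measure ?G B1 \<le> 1 - 2 * \<eta>" .
    have "measure ?G B2 \<le> (2 * (real n)\<^sup>2 * real d) / (K\<^sup>2 * (real n)\<^sup>2 * real d)"
      unfolding B2_def using K n d \<eta> nn_integral_gram_dev_sq
      by (intro measure_ge_le_nn_integral G.prob_space_axioms) auto
    also have "\<dots> = \<eta>" using K n d \<eta> by (simp add: field_simps)
    finally have B2: "measure ?G B2 \<le> \<eta>" .
    have "measure ?G (B1 \<union> B2) \<le> 1 - \<eta>"
      using measure_Un_le[OF meas(2,3)] B1 B2 by linarith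
    then have B: "\<eta> \<le> measure ?G (space ?G - (B1 \<union> B2))"
      by (subst G.prob_compl) auto
    have "measure ?G A * measure ?G (space ?G - (B1 \<union> B2)) \<le> exp (- (c * m / 4))"
    proof (rule measure_mult_le_exp_dist[OF property_tau_gaussian_sample prob_space_gaussian_sample])
      fix X Y assume X: "X \<in> A" and Y: "Y \<in> space ?G - (B1 \<union> B2)"
      have "c * m \<le> (\<Sum>i\<in>{1..n}. \<Sum>k<d. (X i k - Y i k)\<^sup>2)"
        unfolding m_def
      proof (rule frobenius_distance_ge[where K = K and b = c1])
        show "gram_dev_sq n d Y \<le> K\<^sup>2 * (real n)\<^sup>2 * real d" using Y by (auto simp: B2_def)
        have "\<epsilon> / 2 * ?N * p \<le> real (card (rgg_edges n d t X)) - real (card (rgg_edges n d t' Y))"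
          using X Y by (auto simp: A_def B1_def algebra_simps)
        also have "\<dots> = (\<Sum>i\<in>{1..n}. \<Sum>j\<in>{i<..n}. of_bool (t \<le> dot d (X i) (X j)) - of_bool (t' \<le> dot d (Y i) (Y j)))"
          unfolding card_rgg_edges by (simp add: sum_subtractf)
        finally have "\<delta>\<^sup>2 * real d * (\<epsilon> / 2 * ?N * p)
          \<le> \<delta>\<^sup>2 * real d * (\<Sum>i\<in>{1..n}. \<Sum>j\<in>{i<..n}. of_bool (t \<le> dot d (X i) (X j)) - of_bool (t' \<le> dot d (Y i) (Y j)))"
          by (rule mult_left_mono) simp
        also have "\<dots> = (\<Sum>i\<in>{1..n}. \<Sum>j\<in>{i<..n}. \<delta>\<^sup>2 * real d * (of_bool (t \<le> dot d (X i) (X j)) - of_bool (t' \<le> dot d (Y i) (Y j))))"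
          by (simp add: sum_distrib_left)
        also have "\<dots> \<le> (\<Sum>i\<in>{1..n}. \<Sum>j\<in>{i<..n}. (dot d (X i) (X j) - dot d (Y i) (Y j))\<^sup>2)"
        proof (intro sum_mono)
          fix i j
          show "\<delta>\<^sup>2 * real d * (of_bool (t \<le> dot d (X i) (X j)) - of_bool (t' \<le> dot d (Y i) (Y j)))
            \<le> (dot d (X i) (X j) - dot d (Y i) (Y j))\<^sup>2"
          proof (cases "t \<le> dot d (X i) (X j) \<and> \<not> t' \<le> dot d (Y i) (Y j)")
            case True
            then have "\<delta> * sqrt (real d) \<le> dot d (X i) (X j) - dot d (Y i) (Y j)" by (simp add: t'_def)
            then have "(\<delta> * sqrt (real d))\<^sup>2 \<le> (dot d (X i) (X j) - dot d (Y i) (Y j))\<^sup>2"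
              using \<delta>(1) by (intro power_mono) auto
            then show ?thesis using True by (simp add: power_mult_distrib)
          next
            case False
            then have "\<delta>\<^sup>2 * real d * (of_bool (t \<le> dot d (X i) (X j)) - of_bool (t' \<le> dot d (Y i) (Y j))) \<le> 0"
              by (auto simp: mult_le_0_iff)
            then show ?thesis by (rule order_trans) simp
          qed
        qed
        also have "\<dots> \<le> (\<Sum>i\<in>{1..n}. \<Sum>j\<in>{1..n}. (dot d (X i) (X j) - dot d (Y i) (Y j))\<^sup>2)"
          by (intro sum_mono sum_mono2) auto
        finally have "\<delta>\<^sup>2 * real d * (\<epsilon> / 2 * ?N * p) \<le> \<dots>" .
        moreover have "c1 * (real n)\<^sup>2 * real d \<le> \<delta>\<^sup>2 * real d * (\<epsilon> / 2 * ?N * p)"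
        proof -
          have "(\<delta>\<^sup>2 * real d * \<epsilon> / 2 * p) * ((real n)\<^sup>2 / 4) \<le> (\<delta>\<^sup>2 * real d * \<epsilon> / 2 * p) * ?N"
            using \<epsilon> p by (intro mult_left_mono N4) auto
          then show ?thesis by (simp add: c1_def mult_ac)
        qed
        ultimately show "c1 * (real n)\<^sup>2 * real d \<le> (\<Sum>i\<in>{1..n}. \<Sum>j\<in>{1..n}. (dot d (X i) (X j) - dot d (Y i) (Y j))\<^sup>2)"
          by linarith
      qed (use n d K c in auto)
      then show "c * m / 4 \<le> (\<Sum>i\<in>{1..n}. \<Sum>k<d. (X i k - Y i k)\<^sup>2 / 4)"
        by (simp add: sum_divide_distrib[symmetric])
    qed (auto intro!: sum_nonneg)
    moreover have "measure ?G A * \<eta> \<le> measure ?G A * measure ?G (space ?G - (B1 \<union> B2))"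
      by (intro mult_left_mono B) auto
    ultimately have A2: "measure ?G A * \<eta> \<le> exp (- (c * m / 4))" by linarith
    have m0: "0 \<le> m" by (simp add: m_def)
    have "measure ?G A \<le> exp (- C * m)"
    proof (cases "M \<le> m")
      case True
      then have "ln (1 / \<eta>) \<le> c * m / 8" using c by (simp add: M_def field_simps)
      have "measure ?G A \<le> exp (- (c * m / 4)) * exp (ln (1 / \<eta>))"
        using A2 \<eta> by (simp add: field_simps)
      also have "\<dots> \<le> exp (- (c * m / 4)) * exp (c * m / 8)"
        using \<open>ln (1 / \<eta>) \<le> c * m / 8\<close> by (intro mult_left_mono) auto
      also have "\<dots> = exp (- (c / 8) * m)" unfolding exp_add[symmetric] by simp
      also have "\<dots> \<le> exp (- C * m)"
        using mult_right_mono[OF min.cobounded1 m0, of "c / 8" "ln (1 + \<epsilon>) / M"] by (simp add: C_def)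
      finally show ?thesis .
    next
      case False
      have "C * m \<le> ln (1 + \<epsilon>) / M * M"
        using False M m0 \<epsilon> by (intro mult_mono) (auto simp: C_def)
      then have "exp (- ln (1 + \<epsilon>)) \<le> exp (- C * m)" using M by simp
      with A1 show ?thesis by linarith
    qed
    then show "measure ?G {X \<in> space ?G. (1 + \<epsilon>) * ?N * p \<le> real (card (rgg_edges n d t X))}
      \<le> exp (- C * min ((real n)\<^sup>2) (real n * sqrt (real d)))"
      by (simp add: A_def m_def)
  qed
qed

subsection \<open>Shifts of the Gaussian measure\<close>

text \<open>The Cameron-Martin formula in one dimension: the exponential is the ratio of the
  translated to the original density.\<close>

lemma nn_integral_std_normal_shift:
  fixes f :: "real \<Rightarrow> ennreal"
  assumes "f \<in> borel_measurable std_normal_distribution"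
  shows "(\<integral>\<^sup>+z. f z \<partial>std_normal_distribution)
    = (\<integral>\<^sup>+z. f (z + v) * ennreal (exp (- (v * z + v\<^sup>2 / 2))) \<partial>std_normal_distribution)"
proof -
  have [measurable]: "f \<in> borel_measurable borel" using assms by (simp cong: measurable_cong_sets)
  have "(\<integral>\<^sup>+z. f z \<partial>std_normal_distribution) = (\<integral>\<^sup>+z. ennreal (std_normal_density z) * f z \<partial>lborel)"
    by (simp add: nn_integral_density)
  also have "\<dots> = (\<integral>\<^sup>+z. ennreal (std_normal_density (v + 1 * z)) * f (v + 1 * z) \<partial>lborel)"
    by (subst nn_integral_real_affine[where c = 1 and t = v]) auto
  also have "\<dots> = (\<integral>\<^sup>+z. ennreal (std_normal_density z) * (f (z + v) * ennreal (exp (- (v * z + v\<^sup>2 / 2)))) \<partial>lborel)"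
  proof (intro nn_integral_cong)
    fix z
    have "exp (- ((v + z)\<^sup>2 / 2)) = exp (- (z\<^sup>2 / 2)) * exp (- (v * z + v\<^sup>2 / 2))"
      unfolding exp_add[symmetric] by (rule arg_cong[where f = exp]) (simp add: power2_eq_square field_simps)
    then have "std_normal_density (v + z) = std_normal_density z * exp (- (v * z + v\<^sup>2 / 2))"
      by (simp add: std_normal_density_def)
    then show "ennreal (std_normal_density (v + 1 * z)) * f (v + 1 * z)
      = ennreal (std_normal_density z) * (f (z + v) * ennreal (exp (- (v * z + v\<^sup>2 / 2))))"
      by (simp add: ennreal_mult mult_ac add.commute)
  qed
  also have "\<dots> = (\<integral>\<^sup>+z. f (z + v) * ennreal (exp (- (v * z + v\<^sup>2 / 2))) \<partial>std_normal_distribution)"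
    by (subst nn_integral_density) auto
  finally show ?thesis .
qed

lemma nn_integral_PiM_std_normal_shift:
  fixes f :: "('i \<Rightarrow> real) \<Rightarrow> ennreal"
  assumes "finite I" and "f \<in> borel_measurable (Pi\<^sub>M I (\<lambda>_. std_normal_distribution))"
  shows "(\<integral>\<^sup>+x. f x \<partial>Pi\<^sub>M I (\<lambda>_. std_normal_distribution))
    = (\<integral>\<^sup>+x. f (\<lambda>i\<in>I. x i + v i) * ennreal (exp (- (\<Sum>i\<in>I. v i * x i + (v i)\<^sup>2 / 2))) \<partial>Pi\<^sub>M I (\<lambda>_. std_normal_distribution))"
  using assms
proof (induction I arbitrary: f rule: finite_induct)
  case empty
  then show ?case by (simp add: PiM_empty nn_integral_count_space_finite)
next
  case (insert i I)
  note [measurable] = insert.prems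
  interpret P: product_sigma_finite "\<lambda>_::'i. std_normal_distribution"
    by (intro product_sigma_finite.intro prob_space_imp_sigma_finite prob_space_std_normal)
  let ?N = std_normal_distribution
  let ?Q = "Pi\<^sub>M I (\<lambda>_. ?N)" and ?Q' = "Pi\<^sub>M (insert i I) (\<lambda>_. ?N)"
  let ?e = "\<lambda>j z. v j * z + (v j)\<^sup>2 / 2"
  have comp [measurable]: "(\<lambda>x. x j) \<in> borel_measurable (Pi\<^sub>M J (\<lambda>_. ?N))" if "j \<in> J" for j and J :: "'i set"
    using measurable_component_singleton[OF that, of "\<lambda>_. ?N"] by (simp cong: measurable_cong_sets)
  have upd: "(\<lambda>z. x(i := z)) \<in> measurable ?N ?Q'" if "x \<in> space ?Q" for x
    using that insert.hyps by (intro measurable_component_update) auto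
  have shift: "(\<lambda>x. \<lambda>j\<in>J. x j + v j) \<in> measurable (Pi\<^sub>M J (\<lambda>_. ?N)) (Pi\<^sub>M J (\<lambda>_. ?N))" for J :: "'i set"
  proof (rule measurable_restrict)
    fix j assume "j \<in> J"
    then have "(\<lambda>x. x j + v j) \<in> borel_measurable (Pi\<^sub>M J (\<lambda>_. ?N))" by measurable
    then show "(\<lambda>x. x j + v j) \<in> measurable (Pi\<^sub>M J (\<lambda>_. ?N)) ?N" by (simp cong: measurable_cong_sets)
  qed
  have "(\<lambda>w. (fst w)(i := snd w + v i)) \<in> measurable (?Q \<Otimes>\<^sub>M ?N) ?Q'"
  proof -
    have "(\<lambda>w. (fst w, snd w + v i)) \<in> measurable (?Q \<Otimes>\<^sub>M ?N) (?Q \<Otimes>\<^sub>M ?N)"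
      by (intro measurable_Pair measurable_fst) (simp cong: measurable_cong_sets)
    from measurable_compose[OF this measurable_add_dim] show ?thesis by simp
  qed
  then have [measurable]: "(\<lambda>w. f ((fst w)(i := snd w + v i))) \<in> borel_measurable (?Q \<Otimes>\<^sub>M ?N)"
    by (rule measurable_compose) (rule insert.prems)
  have [measurable]: "(\<lambda>w. snd w) \<in> borel_measurable (?Q \<Otimes>\<^sub>M ?N)"
    using measurable_snd[of ?Q ?N] by (simp cong: measurable_cong_sets)
  have h: "(\<lambda>x. \<integral>\<^sup>+z. f (x(i := z + v i)) * ennreal (exp (- ?e i z)) \<partial>?N) \<in> borel_measurable ?Q"
    by (rule sigma_finite_measure.borel_measurable_nn_integral[OF prob_space_imp_sigma_finite[OF prob_space_std_normal]]) (simp add: case_prod_unfold)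
  have "(\<integral>\<^sup>+x. f x \<partial>?Q') = (\<integral>\<^sup>+x. \<integral>\<^sup>+z. f (x(i := z)) \<partial>?N \<partial>?Q)"
    using insert.hyps insert.prems by (rule P.product_nn_integral_insert)
  also have "\<dots> = (\<integral>\<^sup>+x. \<integral>\<^sup>+z. f (x(i := z + v i)) * ennreal (exp (- ?e i z)) \<partial>?N \<partial>?Q)"
    by (intro nn_integral_cong nn_integral_std_normal_shift measurable_compose[OF upd insert.prems])
  also have "\<dots> = (\<integral>\<^sup>+x. (\<integral>\<^sup>+z. f ((\<lambda>j\<in>I. x j + v j)(i := z + v i)) * ennreal (exp (- ?e i z)) \<partial>?N)
      * ennreal (exp (- (\<Sum>j\<in>I. ?e j (x j)))) \<partial>?Q)"
    by (rule insert.IH[OF h])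
  also have "\<dots> = (\<integral>\<^sup>+x. \<integral>\<^sup>+z. f (\<lambda>j\<in>insert i I. (x(i := z)) j + v j)
      * ennreal (exp (- (\<Sum>j\<in>insert i I. ?e j ((x(i := z)) j)))) \<partial>?N \<partial>?Q)"
  proof (rule nn_integral_cong)
    fix x assume x: "x \<in> space ?Q"
    have eq: "(\<lambda>j\<in>I. x j + v j)(i := z + v i) = (\<lambda>j\<in>insert i I. (x(i := z)) j + v j)" for z
      by auto
    have s: "(\<Sum>j\<in>insert i I. ?e j ((x(i := z)) j)) = ?e i z + (\<Sum>j\<in>I. ?e j (x j))" for z
    proof -
      have "(\<Sum>j\<in>I. ?e j ((x(i := z)) j)) = (\<Sum>j\<in>I. ?e j (x j))"
        using insert.hyps by (intro sum.cong) auto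
      then show ?thesis using insert.hyps by simp
    qed
    have "(\<lambda>j\<in>I. x j + v j) \<in> space ?Q" by (rule measurable_space[OF shift x])
    from measurable_compose[OF upd[OF this] insert.prems]
    have "(\<lambda>z. f ((\<lambda>j\<in>I. x j + v j)(i := z))) \<in> borel_measurable borel" by (simp cong: measurable_cong_sets)
    from measurable_compose[OF _ this, of "\<lambda>z. z + v i" borel]
    have m: "(\<lambda>z. f ((\<lambda>j\<in>I. x j + v j)(i := z + v i))) \<in> borel_measurable borel" by simp
    have "(\<integral>\<^sup>+z. f ((\<lambda>j\<in>I. x j + v j)(i := z + v i)) * ennreal (exp (- ?e i z)) \<partial>?N) * ennreal (exp (- (\<Sum>j\<in>I. ?e j (x j))))
      = (\<integral>\<^sup>+z. f ((\<lambda>j\<in>I. x j + v j)(i := z + v i)) * ennreal (exp (- ?e i z)) * ennreal (exp (- (\<Sum>j\<in>I. ?e j (x j)))) \<partial>?N)"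
      using m by (intro nn_integral_multc[symmetric]) (simp cong: measurable_cong_sets)
    also have "\<dots> = (\<integral>\<^sup>+z. f (\<lambda>j\<in>insert i I. (x(i := z)) j + v j)
      * ennreal (exp (- (\<Sum>j\<in>insert i I. ?e j ((x(i := z)) j)))) \<partial>?N)"
      unfolding eq s mult.assoc by (intro nn_integral_cong) (simp add: ennreal_mult[symmetric] exp_add[symmetric])
    finally show "(\<integral>\<^sup>+z. f ((\<lambda>j\<in>I. x j + v j)(i := z + v i)) * ennreal (exp (- ?e i z)) \<partial>?N) * ennreal (exp (- (\<Sum>j\<in>I. ?e j (x j))))
      = (\<integral>\<^sup>+z. f (\<lambda>j\<in>insert i I. (x(i := z)) j + v j)
      * ennreal (exp (- (\<Sum>j\<in>insert i I. ?e j ((x(i := z)) j)))) \<partial>?N)" .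
  qed
  also have "\<dots> = (\<integral>\<^sup>+x. f (\<lambda>j\<in>insert i I. x j + v j) * ennreal (exp (- (\<Sum>j\<in>insert i I. ?e j (x j)))) \<partial>?Q')"
  proof (rule P.product_nn_integral_insert[OF insert.hyps, symmetric])
    have "(\<lambda>x. f (\<lambda>j\<in>insert i I. x j + v j)) \<in> borel_measurable ?Q'"
      by (rule measurable_compose[OF shift insert.prems])
    moreover have "(\<lambda>x. \<Sum>j\<in>insert i I. ?e j (x j)) \<in> borel_measurable ?Q'"
      by (intro borel_measurable_sum) measurable
    ultimately show "(\<lambda>x. f (\<lambda>j\<in>insert i I. x j + v j) * ennreal (exp (- (\<Sum>j\<in>insert i I. ?e j (x j))))) \<in> borel_measurable ?Q'"
      by measurable
  qed
  finally show ?case .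
qed

lemma nn_integral_std_gaussian_shift:
  assumes "f \<in> borel_measurable (std_gaussian d)"
  shows "(\<integral>\<^sup>+x. f x \<partial>std_gaussian d)
    = (\<integral>\<^sup>+x. f (\<lambda>k\<in>{..<d}. x k + v k) * ennreal (exp (- (dot d v x + dot d v v / 2))) \<partial>std_gaussian d)"
  using nn_integral_PiM_std_normal_shift[of "{..<d}" f v] assms
  by (simp add: std_gaussian_def dot_def sum.distrib power2_eq_square sum_divide_distrib)

text \<open>Given the other rows, the translation is a fixed vector, because \<open>indep\<close>
  forbids it to look at row \<open>m\<close>; so the formula for fixed translations applies under
  the outer integral.\<close>

lemma nn_integral_gaussian_sample_shift:
  assumes m: "m \<in> {1..n}"
    and f: "f \<in> borel_measurable (gaussian_sample n d)"
    and v: "\<And>k. k < d \<Longrightarrow> (\<lambda>X. v X k) \<in> borel_measurable (gaussian_sample n d)"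
    and indep: "\<And>X y k. v (X(m := y)) k = v X k"
  shows "(\<integral>\<^sup>+X. f X \<partial>gaussian_sample n d)
    = (\<integral>\<^sup>+X. f (X(m := \<lambda>k\<in>{..<d}. X m k + v X k)) * ennreal (exp (- (dot d (v X) (X m) + dot d (v X) (v X) / 2)))
        \<partial>gaussian_sample n d)"
proof -
  interpret P: product_sigma_finite "\<lambda>_::nat. std_gaussian d"
    by (intro product_sigma_finite.intro prob_space_imp_sigma_finite prob_space_std_gaussian)
  let ?J = "{1..n} - {m}"
  have J: "insert m ?J = {1..n}" "finite ?J" "m \<notin> ?J" using m by auto
  let ?Q = "Pi\<^sub>M ?J (\<lambda>_. std_gaussian d)" and ?Q' = "Pi\<^sub>M {1..n} (\<lambda>_. std_gaussian d)"
  let ?g = "\<lambda>X. f (X(m := \<lambda>k\<in>{..<d}. X m k + v X k)) * ennreal (exp (- (dot d (v X) (X m) + dot d (v X) (v X) / 2)))"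
  have f': "f \<in> borel_measurable ?Q'" using f by (simp add: gaussian_sample_def)
  have v' [measurable]: "(\<lambda>X. v X k) \<in> borel_measurable ?Q'" if "k < d" for k
    using v[OF that] by (simp add: gaussian_sample_def)
  have c [measurable]: "(\<lambda>X. X i k) \<in> borel_measurable ?Q'" if "i \<in> {1..n}" "k < d" for i k
    by (rule measurable_compose[OF measurable_component_singleton[OF that(1)] measurable_coordinate[OF that(2)]])
  have g: "?g \<in> borel_measurable ?Q'"
  proof -
    have "(\<lambda>X. \<lambda>k\<in>{..<d}. X m k + v X k) \<in> measurable ?Q' (std_gaussian d)"
      unfolding std_gaussian_def
    proof (rule measurable_restrict, fold std_gaussian_def)
      fix k assume "k \<in> {..<d}"
      then have "(\<lambda>X. X m k + v X k) \<in> borel_measurable ?Q'" using m by (intro borel_measurable_add c v') auto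
      then show "(\<lambda>X. X m k + v X k) \<in> measurable ?Q' std_normal_distribution" by (simp cong: measurable_cong_sets)
    qed
    then have "(\<lambda>X. X(m := \<lambda>k\<in>{..<d}. X m k + v X k)) \<in> measurable ?Q' ?Q'"
      using m by (intro measurable_fun_upd[where J = "{1..n}"]) auto
    then have "(\<lambda>X. f (X(m := \<lambda>k\<in>{..<d}. X m k + v X k))) \<in> borel_measurable ?Q'"
      by (rule measurable_compose[OF _ f'])
    moreover have "(\<lambda>X. dot d (v X) (X m) + dot d (v X) (v X) / 2) \<in> borel_measurable ?Q'"
      unfolding dot_def using m by (intro borel_measurable_add borel_measurable_divide borel_measurable_sum borel_measurable_times v' c borel_measurable_const) auto
    ultimately show ?thesis by measurable
  qed
  have "(\<integral>\<^sup>+X. f X \<partial>gaussian_sample n d) = (\<integral>\<^sup>+X. \<integral>\<^sup>+y. f (X(m := y)) \<partial>std_gaussian d \<partial>?Q)"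
    unfolding gaussian_sample_def using P.product_nn_integral_insert[OF J(2,3), of f] f' by (simp only: J(1))
  also have "\<dots> = (\<integral>\<^sup>+X. \<integral>\<^sup>+y. ?g (X(m := y)) \<partial>std_gaussian d \<partial>?Q)"
  proof (rule nn_integral_cong)
    fix X assume X: "X \<in> space ?Q"
    have "(\<lambda>y. X(m := y)) \<in> measurable (std_gaussian d) ?Q'"
      using measurable_component_update[OF X J(3)] by (simp only: J(1))
    from nn_integral_std_gaussian_shift[OF measurable_compose[OF this f'], of "v X"]
    have "(\<integral>\<^sup>+y. f (X(m := y)) \<partial>std_gaussian d) =
      (\<integral>\<^sup>+y. f (X(m := \<lambda>k\<in>{..<d}. y k + v X k)) * ennreal (exp (- (dot d (v X) y + dot d (v X) (v X) / 2))) \<partial>std_gaussian d)" .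
    moreover have "v (X(m := y)) = v X" for y using indep by (rule ext)
    ultimately show "(\<integral>\<^sup>+y. f (X(m := y)) \<partial>std_gaussian d) = (\<integral>\<^sup>+y. ?g (X(m := y)) \<partial>std_gaussian d)"
      by simp
  qed
  also have "\<dots> = (\<integral>\<^sup>+X. ?g X \<partial>gaussian_sample n d)"
    unfolding gaussian_sample_def using P.product_nn_integral_insert[OF J(2,3), of ?g] g by (simp only: J(1))
  finally show ?thesis .
qed

text \<open>
  The vectors with index at most \<open>l\<close> are translated by \<open>v i X\<close>, which is only used when it depends on
  the vectors \<open>X j\<close> with \<open>j < i\<close>; then the map is unipotent and \<open>exp (- shear_cost)\<close> is its Gaussian density.
\<close>

definition shear :: "nat \<Rightarrow> (nat \<Rightarrow> (nat \<Rightarrow> nat \<Rightarrow> real) \<Rightarrow> nat \<Rightarrow> real) \<Rightarrow> nat \<Rightarrow> (nat \<Rightarrow> nat \<Rightarrow> real) \<Rightarrow> nat \<Rightarrow> nat \<Rightarrow> real" where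
  "shear d v l X = (\<lambda>i. if i \<in> {1..l} then \<lambda>k\<in>{..<d}. X i k + v i X k else X i)"

definition shear_cost :: "nat \<Rightarrow> (nat \<Rightarrow> (nat \<Rightarrow> nat \<Rightarrow> real) \<Rightarrow> nat \<Rightarrow> real) \<Rightarrow> nat \<Rightarrow> (nat \<Rightarrow> nat \<Rightarrow> real) \<Rightarrow> real" where
  "shear_cost d v l X = (\<Sum>i\<in>{1..l}. dot d (v i X) (X i) + dot d (v i X) (v i X) / 2)"

lemma measurable_shear:
  assumes v: "\<And>i k. i \<in> {1..n} \<Longrightarrow> k < d \<Longrightarrow> (\<lambda>X. v i X k) \<in> borel_measurable (gaussian_sample n d)"
  shows "l \<le> n \<Longrightarrow> shear d v l \<in> measurable (gaussian_sample n d) (gaussian_sample n d)"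
    "l \<le> n \<Longrightarrow> shear_cost d v l \<in> borel_measurable (gaussian_sample n d)"
proof -
  assume l: "l \<le> n"
  have c: "(\<lambda>X. X i k) \<in> borel_measurable (gaussian_sample n d)" if "i \<in> {1..n}" "k < d" for i k
    by (rule measurable_compose[OF measurable_gaussian_sample_component[OF that(1)] measurable_coordinate[OF that(2)]])
  have "(\<lambda>X. \<lambda>i\<in>{1..n}. shear d v l X i) \<in> measurable (gaussian_sample n d) (gaussian_sample n d)"
    unfolding gaussian_sample_def
  proof (rule measurable_restrict, fold gaussian_sample_def)
    fix i assume i: "i \<in> {1..n}"
    show "(\<lambda>X. shear d v l X i) \<in> measurable (gaussian_sample n d) (std_gaussian d)"
    proof (cases "i \<le> l")
      case True
      have "(\<lambda>X. \<lambda>k\<in>{..<d}. X i k + v i X k) \<in> measurable (gaussian_sample n d) (std_gaussian d)"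
        unfolding std_gaussian_def
      proof (rule measurable_restrict)
        fix k assume "k \<in> {..<d}"
        then have "(\<lambda>X. X i k + v i X k) \<in> borel_measurable (gaussian_sample n d)"
          using i by (intro borel_measurable_add c v) auto
        then show "(\<lambda>X. X i k + v i X k) \<in> measurable (gaussian_sample n d) std_normal_distribution"
          by (simp cong: measurable_cong_sets)
      qed
      then show ?thesis using True i by (simp add: shear_def)
    next
      case False
      then show ?thesis using i by (simp add: shear_def)
    qed
  qed
  moreover have "(\<lambda>i\<in>{1..n}. shear d v l X i) = shear d v l X" if "X \<in> space (gaussian_sample n d)" for X
    using that l by (auto simp: gaussian_sample_def space_PiM shear_def restrict_def PiE_def extensional_def)
  ultimately show "shear d v l \<in> measurable (gaussian_sample n d) (gaussian_sample n d)"
    by (subst measurable_cong[where g = "\<lambda>X. \<lambda>i\<in>{1..n}. shear d v l X i"]) simp_all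
  show "shear_cost d v l \<in> borel_measurable (gaussian_sample n d)"
    unfolding shear_cost_def dot_def using l
    by (intro borel_measurable_add borel_measurable_divide borel_measurable_sum borel_measurable_times v c borel_measurable_const) auto
qed

text \<open>All translations are evaluated at the original sample. Induction adds row l + 1: moving
  it changes none of the translations of rows up to l + 1, which look only at smaller indices, so
  the earlier rows and their cost are untouched and the new density is just one more factor.\<close>

lemma nn_integral_gaussian_sample_shear:
  assumes f: "f \<in> borel_measurable (gaussian_sample n d)"
    and v: "\<And>i k. i \<in> {1..n} \<Longrightarrow> k < d \<Longrightarrow> (\<lambda>X. v i X k) \<in> borel_measurable (gaussian_sample n d)"
    and past: "\<And>i X Y. (\<And>j. j < i \<Longrightarrow> X j = Y j) \<Longrightarrow> v i X = v i Y"
  shows "l \<le> n \<Longrightarrow> (\<integral>\<^sup>+X. f X \<partial>gaussian_sample n d)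
    = (\<integral>\<^sup>+X. f (shear d v l X) * ennreal (exp (- shear_cost d v l X)) \<partial>gaussian_sample n d)"
proof (induction l)
  case 0
  then show ?case by (simp add: shear_def shear_cost_def)
next
  case (Suc l)
  let ?g = "\<lambda>X. f (shear d v l X) * ennreal (exp (- shear_cost d v l X))"
  let ?m = "Suc l"
  have l: "l \<le> n" and m: "?m \<in> {1..n}" using Suc.prems by auto
  have g: "?g \<in> borel_measurable (gaussian_sample n d)"
  proof -
    note [measurable] = measurable_shear(2)[OF v l] measurable_compose[OF measurable_shear(1)[OF v l] f]
    show ?thesis by measurable
  qed
  have "(\<integral>\<^sup>+X. f X \<partial>gaussian_sample n d) = (\<integral>\<^sup>+X. ?g X \<partial>gaussian_sample n d)"
    using Suc.IH l by simp
  also have "\<dots> = (\<integral>\<^sup>+X. ?g (X(?m := \<lambda>k\<in>{..<d}. X ?m k + v ?m X k))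
      * ennreal (exp (- (dot d (v ?m X) (X ?m) + dot d (v ?m X) (v ?m X) / 2))) \<partial>gaussian_sample n d)"
  proof (rule nn_integral_gaussian_sample_shift[OF m g v])
    show "v ?m (X(?m := y)) k = v ?m X k" for X y k
      by (rule fun_cong[OF past]) auto
  qed (use m in auto)
  also have "\<dots> = (\<integral>\<^sup>+X. f (shear d v ?m X) * ennreal (exp (- shear_cost d v ?m X)) \<partial>gaussian_sample n d)"
  proof (rule nn_integral_cong)
    fix X
    let ?X = "X(?m := \<lambda>k\<in>{..<d}. X ?m k + v ?m X k)"
    have v_eq: "v i ?X = v i X" if "i \<le> ?m" for i
      using that by (intro past) auto
    have "shear d v l ?X = shear d v ?m X"
      by (rule ext) (auto simp: shear_def v_eq le_Suc_eq)
    moreover have "shear_cost d v l ?X = shear_cost d v l X"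
      unfolding shear_cost_def by (intro sum.cong refl) (auto simp: v_eq)
    moreover have "shear_cost d v ?m X = shear_cost d v l X + (dot d (v ?m X) (X ?m) + dot d (v ?m X) (v ?m X) / 2)"
      unfolding shear_cost_def by simp
    ultimately show "?g ?X * ennreal (exp (- (dot d (v ?m X) (X ?m) + dot d (v ?m X) (v ?m X) / 2)))
      = f (shear d v ?m X) * ennreal (exp (- shear_cost d v ?m X))"
      by (simp add: mult.assoc ennreal_mult[symmetric] exp_add[symmetric])
  qed
  finally show ?case .
qed

text \<open>Change variables in the integral of the indicator of A and keep only the contribution of
  G, where the density is at least exp (-B).\<close>

lemma measure_ge_by_shear:
  assumes A: "A \<in> sets (gaussian_sample n d)" and G: "G \<in> sets (gaussian_sample n d)"
    and v: "\<And>i k. i \<in> {1..n} \<Longrightarrow> k < d \<Longrightarrow> (\<lambda>X. v i X k) \<in> borel_measurable (gaussian_sample n d)"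
    and past: "\<And>i X Y. (\<And>j. j < i \<Longrightarrow> X j = Y j) \<Longrightarrow> v i X = v i Y"
    and shear: "\<And>X. X \<in> G \<Longrightarrow> shear d v n X \<in> A" and cost: "\<And>X. X \<in> G \<Longrightarrow> shear_cost d v n X \<le> B"
  shows "exp (- B) * measure (gaussian_sample n d) G \<le> measure (gaussian_sample n d) A"
proof -
  interpret prob_space "gaussian_sample n d" by (rule prob_space_gaussian_sample)
  have "ennreal (exp (- B)) * emeasure (gaussian_sample n d) G
      = (\<integral>\<^sup>+X. ennreal (exp (- B)) * indicator G X \<partial>gaussian_sample n d)"
    using G by (simp add: nn_integral_cmult_indicator)
  also have "\<dots> \<le> (\<integral>\<^sup>+X. indicator A (shear d v n X) * ennreal (exp (- shear_cost d v n X)) \<partial>gaussian_sample n d)"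
    using shear cost by (intro nn_integral_mono) (auto simp: indicator_def intro!: ennreal_leI)
  also have "\<dots> = (\<integral>\<^sup>+X. indicator A X \<partial>gaussian_sample n d)"
    using A by (intro nn_integral_gaussian_sample_shear[symmetric] v past) auto
  also have "\<dots> = emeasure (gaussian_sample n d) A" using A by simp
  finally show ?thesis by (simp add: emeasure_eq_measure ennreal_mult[symmetric])
qed

subsection \<open>Lower bound\<close>

text \<open>Markov's inequality for a count: each missing edge carries an error of at least
  \<open>r\<close>, so at most W / r are missing. The errors are summed over ordered pairs to fit
  Frobenius norms.\<close>

lemma card_rgg_edges_ge:
  assumes r: "0 < r" and err: "\<And>i j. 0 \<le> err i j"
    and nonedge: "\<And>i j. i \<in> {1..n} \<Longrightarrow> j \<in> {i<..n} \<Longrightarrow> dot d (X i) (X j) < t \<Longrightarrow> r \<le> err i j"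
    and W: "(\<Sum>i\<in>{1..n}. \<Sum>j\<in>{1..n}. err i j) \<le> W"
  shows "real (n choose 2) - W / r \<le> real (card (rgg_edges n d t X))"
proof -
  have "real (n choose 2) - real (card (rgg_edges n d t X)) = (\<Sum>i\<in>{1..n}. \<Sum>j\<in>{i<..n}. 1 - of_bool (t \<le> dot d (X i) (X j)))"
    unfolding card_rgg_edges sum_pairs_eq_choose[symmetric] by (simp only: sum_subtractf)
  also have "\<dots> \<le> (\<Sum>i\<in>{1..n}. \<Sum>j\<in>{i<..n}. err i j / r)"
  proof (intro sum_mono)
    fix i j assume ij: "i \<in> {1..n}" "j \<in> {i<..n}"
    show "1 - of_bool (t \<le> dot d (X i) (X j)) \<le> err i j / r"
      using nonedge[OF ij] err[of i j] r by (cases "t \<le> dot d (X i) (X j)") auto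
  qed
  also have "\<dots> \<le> (\<Sum>i\<in>{1..n}. \<Sum>j\<in>{1..n}. err i j / r)"
    using r err by (intro sum_mono sum_mono2) auto
  also have "\<dots> = (\<Sum>i\<in>{1..n}. \<Sum>j\<in>{1..n}. err i j) / r"
    by (simp add: sum_divide_distrib)
  also have "\<dots> \<le> W / r" using W r by (intro divide_right_mono) auto
  finally show ?thesis by simp
qed

text \<open>The map is I + \<alpha> L with L the strictly lower triangular matrix of ones.
  Cauchy-Schwarz bounds the operator norm of L by n, so the map at most doubles lengths when
  \<alpha> n \<le> 1.\<close>

lemma sum_add_partial_sums_square_le:
  fixes e :: "nat \<Rightarrow> real"
  assumes \<alpha>: "0 \<le> \<alpha>" "\<alpha> * real n \<le> 1"
  shows "(\<Sum>j\<in>{1..n}. (e j + \<alpha> * (\<Sum>k\<in>{1..<j}. e k))\<^sup>2) \<le> 4 * (\<Sum>j\<in>{1..n}. (e j)\<^sup>2)"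
proof -
  let ?s = "\<Sum>j\<in>{1..n}. (e j)\<^sup>2"
  have s: "0 \<le> ?s" by (simp add: sum_nonneg)
  have "(e j + \<alpha> * (\<Sum>k\<in>{1..<j}. e k))\<^sup>2 \<le> 2 * (e j)\<^sup>2 + 2 * (\<alpha>\<^sup>2 * (real n * ?s))" if j: "j \<in> {1..n}" for j
  proof -
    have "(\<Sum>k\<in>{1..<j}. 1 * e k)\<^sup>2 \<le> (\<Sum>k\<in>{1..<j}. 1\<^sup>2) * (\<Sum>k\<in>{1..<j}. (e k)\<^sup>2)"
      by (rule Cauchy_Schwarz_ineq_sum)
    also have "\<dots> \<le> real n * ?s"
      using j by (intro mult_mono sum_mono2) (auto simp: sum_nonneg)
    finally have "\<alpha>\<^sup>2 * (\<Sum>k\<in>{1..<j}. e k)\<^sup>2 \<le> \<alpha>\<^sup>2 * (real n * ?s)"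
      by (intro mult_left_mono) auto
    then have "(\<alpha> * (\<Sum>k\<in>{1..<j}. e k))\<^sup>2 \<le> \<alpha>\<^sup>2 * (real n * ?s)" by (simp add: power_mult_distrib)
    moreover have "(x + y)\<^sup>2 \<le> 2 * x\<^sup>2 + 2 * y\<^sup>2" for x y :: real
      using sum_squares_bound[of x y] by (simp add: power2_sum)
    ultimately show ?thesis by (smt (verit, best))
  qed
  then have "(\<Sum>j\<in>{1..n}. (e j + \<alpha> * (\<Sum>k\<in>{1..<j}. e k))\<^sup>2) \<le> (\<Sum>j\<in>{1..n}. 2 * (e j)\<^sup>2 + 2 * (\<alpha>\<^sup>2 * (real n * ?s)))"
    by (rule sum_mono)
  also have "\<dots> = 2 * ?s + 2 * (\<alpha> * real n)\<^sup>2 * ?s"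
    by (simp add: sum.distrib sum_distrib_left[symmetric] power2_eq_square)
  also have "\<dots> \<le> 2 * ?s + 2 * 1 * ?s"
    using \<alpha> s by (intro add_mono mult_right_mono mult_left_mono power_le_one) auto
  finally show ?thesis by simp
qed

text \<open>The second condition controls the cross terms and the cost of the translation in the
  first coordinate. By Markov's inequality the constants 9 and 4 give exceptional probabilities 2/9
  and 1/4, together less than 1/2.\<close>

definition typical :: "nat \<Rightarrow> nat \<Rightarrow> (nat \<Rightarrow> nat \<Rightarrow> real) set" where
  "typical n d = {X \<in> space (gaussian_sample n d).
     gram_dev_sq n d X \<le> 9 * (real n)\<^sup>2 * real d \<and> (\<Sum>i\<in>{1..n}. (X i 0)\<^sup>2) \<le> 4 * real n}"

lemma measurable_entry [measurable]:
  "i \<in> {1..n} \<Longrightarrow> k < d \<Longrightarrow> (\<lambda>X. X i k) \<in> borel_measurable (gaussian_sample n d)"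
  by (rule measurable_compose[OF measurable_gaussian_sample_component measurable_coordinate])

lemma typical_measurable:
  assumes "0 < d"
  shows "typical n d \<in> sets (gaussian_sample n d)"
  using assms unfolding typical_def by measurable

lemma measure_typical_ge:
  assumes n: "0 < n" and d: "0 < d"
  shows "1 / 2 \<le> measure (gaussian_sample n d) (typical n d)"
proof -
  interpret prob_space "gaussian_sample n d" by (rule prob_space_gaussian_sample)
  let ?G = "gaussian_sample n d"
  define B1 where "B1 = {X \<in> space ?G. 9 * (real n)\<^sup>2 * real d \<le> gram_dev_sq n d X}"
  define B2 where "B2 = {X \<in> space ?G. 4 * real n \<le> (\<Sum>i\<in>{1..n}. (X i 0)\<^sup>2)}"
  have meas: "B1 \<in> sets ?G" "B2 \<in> sets ?G" unfolding B1_def B2_def using d by measurable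
  have "measure ?G B1 \<le> (2 * (real n)\<^sup>2 * real d) / (9 * (real n)\<^sup>2 * real d)"
    unfolding B1_def using n d nn_integral_gram_dev_sq
    by (intro measure_ge_le_nn_integral prob_space_axioms) auto
  also have "\<dots> = 2 / 9" using n d by simp
  finally have B1: "measure ?G B1 \<le> 2 / 9" .
  have "measure ?G B2 \<le> real n / (4 * real n)"
    unfolding B2_def
  proof (rule measure_ge_le_nn_integral)
    have "(\<integral>\<^sup>+X. ennreal (\<Sum>i\<in>{1..n}. (X i 0)\<^sup>2) \<partial>?G) = (\<integral>\<^sup>+X. (\<Sum>i\<in>{1..n}. ennreal ((X i 0)\<^sup>2)) \<partial>?G)"
      by (intro nn_integral_cong) (simp add: sum_ennreal)
    also have "\<dots> = (\<Sum>i\<in>{1..n}. (\<integral>\<^sup>+X. ennreal ((X i 0)\<^sup>2) \<partial>?G))"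
      using d by (intro nn_integral_sum) measurable
    also have "\<dots> = (\<Sum>i\<in>{1..n}. 1)"
    proof (intro sum.cong refl)
      fix i assume i: "i \<in> {1..n}"
      have [measurable]: "(\<lambda>x. x 0) \<in> borel_measurable (std_gaussian d)" by (rule measurable_coordinate[OF d])
      have "(\<integral>\<^sup>+X. ennreal ((X i 0)\<^sup>2) \<partial>?G) = (\<integral>\<^sup>+x. ennreal ((x 0)\<^sup>2) \<partial>std_gaussian d)"
        unfolding gaussian_sample_def using i
        by (intro nn_integral_PiM_component[where f = "\<lambda>x. ennreal ((x 0)\<^sup>2)"] prob_space_std_gaussian) measurable
      then show "(\<integral>\<^sup>+X. ennreal ((X i 0)\<^sup>2) \<partial>?G) = 1" by (simp add: nn_integral_coordinate_square[OF d])
    qed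
    finally show "(\<integral>\<^sup>+X. ennreal (\<Sum>i\<in>{1..n}. (X i 0)\<^sup>2) \<partial>?G) \<le> ennreal (real n)"
      by (simp add: ennreal_of_nat_eq_real_of_nat)
    show "(\<lambda>X. \<Sum>i\<in>{1..n}. (X i 0)\<^sup>2) \<in> borel_measurable ?G" using d by measurable
  qed (use n prob_space_axioms in auto)
  also have "\<dots> = 1 / 4" using n by simp
  finally have B2: "measure ?G B2 \<le> 1 / 4" .
  have "measure ?G (B1 \<union> B2) \<le> 1 / 2" using measure_Un_le[OF meas] B1 B2 by linarith
  then have "1 / 2 \<le> measure ?G (space ?G - (B1 \<union> B2))"
    using meas by (subst prob_compl) auto
  also have "\<dots> \<le> measure ?G (typical n d)"
  proof (rule finite_measure_mono[OF _ typical_measurable[OF d]], rule subsetI)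
    fix X assume "X \<in> space ?G - (B1 \<union> B2)"
    then show "X \<in> typical n d"
      unfolding typical_def B1_def B2_def by (simp only: mem_Collect_eq Diff_iff Un_iff) (metis linear)
  qed
  finally show ?thesis .
qed

lemma typical_sqrt_gram_dev_sq:
  assumes "X \<in> typical n d"
  shows "sqrt (gram_dev_sq n d X) \<le> 3 * real n * sqrt (real d)"
proof -
  have "gram_dev_sq n d X \<le> (3 * real n * sqrt (real d))\<^sup>2"
    using assms by (simp add: typical_def power_mult_distrib)
  then show ?thesis by (simp add: real_le_lsqrt)
qed

text \<open>Cauchy-Schwarz against weights of Frobenius norm at most n. The weights will be
  indicators of triangular or square index sets, so partial sums of deviations obey the same
  bound.\<close>

lemma sum_gram_dev_le:
  assumes w: "\<And>i j. \<bar>w i j\<bar> \<le> 1"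
  shows "(\<Sum>i\<in>{1..n}. \<Sum>j\<in>{1..n}. w i j * gram_dev d X i j) \<le> real n * sqrt (gram_dev_sq n d X)"
proof (rule power2_le_imp_le)
  have "(\<Sum>i\<in>{1..n}. \<Sum>j\<in>{1..n}. w i j * gram_dev d X i j)\<^sup>2 \<le> (\<Sum>i\<in>{1..n}. \<Sum>j\<in>{1..n}. (w i j)\<^sup>2) * gram_dev_sq n d X"
    unfolding gram_dev_sq_def by (rule Cauchy_Schwarz_ineq_sum_sum)
  also have "\<dots> \<le> (\<Sum>i\<in>{1..n}. \<Sum>j\<in>{1..n}. 1) * gram_dev_sq n d X"
    using w by (intro mult_right_mono sum_mono gram_dev_sq_nonneg) (simp add: abs_square_le_1)
  also have "\<dots> = (real n * sqrt (gram_dev_sq n d X))\<^sup>2"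
    by (simp add: power_mult_distrib gram_dev_sq_nonneg power2_eq_square)
  finally show "(\<Sum>i\<in>{1..n}. \<Sum>j\<in>{1..n}. w i j * gram_dev d X i j)\<^sup>2 \<le> (real n * sqrt (gram_dev_sq n d X))\<^sup>2" .
qed (simp add: gram_dev_sq_nonneg)

text \<open>Only strictly smaller indices occur, so row 1 stays fixed. For i < j the inner product
  of the new rows gains \<alpha> |X i|^2, which is about \<alpha> d.\<close>

definition cumulative_shift :: "real \<Rightarrow> nat \<Rightarrow> (nat \<Rightarrow> nat \<Rightarrow> real) \<Rightarrow> nat \<Rightarrow> real" where
  "cumulative_shift \<alpha> i X k = (\<Sum>j\<in>{1..<i}. \<alpha> * X j k)"

text \<open>By rotation invariance any direction would do; a coordinate direction keeps the inner
  products explicit.\<close>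

definition first_coordinate_shift :: "real \<Rightarrow> nat \<Rightarrow> (nat \<Rightarrow> nat \<Rightarrow> real) \<Rightarrow> nat \<Rightarrow> real" where
  "first_coordinate_shift \<beta> i X k = (if k = 0 then \<beta> else 0)"

lemma dot_shear:
  assumes "i \<in> {1..l}"
  shows "dot d w (shear d v l X i) = dot d w (X i) + dot d w (v i X)"
proof -
  have "dot d w (shear d v l X i) = (\<Sum>k<d. w k * X i k + w k * v i X k)"
    unfolding dot_def using assms by (intro sum.cong) (auto simp: shear_def algebra_simps)
  then show ?thesis by (simp add: dot_def sum.distrib)
qed

lemma dot_cumulative_shift:
  "dot d w (cumulative_shift \<alpha> i X) = \<alpha> * (\<Sum>j\<in>{1..<i}. dot d w (X j))"
  unfolding cumulative_shift_def[abs_def] dot_sum_right by (simp add: sum_distrib_left)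

lemma dot_first_coordinate_shift:
  assumes "0 < d"
  shows "dot d w (first_coordinate_shift \<beta> i X) = \<beta> * w 0"
  unfolding dot_def first_coordinate_shift_def using assms
  by (subst sum.remove[of _ 0]) (auto simp: mult.commute)

text \<open>
  Writing the shear as \<open>M = I + \<alpha> L\<close>, the Gram matrix becomes \<open>M (d I + E) M\<^sup>T\<close>: the part \<open>D2\<close> coming from
  \<open>d I\<close> has off-diagonal entries at least \<open>\<alpha> d\<close>, and the part \<open>E2\<close> coming from the deviation is
  at most four times larger than \<open>E\<close> in Frobenius norm.
\<close>

lemma cumulative_shear_edges:
  assumes \<alpha>: "0 \<le> \<alpha>" "\<alpha> * real n \<le> 1" and s: "0 < s" "t + s \<le> \<alpha> * real d"
  shows "real (n choose 2) - 16 * gram_dev_sq n d X / s\<^sup>2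
    \<le> real (card (rgg_edges n d t (shear d (cumulative_shift \<alpha>) n X)))"
proof -
  define E where "E = gram_dev d X"
  define D where "D i j = (if i = j then real d else 0)" for i j :: nat
  \<comment> \<open>\<open>E1 i j\<close> belongs to the new row i and the old row j;
    \<open>E2\<close> transforms the second index too. The transposed arguments let both stages add
    partial sums in the last index, as the norm bound requires.\<close>
  define E1 where "E1 i j = E j i + \<alpha> * (\<Sum>l\<in>{1..<i}. E j l)" for i j
  define E2 where "E2 i j = E1 i j + \<alpha> * (\<Sum>l\<in>{1..<j}. E1 i l)" for i j
  define D1 where "D1 i j = D j i + \<alpha> * (\<Sum>l\<in>{1..<i}. D j l)" for i j
  define D2 where "D2 i j = D1 i j + \<alpha> * (\<Sum>l\<in>{1..<j}. D1 i l)" for i j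
  let ?T = "shear d (cumulative_shift \<alpha>) n X"
  have G: "dot d (X i) (X j) = E i j + D i j" for i j
    by (simp add: E_def gram_dev_def D_def)
  have T1: "dot d (X j) (?T i) = E1 i j + D1 i j" if "i \<in> {1..n}" for i j
    unfolding dot_shear[OF that] dot_cumulative_shift G
    by (simp add: E1_def D1_def sum.distrib algebra_simps)
  have T2: "dot d (?T i) (?T j) = E2 i j + D2 i j" if "i \<in> {1..n}" "j \<in> {1..n}" for i j
    unfolding dot_shear[OF that(2)] dot_cumulative_shift dot_commute[of d "?T i"] T1[OF that(1)]
    by (simp add: E2_def D2_def sum.distrib algebra_simps)
  have D1: "D j i \<le> D1 i j" for i j
    using \<alpha> by (simp add: D1_def D_def sum_nonneg)
  have D10: "0 \<le> D1 i j" for i j by (rule order_trans[OF _ D1]) (simp add: D_def)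
  \<comment> \<open>The term l = i, present because i < j, already contributes \<alpha> d; the
    others are nonnegative.\<close>
  have D2: "\<alpha> * real d \<le> D2 i j" if "i \<in> {1..n}" "j \<in> {i<..n}" for i j
  proof -
    have "real d \<le> D1 i i" using D1[of i i] by (simp add: D_def)
    also have "\<dots> \<le> (\<Sum>l\<in>{1..<j}. D1 i l)" using that D10 by (intro member_le_sum) auto
    finally have "\<alpha> * real d \<le> \<alpha> * (\<Sum>l\<in>{1..<j}. D1 i l)" using \<alpha> by (intro mult_left_mono)
    then show ?thesis using D10[of i j] by (simp add: D2_def)
  qed
  show ?thesis
  proof (rule card_rgg_edges_ge[where err = "\<lambda>i j. (E2 i j)\<^sup>2"])
    fix i j assume ij: "i \<in> {1..n}" "j \<in> {i<..n}" and "dot d (?T i) (?T j) < t"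
    then have "E2 i j \<le> - s" using T2[of i j] D2[OF ij] s by auto
    then have "s\<^sup>2 \<le> (- E2 i j)\<^sup>2" using s by (intro power_mono) auto
    then show "s\<^sup>2 \<le> (E2 i j)\<^sup>2" by simp
  next
    have "(\<Sum>i\<in>{1..n}. \<Sum>j\<in>{1..n}. (E2 i j)\<^sup>2) \<le> (\<Sum>i\<in>{1..n}. 4 * (\<Sum>j\<in>{1..n}. (E1 i j)\<^sup>2))"
      unfolding E2_def by (intro sum_mono sum_add_partial_sums_square_le \<alpha>)
    also have "\<dots> = 4 * (\<Sum>j\<in>{1..n}. \<Sum>i\<in>{1..n}. (E1 i j)\<^sup>2)"
      unfolding sum_distrib_left[symmetric] by (subst sum.swap) (rule refl)
    also have "\<dots> \<le> 4 * (\<Sum>j\<in>{1..n}. 4 * (\<Sum>i\<in>{1..n}. (E j i)\<^sup>2))"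
      unfolding E1_def by (intro mult_left_mono sum_mono sum_add_partial_sums_square_le \<alpha>) simp
    also have "\<dots> = 16 * (\<Sum>j\<in>{1..n}. \<Sum>i\<in>{1..n}. (E j i)\<^sup>2)"
      by (simp add: sum_distrib_left)
    also have "\<dots> = 16 * gram_dev_sq n d X"
      by (simp add: gram_dev_sq_def E_def)
    finally show "(\<Sum>i\<in>{1..n}. \<Sum>j\<in>{1..n}. (E2 i j)\<^sup>2) \<le> 16 * gram_dev_sq n d X" .
  qed (use s in auto)
qed

text \<open>The linear part involves only pairs j < i, so the mean d of the diagonal does not enter
  it and only the deviation counts. The diagonal appears in the squared length of each translation,
  as at most \<alpha>^2 n d.\<close>

lemma cumulative_shear_cost:
  assumes \<alpha>: "0 \<le> \<alpha>"
  shows "shear_cost d (cumulative_shift \<alpha>) n X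
    \<le> \<alpha> * real n * sqrt (gram_dev_sq n d X) + \<alpha>\<^sup>2 / 2 * (real n)\<^sup>2 * (sqrt (gram_dev_sq n d X) + real d)"
proof -
  let ?F = "sqrt (gram_dev_sq n d X)"
  let ?w = "\<lambda>i j. of_bool (j < i) :: real"
  have 1: "dot d (cumulative_shift \<alpha> i X) (X i) = \<alpha> * (\<Sum>j\<in>{1..n}. ?w i j * gram_dev d X i j)"
    if "i \<in> {1..n}" for i
  proof -
    have "(\<Sum>j\<in>{1..<i}. dot d (X i) (X j)) = (\<Sum>j\<in>{1..<i}. ?w i j * gram_dev d X i j)"
      by (intro sum.cong) (auto simp: gram_dev_def)
    also have "\<dots> = (\<Sum>j\<in>{1..n}. ?w i j * gram_dev d X i j)"
      using that by (intro sum.mono_neutral_left) auto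
    finally show ?thesis
      unfolding dot_commute[of d "cumulative_shift \<alpha> i X"] dot_cumulative_shift by simp
  qed
  have 2: "dot d (cumulative_shift \<alpha> i X) (cumulative_shift \<alpha> i X) \<le> \<alpha>\<^sup>2 * (real n * ?F + real n * real d)"
    if i: "i \<in> {1..n}" for i
  proof -
    have "dot d (cumulative_shift \<alpha> i X) (cumulative_shift \<alpha> i X)
      = \<alpha>\<^sup>2 * (\<Sum>l\<in>{1..<i}. \<Sum>j\<in>{1..<i}. dot d (X l) (X j))"
      unfolding dot_cumulative_shift dot_commute[of d "cumulative_shift \<alpha> i X"]
      by (simp add: power2_eq_square sum_distrib_left mult.assoc)
    also have "(\<Sum>l\<in>{1..<i}. \<Sum>j\<in>{1..<i}. dot d (X l) (X j))
      = (\<Sum>l\<in>{1..<i}. \<Sum>j\<in>{1..<i}. gram_dev d X l j) + (\<Sum>l\<in>{1..<i}. \<Sum>j\<in>{1..<i}. if l = j then real d else 0)"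
      unfolding sum.distrib[symmetric] by (simp add: gram_dev_def)
    also have "(\<Sum>l\<in>{1..<i}. \<Sum>j\<in>{1..<i}. gram_dev d X l j) = (\<Sum>l\<in>{1..n}. \<Sum>j\<in>{1..n}. (?w i l * ?w i j) * gram_dev d X l j)"
    proof -
      have "(\<Sum>l\<in>{1..<i}. \<Sum>j\<in>{1..<i}. gram_dev d X l j) = (\<Sum>l\<in>{1..<i}. \<Sum>j\<in>{1..n}. (?w i l * ?w i j) * gram_dev d X l j)"
        using i by (intro sum.cong refl sum.mono_neutral_cong_left) auto
      also have "\<dots> = (\<Sum>l\<in>{1..n}. \<Sum>j\<in>{1..n}. (?w i l * ?w i j) * gram_dev d X l j)"
        using i by (intro sum.mono_neutral_left) auto
      finally show ?thesis .
    qed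
    also have "\<dots> \<le> real n * ?F" by (rule sum_gram_dev_le) simp
    also have "(\<Sum>l\<in>{1..<i}. \<Sum>j\<in>{1..<i}. if l = j then real d else 0) \<le> real n * real d"
    proof -
      have "(\<Sum>l\<in>{1..<i}. \<Sum>j\<in>{1..<i}. if l = j then real d else 0) = (\<Sum>l\<in>{1..<i}. real d)"
        by (intro sum.cong) auto
      then show ?thesis using i by (simp add: mult_right_mono)
    qed
    finally show ?thesis by (simp add: mult_left_mono)
  qed
  have "shear_cost d (cumulative_shift \<alpha>) n X
    \<le> (\<Sum>i\<in>{1..n}. \<alpha> * (\<Sum>j\<in>{1..n}. ?w i j * gram_dev d X i j) + \<alpha>\<^sup>2 * (real n * ?F + real n * real d) / 2)"
    unfolding shear_cost_def using 1 2 by (intro sum_mono) simp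
  also have "\<dots> = \<alpha> * (\<Sum>i\<in>{1..n}. \<Sum>j\<in>{1..n}. ?w i j * gram_dev d X i j) + real n * (\<alpha>\<^sup>2 * (real n * ?F + real n * real d) / 2)"
    by (simp add: sum.distrib sum_distrib_left)
  also have "\<alpha> * (\<Sum>i\<in>{1..n}. \<Sum>j\<in>{1..n}. ?w i j * gram_dev d X i j) \<le> \<alpha> * (real n * ?F)"
    by (intro mult_left_mono sum_gram_dev_le \<alpha>) simp
  finally show ?thesis
    by (simp add: power2_eq_square algebra_simps)
qed

text \<open>Every inner product gains \<beta>^2, at least twice \<open>t\<close>, so at a missing
  edge the deviation and the two cross terms add up to at most - \<beta>^2 / 2. Bounding the square
  of three terms gives 27 = 3 * 9 and 24 = 3 * 2 * 4 from the constants of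
  \<open>typical\<close>.\<close>

lemma first_coordinate_shear_edges:
  assumes d: "0 < d" and \<beta>: "0 < \<beta>" "t \<le> \<beta>\<^sup>2 / 2" and X: "X \<in> typical n d"
  shows "real (n choose 2) - (27 * (real n)\<^sup>2 * real d + 24 * (real n)\<^sup>2 * \<beta>\<^sup>2) / (\<beta>\<^sup>2 / 2)\<^sup>2
    \<le> real (card (rgg_edges n d t (shear d (first_coordinate_shift \<beta>) n X)))"
proof -
  let ?T = "shear d (first_coordinate_shift \<beta>) n X"
  have T: "dot d (?T i) (?T j) = dot d (X i) (X j) + \<beta> * X i 0 + \<beta> * X j 0 + \<beta>\<^sup>2"
    if ij: "i \<in> {1..n}" "j \<in> {1..n}" for i j
  proof -
    have "?T i 0 = X i 0 + \<beta>" using ij d by (simp add: shear_def first_coordinate_shift_def)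
    then show ?thesis
      unfolding dot_shear[OF ij(2)] dot_first_coordinate_shift[OF d] dot_commute[of d "?T i"] dot_shear[OF ij(1)]
      by (simp add: dot_commute algebra_simps power2_eq_square)
  qed
  define err where "err i j = 3 * ((gram_dev d X i j)\<^sup>2 + \<beta>\<^sup>2 * (X i 0)\<^sup>2 + \<beta>\<^sup>2 * (X j 0)\<^sup>2)" for i j
  show ?thesis
  proof (rule card_rgg_edges_ge[where err = err])
    show "0 < (\<beta>\<^sup>2 / 2)\<^sup>2" using \<beta> by simp
    show "0 \<le> err i j" for i j by (simp add: err_def)
  next
    fix i j assume ij: "i \<in> {1..n}" "j \<in> {i<..n}" and "dot d (?T i) (?T j) < t"
    then have "gram_dev d X i j + \<beta> * X i 0 + \<beta> * X j 0 \<le> - (\<beta>\<^sup>2 / 2)"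
      using T[of i j] \<beta> by (auto simp: gram_dev_def)
    then have "(\<beta>\<^sup>2 / 2)\<^sup>2 \<le> (- (gram_dev d X i j + \<beta> * X i 0 + \<beta> * X j 0))\<^sup>2"
      using \<beta> by (intro power_mono) auto
    also have "\<dots> = (gram_dev d X i j + \<beta> * X i 0 + \<beta> * X j 0)\<^sup>2" by (rule power2_minus)
    also have "\<dots> \<le> err i j"
      using square_sum3_le[of "gram_dev d X i j" "\<beta> * X i 0" "\<beta> * X j 0"]
      by (simp add: err_def power_mult_distrib)
    finally show "(\<beta>\<^sup>2 / 2)\<^sup>2 \<le> err i j" .
  next
    let ?S = "\<Sum>i\<in>{1..n}. (X i 0)\<^sup>2"
    have "(\<Sum>i\<in>{1..n}. \<Sum>j\<in>{1..n}. err i j) = 3 * (gram_dev_sq n d X + 2 * real n * \<beta>\<^sup>2 * ?S)"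
      unfolding err_def gram_dev_sq_def
      by (simp add: sum.distrib sum_distrib_left[symmetric] algebra_simps)
    also have "\<dots> \<le> 3 * (9 * (real n)\<^sup>2 * real d + 2 * real n * \<beta>\<^sup>2 * (4 * real n))"
      using X unfolding typical_def by (intro mult_left_mono add_mono) auto
    also have "\<dots> = 27 * (real n)\<^sup>2 * real d + 24 * (real n)\<^sup>2 * \<beta>\<^sup>2"
      by (simp add: power2_eq_square algebra_simps)
    finally show "(\<Sum>i\<in>{1..n}. \<Sum>j\<in>{1..n}. err i j) \<le> 27 * (real n)\<^sup>2 * real d + 24 * (real n)\<^sup>2 * \<beta>\<^sup>2" .
  qed
qed

lemma first_coordinate_shear_cost:
  assumes d: "0 < d" and \<beta>: "0 < \<beta>" and X: "X \<in> typical n d"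
  shows "shear_cost d (first_coordinate_shift \<beta>) n X \<le> 2 * \<beta> * real n + real n * \<beta>\<^sup>2 / 2"
proof -
  have "(\<Sum>i\<in>{1..n}. 1 * X i 0)\<^sup>2 \<le> (\<Sum>i\<in>{1..n}. 1\<^sup>2) * (\<Sum>i\<in>{1..n}. (X i 0)\<^sup>2)"
    by (rule Cauchy_Schwarz_ineq_sum)
  also have "\<dots> \<le> real n * (4 * real n)"
    using X by (simp add: typical_def mult_left_mono)
  also have "\<dots> = (2 * real n)\<^sup>2" by (simp add: power2_eq_square)
  finally have "(\<Sum>i\<in>{1..n}. 1 * X i 0) \<le> 2 * real n" by (rule power2_le_imp_le) simp
  then have "\<beta> * (\<Sum>i\<in>{1..n}. X i 0) \<le> \<beta> * (2 * real n)" using \<beta> by (intro mult_left_mono) auto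
  moreover have "shear_cost d (first_coordinate_shift \<beta>) n X = (\<Sum>i\<in>{1..n}. \<beta> * X i 0 + \<beta> * \<beta> / 2)"
    unfolding shear_cost_def dot_first_coordinate_shift[OF d] dot_commute[of d "first_coordinate_shift \<beta> _ X" "X _"]
    by (simp add: first_coordinate_shift_def)
  ultimately show ?thesis
    by (simp add: sum.distrib sum_distrib_left power2_eq_square algebra_simps)
qed

text \<open>The probability 1/2 of typical samples is paid for by one more unit in the exponent: m
  \<ge> 1 gives exp (-m) \<le> 1/2.\<close>

lemma measure_edges_ge_by_shear:
  assumes n: "2 \<le> n" and d: "0 < d"
    and v: "\<And>i k. i \<in> {1..n} \<Longrightarrow> k < d \<Longrightarrow> (\<lambda>X. v i X k) \<in> borel_measurable (gaussian_sample n d)"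
    and past: "\<And>i X Y. (\<And>j. j < i \<Longrightarrow> X j = Y j) \<Longrightarrow> v i X = v i Y"
    and edges: "\<And>X. X \<in> typical n d \<Longrightarrow> e \<le> real (card (rgg_edges n d t (shear d v n X)))"
    and cost: "\<And>X. X \<in> typical n d \<Longrightarrow> shear_cost d v n X \<le> B * m" and m: "1 \<le> m"
  shows "exp (- (B + 1) * m) \<le> measure (gaussian_sample n d)
    {X \<in> space (gaussian_sample n d). e \<le> real (card (rgg_edges n d t X))}"
proof -
  note [measurable] = measurable_card_rgg_edges
  have "exp (- m) \<le> 1 / 2"
  proof -
    have "1 + m \<le> exp m" by (rule exp_ge_add_one_self)
    then have "2 \<le> exp m" using m by linarith
    then show ?thesis by (simp add: exp_minus field_simps)
  qed
  also have "\<dots> \<le> measure (gaussian_sample n d) (typical n d)"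
    using n d by (intro measure_typical_ge) auto
  finally have "exp (- (B * m)) * exp (- m) \<le> exp (- (B * m)) * measure (gaussian_sample n d) (typical n d)"
    by (intro mult_left_mono) auto
  also have "\<dots> \<le> measure (gaussian_sample n d) {X \<in> space (gaussian_sample n d). e \<le> real (card (rgg_edges n d t X))}"
  proof (rule measure_ge_by_shear[OF _ typical_measurable[OF d] v past])
    fix X assume X: "X \<in> typical n d"
    then have "X \<in> space (gaussian_sample n d)" by (simp add: typical_def)
    from measurable_space[OF measurable_shear(1)[OF v order_refl] this] edges[OF X]
    show "shear d v n X \<in> {X \<in> space (gaussian_sample n d). e \<le> real (card (rgg_edges n d t X))}" by simp
    show "shear_cost d v n X \<le> B * m" by (rule cost[OF X])
  qed measurable
  also have "exp (- (B * m)) * exp (- m) = exp (- (B + 1) * m)"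
    unfolding exp_add[symmetric] by (simp add: algebra_simps)
  finally show ?thesis .
qed

text \<open>All that is used of \<open>t\<close> is that it is at most of order sqrt d: for a large
  parameter \<open>a\<close>, either change of variables lifts all but a proportion 1 - q of the
  pairs above it.\<close>

lemma upper_tail_ge:
  fixes p q :: real
  assumes p: "0 < p" and q: "q < 1"
  shows "\<exists>c>0. \<forall>n d t. 2 \<le> n \<longrightarrow> 0 < d \<longrightarrow> is_threshold p d t \<longrightarrow>
    exp (- c * min ((real n)\<^sup>2) (real n * sqrt (real d)))
      \<le> measure (gaussian_sample n d) {X \<in> space (gaussian_sample n d).
           q * real (n choose 2) \<le> real (card (rgg_edges n d t X))}"
proof -
  define \<rho> where "\<rho> = 1 - q"
  have \<rho>: "0 < \<rho>" using q by (simp add: \<rho>_def)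
  \<comment> \<open>The second term gives t \<le> (a / 2) sqrt d. The third gives 48^2 = 2304 \<le>
    \<rho> a^2, so a loss of 576 n^2 / a^2 edges is at most \<rho> n^2 / 4, hence at most \<rho>
    times the number of pairs.\<close>
  define a where "a = 1 + 2 / sqrt p + 48 / sqrt \<rho>"
  have a1: "1 \<le> a" and ap: "2 / sqrt p \<le> a" and a\<rho>: "48 / sqrt \<rho> \<le> a"
    using p \<rho> by (simp_all add: a_def)
  have "(48 / sqrt \<rho>)\<^sup>2 \<le> a\<^sup>2" using a\<rho> \<rho> by (intro power_mono) auto
  then have a2: "2304 \<le> \<rho> * a\<^sup>2" using \<rho> by (simp add: power_divide field_simps)
  have aa: "a \<le> a\<^sup>2" using a1 by (simp add: power2_eq_square)
  \<comment> \<open>The first two summands cover the cost of the cumulative shift, the last that of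
    the shift in the first coordinate.\<close>
  define B where "B = 3 * a + (3 * a + a\<^sup>2) / 2 + a * (2 * a + a\<^sup>2 / 2)"
  have B0: "0 \<le> B" using a1 by (simp add: B_def)
  show ?thesis
  proof (intro exI[of _ "B + 1"] conjI allI impI)
    show "0 < B + 1" using B0 by simp
    fix n d :: nat and t :: real
    assume n: "2 \<le> n" and d: "0 < d" and t: "is_threshold p d t"
    let ?N = "real (n choose 2)" and ?r = "sqrt (real d)"
    define m where "m = min ((real n)\<^sup>2) (real n * ?r)"
    have r1: "1 \<le> ?r" using d by simp
    have r2: "?r * ?r = real d" by simp
    have n1: "1 \<le> real n" using n by simp
    have m1: "1 \<le> m"
      using n1 r1 mult_mono[of 1 "real n" 1 ?r] by (simp add: m_def one_le_power)
    have N: "(real n)\<^sup>2 / 4 \<le> ?N" by (rule choose_two_ge[OF n])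
    have tr: "t \<le> a / 2 * ?r"
    proof -
      have "t \<le> sqrt (real d / p)" using t p by (rule threshold_le)
      also have "\<dots> = 2 / sqrt p / 2 * ?r" by (simp add: real_sqrt_divide)
      also have "\<dots> \<le> a / 2 * ?r" using ap by (intro mult_right_mono divide_right_mono) auto
      finally show ?thesis .
    qed
    have lost: "q * ?N \<le> ?N - W" if "W \<le> 576 * (real n)\<^sup>2 / a\<^sup>2" for W
    proof -
      have "576 * (real n)\<^sup>2 / a\<^sup>2 \<le> \<rho> * ((real n)\<^sup>2 / 4)"
      proof -
        have "2304 * (real n)\<^sup>2 \<le> (\<rho> * a\<^sup>2) * (real n)\<^sup>2" by (intro mult_right_mono a2) simp
        then show ?thesis using a1 by (simp add: divide_le_eq mult_ac)
      qed
      also have "\<dots> \<le> \<rho> * ?N" using \<rho> N by (intro mult_left_mono) auto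
      finally show ?thesis using that by (simp add: \<rho>_def algebra_simps)
    qed
    show "exp (- (B + 1) * min ((real n)\<^sup>2) (real n * ?r))
      \<le> measure (gaussian_sample n d) {X \<in> space (gaussian_sample n d). q * ?N \<le> real (card (rgg_edges n d t X))}"
      unfolding m_def[symmetric]
      \<comment> \<open>For \<open>n \<lesssim> \<surd>d\<close> correlating all vectors slightly costs \<open>n\<^sup>2\<close>; otherwise moving all of them by
        \<open>\<beta> \<approx> d\<close> to the power \<open>1/4\<close> in one direction costs \<open>n \<surd>d\<close>.\<close>
    proof (cases "a * real n \<le> ?r")
      case True
      \<comment> \<open>The case condition becomes \<alpha> n \<le> 1. Of the gain \<alpha> d = a
        sqrt d, one half covers \<open>t\<close> and the other half is the margin against the
        deviation.\<close>
      define \<alpha> where "\<alpha> = a / ?r"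
      have \<alpha>: "0 \<le> \<alpha>" "\<alpha> * real n \<le> 1" using True a1 r1 by (simp_all add: \<alpha>_def divide_le_eq)
      have \<alpha>r: "\<alpha> * ?r = a" using r1 by (simp add: \<alpha>_def)
      have \<alpha>d: "\<alpha> * real d = a * ?r" using \<alpha>r r2 by (metis mult.assoc)
      have "1 * real n \<le> a * real n" using a1 by (intro mult_right_mono) auto
      then have "real n \<le> ?r" using True by linarith
      then have m: "m = (real n)\<^sup>2" by (simp add: m_def power2_eq_square mult_left_mono min_absorb1)
      show "exp (- (B + 1) * m) \<le> measure (gaussian_sample n d) {X \<in> space (gaussian_sample n d). q * ?N \<le> real (card (rgg_edges n d t X))}"
      proof (rule measure_edges_ge_by_shear[OF n d, where v = "cumulative_shift \<alpha>"])
        show "(\<lambda>X. cumulative_shift \<alpha> i X k) \<in> borel_measurable (gaussian_sample n d)"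
          if "i \<in> {1..n}" "k < d" for i k
          unfolding cumulative_shift_def using that
          by (intro borel_measurable_sum borel_measurable_times borel_measurable_const measurable_entry) auto
        show "cumulative_shift \<alpha> i X = cumulative_shift \<alpha> i Y" if "\<And>j. j < i \<Longrightarrow> X j = Y j" for i X Y
          unfolding cumulative_shift_def[abs_def] using that by (intro ext sum.cong) auto
      next
        fix X assume X: "X \<in> typical n d"
        have s: "0 < a / 2 * ?r" using a1 r1 by simp
        have "16 * gram_dev_sq n d X / (a / 2 * ?r)\<^sup>2 \<le> 16 * (9 * (real n)\<^sup>2 * real d) / (a / 2 * ?r)\<^sup>2"
          using X by (intro divide_right_mono mult_left_mono) (auto simp: typical_def)
        also have "\<dots> = 576 * (real n)\<^sup>2 / a\<^sup>2"
          using a1 d by (simp add: power_mult_distrib power_divide)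
        finally have "q * ?N \<le> ?N - 16 * gram_dev_sq n d X / (a / 2 * ?r)\<^sup>2" by (rule lost)
        also have "\<dots> \<le> real (card (rgg_edges n d t (shear d (cumulative_shift \<alpha>) n X)))"
          using tr by (intro cumulative_shear_edges \<alpha> s) (simp add: \<alpha>d)
        finally show "q * ?N \<le> real (card (rgg_edges n d t (shear d (cumulative_shift \<alpha>) n X)))" .
        let ?F = "sqrt (gram_dev_sq n d X)"
        have F: "?F \<le> 3 * real n * ?r" by (rule typical_sqrt_gram_dev_sq[OF X])
        have "shear_cost d (cumulative_shift \<alpha>) n X
          \<le> \<alpha> * real n * ?F + \<alpha>\<^sup>2 / 2 * (real n)\<^sup>2 * (?F + real d)"
          by (rule cumulative_shear_cost[OF \<alpha>(1)])
        also have "\<dots> \<le> \<alpha> * real n * (3 * real n * ?r) + \<alpha>\<^sup>2 / 2 * (real n)\<^sup>2 * (3 * real n * ?r + real d)"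
          using F \<alpha> by (intro add_mono mult_left_mono) auto
        also have "\<dots> = (3 * (\<alpha> * ?r) + (3 * (\<alpha> * ?r) * (\<alpha> * real n) + (\<alpha> * ?r) * (\<alpha> * ?r)) / 2) * (real n)\<^sup>2"
          by (simp add: power2_eq_square algebra_simps)
        also have "\<dots> = (3 * a + (3 * a * (\<alpha> * real n) + a * a) / 2) * (real n)\<^sup>2" unfolding \<alpha>r ..
        also have "\<dots> \<le> B * (real n)\<^sup>2"
        proof (rule mult_right_mono)
          have "3 * a * (\<alpha> * real n) + a * a \<le> 3 * a * 1 + a * a"
            using \<alpha> a1 by (intro add_right_mono mult_left_mono) auto
          then have "(3 * a * (\<alpha> * real n) + a * a) / 2 \<le> (3 * a + a\<^sup>2) / 2"
            by (intro divide_right_mono) (simp_all only: mult_1_right power2_eq_square)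
          moreover have "0 \<le> a * (2 * a + a\<^sup>2 / 2)" using a1 by simp
          ultimately show "3 * a + (3 * a * (\<alpha> * real n) + a * a) / 2 \<le> B"
            unfolding B_def by (metis add_increasing2 add_left_mono)
        qed simp
        finally show "shear_cost d (cumulative_shift \<alpha>) n X \<le> B * m" by (simp add: m)
      qed (rule m1)
    next
      case False
      \<comment> \<open>Then \<beta>^2 = a^2 sqrt d, half of which exceeds (a / 2) sqrt d and so
        \<open>t\<close>, because a \<ge> 1.\<close>
      define \<beta> where "\<beta> = a * sqrt ?r"
      have \<beta>: "0 < \<beta>" using a1 d by (simp add: \<beta>_def)
      have \<beta>2: "\<beta>\<^sup>2 = a\<^sup>2 * ?r" by (simp add: \<beta>_def power_mult_distrib)
      have \<beta>r: "\<beta> \<le> a * ?r"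
        unfolding \<beta>_def using a1 r1 by (intro mult_left_mono real_le_lsqrt) (auto simp: power2_eq_square)
      \<comment> \<open>The minimum may still be n^2 here, but sqrt d < a n makes it smaller than n
        sqrt d by at most the factor \<open>a\<close>.\<close>
      have nr: "real n * ?r \<le> a * m"
      proof -
        have "real n * ?r \<le> a * (real n)\<^sup>2"
          using False mult_left_mono[of ?r "a * real n" "real n"] by (simp add: power2_eq_square mult_ac)
        moreover have "real n * ?r \<le> a * (real n * ?r)" using a1 r1 n1 by simp
        ultimately show ?thesis by (simp add: m_def min_def)
      qed
      show "exp (- (B + 1) * m) \<le> measure (gaussian_sample n d) {X \<in> space (gaussian_sample n d). q * ?N \<le> real (card (rgg_edges n d t X))}"
      proof (rule measure_edges_ge_by_shear[OF n d, where v = "first_coordinate_shift \<beta>"])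
        show "(\<lambda>X. first_coordinate_shift \<beta> i X k) \<in> borel_measurable (gaussian_sample n d)" for i k
          unfolding first_coordinate_shift_def by simp
        show "first_coordinate_shift \<beta> i X = first_coordinate_shift \<beta> i Y" for i X Y
          by (simp add: first_coordinate_shift_def[abs_def])
      next
        fix X assume X: "X \<in> typical n d"
        have "(27 * (real n)\<^sup>2 * real d + 24 * (real n)\<^sup>2 * \<beta>\<^sup>2) / (\<beta>\<^sup>2 / 2)\<^sup>2 \<le> 576 * (real n)\<^sup>2 / a\<^sup>2"
        proof -
          have "real d \<le> a\<^sup>2 * real d" using a1 by (simp add: one_le_power mult_le_cancel_right1)
          moreover have "?r \<le> real d" using r1 r2 mult_left_mono[of 1 ?r ?r] by linarith
          then have "\<beta>\<^sup>2 \<le> a\<^sup>2 * real d" unfolding \<beta>2 by (intro mult_left_mono) auto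
          ultimately have "27 * (real n)\<^sup>2 * real d + 24 * (real n)\<^sup>2 * \<beta>\<^sup>2
            \<le> 27 * (real n)\<^sup>2 * (a\<^sup>2 * real d) + 24 * (real n)\<^sup>2 * (a\<^sup>2 * real d)"
            by (intro add_mono mult_left_mono) auto
          \<comment> \<open>27 + 24 is rounded up to 144 so that the loss has the same form 576 n^2
            / a^2 as in the other case.\<close>
          also have "\<dots> \<le> 144 * (real n)\<^sup>2 * (a\<^sup>2 * real d)" by simp
          finally have "(27 * (real n)\<^sup>2 * real d + 24 * (real n)\<^sup>2 * \<beta>\<^sup>2) / (\<beta>\<^sup>2 / 2)\<^sup>2
            \<le> 144 * (real n)\<^sup>2 * (a\<^sup>2 * real d) / (\<beta>\<^sup>2 / 2)\<^sup>2" by (rule divide_right_mono) simp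
          moreover have sq: "(\<beta>\<^sup>2 / 2)\<^sup>2 = a\<^sup>2 * (a\<^sup>2 * real d) / 4"
            unfolding \<beta>2 by (simp add: power2_eq_square)
          moreover have "144 * (real n)\<^sup>2 * (a\<^sup>2 * real d) / (a\<^sup>2 * (a\<^sup>2 * real d) / 4) = 576 * (real n)\<^sup>2 / a\<^sup>2"
          proof -
            have "144 * x * k / (y * k / 4) = 576 * x / y" if "k \<noteq> 0" for x y k :: real
              using that by simp
            then show ?thesis by this (use a1 d in auto)
          qed
          ultimately show ?thesis by (simp only:)
        qed
        then have "q * ?N \<le> ?N - (27 * (real n)\<^sup>2 * real d + 24 * (real n)\<^sup>2 * \<beta>\<^sup>2) / (\<beta>\<^sup>2 / 2)\<^sup>2" by (rule lost)
        also have "\<dots> \<le> real (card (rgg_edges n d t (shear d (first_coordinate_shift \<beta>) n X)))"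
        proof (rule first_coordinate_shear_edges[OF d \<beta> _ X])
          have "a / 2 * ?r \<le> a\<^sup>2 / 2 * ?r" using aa by (intro mult_right_mono) auto
          then show "t \<le> \<beta>\<^sup>2 / 2" using tr by (simp add: \<beta>2)
        qed
        finally show "q * ?N \<le> real (card (rgg_edges n d t (shear d (first_coordinate_shift \<beta>) n X)))" .
        have "shear_cost d (first_coordinate_shift \<beta>) n X \<le> 2 * \<beta> * real n + real n * \<beta>\<^sup>2 / 2"
          by (rule first_coordinate_shear_cost[OF d \<beta> X])
        also have "2 * \<beta> * real n \<le> 2 * (a * ?r) * real n" using \<beta>r by (intro mult_right_mono) auto
        also have "2 * (a * ?r) * real n + real n * \<beta>\<^sup>2 / 2 = (2 * a + a\<^sup>2 / 2) * (real n * ?r)"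
          unfolding \<beta>2 by (simp add: algebra_simps)
        also have "\<dots> \<le> (2 * a + a\<^sup>2 / 2) * (a * m)" using nr a1 by (intro mult_left_mono) auto
        also have "\<dots> = (a * (2 * a + a\<^sup>2 / 2)) * m" by simp
        also have "\<dots> \<le> B * m" using m1 a1 by (intro mult_right_mono) (auto simp: B_def)
        finally show "shear_cost d (first_coordinate_shift \<beta>) n X \<le> B * m" by simp
      qed (rule m1)
    qed
  qed
qed

theorem theorem2p4:
  fixes p \<epsilon> :: real
  assumes "0 < p" "p \<le> 1 / 2" "0 < \<epsilon>" "(1 + \<epsilon>) * p < 1"
  shows "\<exists>c C :: real. c > 0 \<and> C > 0 \<and>
    (\<forall>n d :: nat. \<forall>t :: real. n \<ge> 2 \<longrightarrow> d \<ge> 2 \<longrightarrow> is_threshold p d t \<longrightarrow>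
      (let P = measure (gaussian_sample n d)
                 {X \<in> space (gaussian_sample n d).
                    real (card (rgg_edges n d t X)) \<ge> (1 + \<epsilon>) * real (n choose 2) * p};
           m = min (real n ^ 2) (real n * sqrt (real d))
       in exp (- c * m) \<le> P \<and> P \<le> exp (- C * m)))"
proof -
  \<comment> \<open>Brings the bound into the form of a proportion (1 + \<epsilon>) p of all pairs,
    which is below 1 by assumption and so is admissible for the lower bound.\<close>
  have eq: "(1 + \<epsilon>) * p * real (n choose 2) = (1 + \<epsilon>) * real (n choose 2) * p" for n
    by simp
  obtain c where c: "0 < c" "\<forall>n d t. 2 \<le> n \<longrightarrow> 0 < d \<longrightarrow> is_threshold p d t \<longrightarrow>
    exp (- c * min ((real n)\<^sup>2) (real n * sqrt (real d)))
      \<le> measure (gaussian_sample n d) {X \<in> space (gaussian_sample n d).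
           (1 + \<epsilon>) * real (n choose 2) * p \<le> real (card (rgg_edges n d t X))}"
    using upper_tail_ge[OF assms(1,4)] unfolding eq by blast
  obtain C where C: "0 < C" "\<forall>n d t. 2 \<le> n \<longrightarrow> 0 < d \<longrightarrow> is_threshold p d t \<longrightarrow>
    measure (gaussian_sample n d) {X \<in> space (gaussian_sample n d).
        (1 + \<epsilon>) * real (n choose 2) * p \<le> real (card (rgg_edges n d t X))}
      \<le> exp (- C * min ((real n)\<^sup>2) (real n * sqrt (real d)))"
    using upper_tail_le[OF assms(1,3)] by blast
  show ?thesis
    using c C unfolding Let_def by (intro exI[of _ c] exI[of _ C]) auto
qed

end
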